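(* Let $k = p_1p_2\cdots p_t \geq 6$ be even, where $p_1,\dots,p_t$ are primes, not necessarily distinct. Let $1 \leq i \leq t-1$, and suppose $p_1,\dots,p_i$ are odd primes and at least one of $p_{i+1},\dots,p_t$ equals $2$. If $u \equiv 1 \pmod{p_1p_2\cdots p_i}$ and $g \equiv 0 \pmod{p_{i+1}p_{i+2}\cdots p_t}$, then there exists a $k$-ARCS of $(K_u \times K_g)(2)$.
   Context: $u,g$ are positive integers. For graphs $G,H$, the tensor product $G \times H$ has vertex set $V(G)\times V(H)$, with $(g_1,h_1)$ adjacent to $(g_2,h_2)$ iff $g_1g_2 \in E(G)$ and $h_1h_2 \in E(H)$. For a graph $G$ and positive integer $\lambda$, $G(\lambda)$ is the multigraph obtained by replacing each edge of $G$ by $\lambda$ parallel edges. $K_n$ is the complete graph on $n$ vertices. $(K_u \times K_g)(\lambda)$ is regarded as a $u$-partite multigraph with partite sets $V_j = \{j\}\times V(K_g)$. A partial $C_k$-factor of $(K_u \times K_g)(\lambda)$ is a subgraph which, for some $j$, is a spanning subgraph of $(K_u \times K_g)(\lambda)\setminus V_j$ all of whose components are cycles of length $k$. A $k$-ARCS of $(K_u \times K_g)(\lambda)$ is a partition of its edge multiset into partial $C_k$-factors. *)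

theory Defs
  imports Main "HOL-Library.Multiset" "HOL-Number_Theory.Cong"
begin

text \<open>Edges are unordered pairs, encoded as two-element sets; a multigraph has a multiset of them.\<close>

record 'a sgraph =
  verts :: "'a set"
  edges :: "'a set set"

record 'a mgraph =
  mverts :: "'a set"
  medges :: "'a set multiset"

definition complete_graph :: "nat \<Rightarrow> nat sgraph" where
  "complete_graph n = \<lparr>verts = {0..<n}, edges = {{x, y} |x y. x < n \<and> y < n \<and> x \<noteq> y}\<rparr>"

definition tensor_product :: "'a sgraph \<Rightarrow> 'b sgraph \<Rightarrow> ('a \<times> 'b) sgraph" where
  "tensor_product G H =
     \<lparr>verts = verts G \<times> verts H,
      edges = {{(g1, h1), (g2, h2)} |g1 h1 g2 h2. {g1, g2} \<in> edges G \<and> {h1, h2} \<in> edges H}\<rparr>"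

text \<open>The multigraph \<open>G(\<lambda>)\<close>. As \<^const>\<open>mset_set\<close> sends infinite sets to the empty multiset,
  this is meaningful for graphs with finitely many edges only.\<close>

definition multiply_edges :: "nat \<Rightarrow> 'a sgraph \<Rightarrow> 'a mgraph" where
  "multiply_edges l G = \<lparr>mverts = verts G, medges = repeat_mset l (mset_set (edges G))\<rparr>"

definition induced :: "'a mgraph \<Rightarrow> 'a set \<Rightarrow> 'a mgraph" where
  "induced M W = \<lparr>mverts = mverts M \<inter> W, medges = filter_mset (\<lambda>e. e \<subseteq> W) (medges M)\<rparr>"

definition delete_verts :: "'a mgraph \<Rightarrow> 'a set \<Rightarrow> 'a mgraph" where
  "delete_verts M W = induced M (mverts M - W)"

definition subgraph :: "'a mgraph \<Rightarrow> 'a mgraph \<Rightarrow> bool" where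
  "subgraph F M \<longleftrightarrow>
     mverts F \<subseteq> mverts M \<and> medges F \<subseteq># medges M \<and> (\<forall>e\<in>#medges F. e \<subseteq> mverts F)"

definition spanning_subgraph :: "'a mgraph \<Rightarrow> 'a mgraph \<Rightarrow> bool" where
  "spanning_subgraph F M \<longleftrightarrow> subgraph F M \<and> mverts F = mverts M"

definition adjacency :: "'a mgraph \<Rightarrow> ('a \<times> 'a) set" where
  "adjacency M = {(x, y). {x, y} \<in># medges M}"

definition components :: "'a mgraph \<Rightarrow> 'a mgraph set" where
  "components M = {induced M ((adjacency M)\<^sup>* `` {x}) |x. x \<in> mverts M}"

definition is_cycle :: "nat \<Rightarrow> 'a mgraph \<Rightarrow> bool" where
  "is_cycle k C \<longleftrightarrow>
     (\<exists>vs. length vs = k \<and> distinct vs \<and> mverts C = set vs \<and>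
           medges C = {#{vs ! i, vs ! (Suc i mod k)}. i \<in># mset_set {0..<k}#})"

definition KxK :: "nat \<Rightarrow> nat \<Rightarrow> nat \<Rightarrow> (nat \<times> nat) mgraph" where
  "KxK u g l = multiply_edges l (tensor_product (complete_graph u) (complete_graph g))"

definition partite_set :: "nat \<Rightarrow> nat \<Rightarrow> (nat \<times> nat) set" where
  "partite_set g j = {j} \<times> verts (complete_graph g)"

definition partial_cycle_factor ::
    "nat \<Rightarrow> nat \<Rightarrow> nat \<Rightarrow> nat \<Rightarrow> (nat \<times> nat) mgraph \<Rightarrow> bool" where
  "partial_cycle_factor k u g l F \<longleftrightarrow>
     (\<exists>j \<in> verts (complete_graph u).
        spanning_subgraph F (delete_verts (KxK u g l) (partite_set g j)) \<and>
        (\<forall>C \<in> components F. is_cycle k C))"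

text \<open>The family of factors is a multiset, because two blocks of a partition of the edge multiset
  may use different copies of the same edges and hence be equal. For \<open>u = 1\<close> the edge multiset is
  empty and the only partition is the empty one.\<close>

definition is_ARCS :: "nat \<Rightarrow> nat \<Rightarrow> nat \<Rightarrow> nat \<Rightarrow> (nat \<times> nat) mgraph multiset \<Rightarrow> bool" where
  "is_ARCS k u g l P \<longleftrightarrow>
     (\<forall>F\<in>#P. partial_cycle_factor k u g l F \<and> medges F \<noteq> {#}) \<and>
     (\<Sum>F\<in>#P. medges F) = medges (KxK u g l)"

end

theory Submission
  imports Defs
begin

text \<open>Write \<open>a = p\<^sub>1\<cdots>p\<^sub>i\<close>, which is odd, \<open>b = 2 * c\<close> for the product of the other primes,
  \<open>u = a * m + 1\<close> and \<open>g = b * m'\<close>. A factor missing a part is a permutation \<open>(x, y) \<mapsto> (\<rho> x, \<Lambda>\<^sub>x y)\<close>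
  of the remaining vertices: \<open>\<rho>\<close> runs through cycles of length \<open>a\<close> or \<open>2 * a\<close> of a
  near-2-factorization of \<open>K\<^sub>u(2)\<close>, and the layers \<open>\<Lambda>\<^sub>x\<close> are fixed point free permutations of the
  colours \<open>V(K\<^sub>g)\<close> whose composition around the cycle consists of cycles of length \<open>b\<close> or \<open>c\<close>,
  respectively.

  Cycles of length \<open>2 * a\<close>: the layers are the involutions of a 1-factorization of \<open>K\<^sub>g\<close>, all equal
  around the cycle except for one, which is the next 1-factor in a cyclic order in which
  consecutive 1-factors form cycles of length \<open>b\<close>.

  Cycles of length \<open>a\<close>: for some \<open>b\<close> and \<open>g\<close>, such as \<open>b = g = 4\<close>, a parity obstruction prevents that each
  layer family is a decomposition of \<open>K\<^sub>g\<close>. Here the multiplicity 2 helps. In a near-2-factorization of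
  \<open>K\<^sub>a\<^sub>+\<^sub>1(2)\<close> on the residues modulo \<open>a\<close> and \<open>\<infinity>\<close>, the cycle missing \<open>\<infinity>\<close> shares exactly one
  edge with each of the other cycles. Over these edges a Hamiltonian cycle of the blocks \<open>K\<^sub>b\<close> is
  used once more instead of the 1-factor left over by Walecki's decomposition, and this is
  compensated in the other cycle containing the edge.

  For general \<open>m\<close> one uses frames, filled recursively: commutative quasigroups with holes of type
  \<open>h\<^sup>q\<close> (\<open>q\<close> odd) and \<open>(2 * h)\<^sup>4\<close>, whose pairs carry cycles of length \<open>2 * a\<close>, reduce everything to
  \<open>m \<in> {1, 2, 4}\<close>, and \<open>m = 2, 4\<close> are cyclic constructions modulo \<open>u\<close>.\<close>

section \<open>Permutations with cycles of prescribed length\<close>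

text \<open>The parity obstruction is one of signs. On four colours, three derangements that
  partition the arcs of the complete digraph form, together with the identity, a regular permutation
  group of order 4. So their signs multiply to 1, and so does the product over all layers, whereas
  the three 4-cycles that are wanted as compositions multiply to -1. Exchanging the 1-factor for a
  Hamiltonian cycle in one layer family flips the sign, and the multiplicity 2 allows a second
  factor through the same edge to absorb the exchange. Over base cycles of even length the
  composition needs only half the period, and no exchange is necessary. Frames with equal holes
  cannot produce \<open>m = 2\<close> or \<open>m = 4\<close>: outside one of two holes there is
  only one other hole, so no pair from different holes, and four holes of size one leave three
  points, which cannot be paired.\<close>

definition exper :: "('a \<Rightarrow> 'a) \<Rightarrow> nat \<Rightarrow> 'a \<Rightarrow> bool" where
  "exper f n x \<longleftrightarrow> (f ^^ n) x = x \<and> (\<forall>i. 0 < i \<and> i < n \<longrightarrow> (f ^^ i) x \<noteq> x)"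

lemma exper_step:
  assumes "exper f n x"
  shows "exper f n (f x)"
proof -
  have e: "(f ^^ n) x = x" and ne: "\<And>i. 0 < i \<Longrightarrow> i < n \<Longrightarrow> (f ^^ i) x \<noteq> x"
    using assms by (auto simp: exper_def)
  have "(f ^^ n) (f x) = f x"
    using e by (metis funpow_swap1)
  moreover have "(f ^^ i) (f x) \<noteq> f x" if "0 < i" "i < n" for i
  proof
    assume h: "(f ^^ i) (f x) = f x"
    have n: "n = (n - 1) + 1" using that by simp
    have bk: "(f ^^ (n - 1)) (f x) = x"
      using e n by (metis One_nat_def Suc_eq_plus1 funpow_simps_right(2) o_apply)
    have "(f ^^ i) x = (f ^^ i) ((f ^^ (n - 1)) (f x))" using bk by simp
    also have "\<dots> = (f ^^ (n - 1)) ((f ^^ i) (f x))"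
      by (metis add.commute comp_apply funpow_add)
    also have "\<dots> = x" using h bk by simp
    finally show False using ne that by blast
  qed
  ultimately show ?thesis by (auto simp: exper_def)
qed

lemma exper_funpow: "exper f n x \<Longrightarrow> exper f n ((f ^^ r) x)"
  by (induction r) (auto intro: exper_step)

lemma exper_cong:
  assumes "\<And>v. v \<in> A \<Longrightarrow> f v = f' v" "\<And>v. v \<in> A \<Longrightarrow> f v \<in> A" "x \<in> A"
  shows "exper f n x \<longleftrightarrow> exper f' n x"
proof -
  have "(f ^^ i) x = (f' ^^ i) x \<and> (f ^^ i) x \<in> A" for i
    by (induction i) (use assms in auto)
  then show ?thesis by (auto simp: exper_def)
qed

lemma exper_conj:
  assumes "\<And>v. v \<in> A \<Longrightarrow> f (h v) = h (f' v)" "\<And>v. v \<in> A \<Longrightarrow> f' v \<in> A" "x \<in> A"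
    and "inj_on h A"
  shows "exper f n (h x) \<longleftrightarrow> exper f' n x"
proof -
  have *: "(f ^^ i) (h x) = h ((f' ^^ i) x) \<and> (f' ^^ i) x \<in> A" for i
    by (induction i) (use assms in auto)
  then have "(f ^^ i) (h x) = h x \<longleftrightarrow> (f' ^^ i) x = x" for i
    using assms by (metis inj_on_def)
  then show ?thesis by (auto simp: exper_def)
qed

text \<open>An involution \<open>g\<close> conjugates \<open>f\<close>. This is the form in which a
  1-factor placed before and after a Hamiltonian permutation preserves its cycle length.\<close>

lemma exper_sur_conj:
  assumes "exper f n x" "\<And>v. v \<in> A \<Longrightarrow> g v \<in> A" "\<And>v. v \<in> A \<Longrightarrow> f v \<in> A" "x \<in> A"
    "\<And>v. v \<in> A \<Longrightarrow> g (g v) = v"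
  shows "exper (g \<circ> f \<circ> g) n (g x)"
  using exper_conj[of A "g \<circ> f \<circ> g" g f x n] assms by (auto simp: inj_on_def) metis

lemma exper_inverse:
  assumes "exper f n x" "\<And>v. v \<in> A \<Longrightarrow> g v \<in> A" "\<And>v. v \<in> A \<Longrightarrow> f v \<in> A" "x \<in> A"
    "\<And>v. v \<in> A \<Longrightarrow> g (f v) = v"
  shows "exper g n x"
proof -
  have inA: "(f ^^ i) x \<in> A" for i by (induction i) (use assms in auto)
  have gf: "(g ^^ i) ((f ^^ (i + j)) x) = (f ^^ j) x" for i j
  proof (induction i arbitrary: j)
    case (Suc i)
    have "(g ^^ Suc i) ((f ^^ (Suc i + j)) x) = g ((g ^^ i) ((f ^^ (i + Suc j)) x))"
      by simp
    then show ?case using Suc[of "Suc j"] inA assms by simp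
  qed simp
  have fn: "(f ^^ n) x = x" and ne: "\<And>i. 0 < i \<Longrightarrow> i < n \<Longrightarrow> (f ^^ i) x \<noteq> x"
    using assms(1) by (auto simp: exper_def)
  have "(g ^^ i) x = (f ^^ (n - i)) x" if "i \<le> n" for i
    using gf[of i "n - i"] fn that by simp
  then show ?thesis using ne by (auto simp: exper_def)
qed

lemma exper_translation:
  assumes "0 < n" "x < n"
  shows "exper (\<lambda>w. (w + 1) mod n) n x"
proof -
  have it: "((\<lambda>w. (w + 1) mod n) ^^ i) x = (x + i) mod n" for i
    using assms by (induction i) (auto simp: mod_Suc_eq)
  have "(x + i) mod n \<noteq> x" if "0 < i" "i < n" for i
    using that assms by (cases "x + i < n") (auto simp: mod_if)
  then show ?thesis using assms by (simp add: exper_def it[simplified])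
qed

primrec layers :: "(nat \<Rightarrow> 'a \<Rightarrow> 'a) \<Rightarrow> nat \<Rightarrow> 'a \<Rightarrow> 'a" where
  "layers f 0 y = y"
| "layers f (Suc p) y = f p (layers f p y)"

lemma layers_bij:
  assumes "\<And>p. p < L \<Longrightarrow> bij_betw (f p) G G" "p \<le> L"
  shows "bij_betw (layers f p) G G"
  using assms(2)
proof (induction p)
  case 0
  then show ?case by (auto simp: bij_betw_def inj_on_def)
next
  case (Suc p)
  then have "bij_betw (f p \<circ> layers f p) G G"
    using assms(1)[of p] by (auto intro: bij_betw_trans)
  then show ?case by (simp add: comp_def)
qed

text \<open>A skew product over a cycle of length \<open>L\<close>: the fibre over
  \<open>h 0\<close> is revisited only after multiples of \<open>L\<close> steps, and the return map
  on it is \<open>layers f L\<close>. Hence the periods multiply. The other fibres lie on the same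
  orbits because every layer is a bijection.\<close>

lemma exper_lift_cycle:
  assumes step: "\<And>p y. p < L \<Longrightarrow> y \<in> G \<Longrightarrow> \<phi> (h p, y) = (h (Suc p mod L), f p y)"
    and bij: "\<And>p. p < L \<Longrightarrow> bij_betw (f p) G G"
    and inj: "inj_on h {..<L}"
    and per: "\<And>y. y \<in> G \<Longrightarrow> exper (layers f L) n y"
    and pL: "p < L" and y: "y \<in> G"
  shows "exper \<phi> (L * n) (h p, y)"
proof -
  have L: "0 < L" using pL by simp
  have layG: "layers f r z \<in> G" if "r \<le> L" "z \<in> G" for r z
    using layers_bij[of L f G r] bij that by (meson bij_betwE)
  have run: "(\<phi> ^^ r) (h 0, z) = (h (r mod L), layers f r z)" if "r \<le> L" "z \<in> G" for r z
    using that
  proof (induction r)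
    case (Suc r)
    then show ?case using step[of r "layers f r z"] layG[of r z] by simp
  qed simp
  have powG: "(layers f L ^^ q) z \<in> G" if "z \<in> G" for q z
    by (induction q) (use that layG in auto)
  have round: "(\<phi> ^^ (L * q)) (h 0, z) = (h 0, (layers f L ^^ q) z)" if "z \<in> G" for q z
  proof (induction q)
    case (Suc q)
    have "(\<phi> ^^ (L * Suc q)) (h 0, z) = (\<phi> ^^ L) ((\<phi> ^^ (L * q)) (h 0, z))"
      by (simp add: funpow_add)
    then show ?case using Suc run[of L "(layers f L ^^ q) z"] powG[OF that, of q] by simp
  qed simp
  have base: "exper \<phi> (L * n) (h 0, z)" if z: "z \<in> G" for z
    unfolding exper_def
  proof (intro conjI allI impI)
    show "(\<phi> ^^ (L * n)) (h 0, z) = (h 0, z)"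
      using round[OF z, of n] per[OF z] by (simp add: exper_def)
    fix i assume i: "0 < i \<and> i < L * n"
    define q where "q = i div L"
    define r where "r = i mod L"
    have iqr: "i = r + L * q" and r: "r < L" using L by (auto simp: q_def r_def)
    have q: "q < n" using i by (simp add: q_def less_mult_imp_div_less mult.commute)
    have "(\<phi> ^^ i) (h 0, z) = (\<phi> ^^ r) ((\<phi> ^^ (L * q)) (h 0, z))"
      by (simp add: iqr funpow_add)
    also have "\<dots> = (h r, layers f r ((layers f L ^^ q) z))"
      using round[OF z, of q] run[of r "(layers f L ^^ q) z"] powG[OF z, of q] r by simp
    finally have e: "(\<phi> ^^ i) (h 0, z) = (h r, layers f r ((layers f L ^^ q) z))" .
    show "(\<phi> ^^ i) (h 0, z) \<noteq> (h 0, z)"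
    proof
      assume "(\<phi> ^^ i) (h 0, z) = (h 0, z)"
      then have "h r = h 0" and *: "layers f r ((layers f L ^^ q) z) = z" using e by auto
      then have r0: "r = 0" using inj r L by (auto simp: inj_on_def)
      then have "(layers f L ^^ q) z = z" using * by simp
      moreover have "0 < q" using i iqr r0 by simp
      ultimately show False using per[OF z] q by (auto simp: exper_def)
    qed
  qed
  have "bij_betw (layers f p) G G" using layers_bij[of L f G p] bij pL by simp
  then obtain z where z: "z \<in> G" "layers f p z = y" using y by (metis bij_betw_def imageE)
  then have "(h p, y) = (\<phi> ^^ p) (h 0, z)" using run[of p z] pL by simp
  then show ?thesis using exper_funpow[OF base[OF z(1)], of p] by simp
qed

text \<open>On an odd cycle a permutation and its inverse cancel in pairs up to the last layer, so
  the whole cycle acts like a single layer.\<close>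

lemma layers_alternate:
  assumes "odd L" "\<And>y. y \<in> G \<Longrightarrow> f y \<in> G" "\<And>y. y \<in> G \<Longrightarrow> g (f y) = y" "y \<in> G"
  shows "layers (\<lambda>p. if even p then f else g) L y = f y"
proof -
  have *: "layers (\<lambda>p. if even p then f else g) (2 * r) y = y" for r
    by (induction r) (use assms in auto)
  obtain r where "L = Suc (2 * r)" using \<open>odd L\<close> by (metis oddE Suc_eq_plus1)
  then show ?thesis using * by simp
qed

lemma layers_involution_tail:
  assumes "\<And>p. q \<le> p \<Longrightarrow> p < q + d \<Longrightarrow> f p = g" "even d"
    "\<And>y. y \<in> G \<Longrightarrow> g y \<in> G" "\<And>y. y \<in> G \<Longrightarrow> g (g y) = y" "layers f q y \<in> G"
  shows "layers f (q + d) y = layers f q y"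
proof -
  obtain r where "d = 2 * r" using \<open>even d\<close> by blast
  moreover have "layers f (q + 2 * r) y = layers f q y" if "2 * r \<le> d" for r
    using that
  proof (induction r)
    case (Suc r)
    then have "f (q + 2 * r) = g" "f (Suc (q + 2 * r)) = g" using assms(1) by auto
    then show ?case using Suc assms by simp
  qed simp
  ultimately show ?thesis by simp
qed

section \<open>Decompositions of complete graphs into 1-factors and Hamiltonian cycles\<close>

text \<open>The graphs of the maps \<open>f s\<close> partition the arcs of the complete digraph on
  \<open>G\<close>, so every edge is used once in each direction.\<close>

definition sharp :: "'s set \<Rightarrow> 'g set \<Rightarrow> ('s \<Rightarrow> 'g \<Rightarrow> 'g) \<Rightarrow> bool" where
  "sharp S G f \<longleftrightarrow> (\<forall>y\<in>G. \<forall>z\<in>G. y \<noteq> z \<longrightarrow> (\<exists>!s. s \<in> S \<and> f s y = z))"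

text \<open>The inverses are carried along as an explicit family \<open>f'\<close>; a family of
  fixed point free involutions is the case \<open>f' = f\<close>.\<close>

definition derangements ::
    "'s set \<Rightarrow> 'g set \<Rightarrow> ('s \<Rightarrow> 'g \<Rightarrow> 'g) \<Rightarrow> ('s \<Rightarrow> 'g \<Rightarrow> 'g) \<Rightarrow> bool" where
  "derangements S G f f' \<longleftrightarrow> (\<forall>s\<in>S. \<forall>y\<in>G. f s y \<in> G \<and> f' s y \<in> G \<and>
     f' s (f s y) = y \<and> f s (f' s y) = y \<and> f s y \<noteq> y)"

text \<open>The 1-factorization of the complete graph on \<open>{..N}\<close> by the circle method: \<open>gk N e\<close> reflects
  the residues modulo \<open>N\<close> at \<open>e\<close> and exchanges \<open>e\<close> with the additional point \<open>N\<close>.\<close>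

definition gk :: "nat \<Rightarrow> nat \<Rightarrow> nat \<Rightarrow> nat" where
  "gk N e x = (if x = N then e else if x = e then N else if 2 * e < x then 2 * e + N - x
     else if 2 * e < x + N then 2 * e - x else 2 * e - x - N)"

lemma gk_basic:
  assumes "e < N" "x \<le> N"
  shows gk_le: "gk N e x \<le> N" and gk_invol: "gk N e (gk N e x) = x"
    and gk_zero: "gk N 0 x = N - x"
  using assms by (auto simp: gk_def)

lemma gk_neq: "odd N \<Longrightarrow> e < N \<Longrightarrow> x \<le> N \<Longrightarrow> gk N e x \<noteq> x"
  unfolding gk_def by (auto elim!: oddE) presburger+

lemma gk_mod:
  assumes "e < N" "x < N" "x \<noteq> e"
  shows "gk N e x < N" "(x + gk N e x) mod N = 2 * e mod N"
proof -
  consider "2 * e < x" | "x \<le> 2 * e" "2 * e < x + N" | "x + N \<le> 2 * e" by linarith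
  then have "gk N e x < N \<and> (x + gk N e x) mod N = 2 * e mod N"
  proof cases
    case 3
    then have "x + gk N e x = 2 * e - N" using assms by (simp add: gk_def)
    moreover have "gk N e x < N" using 3 assms by (simp add: gk_def)
    ultimately show ?thesis using 3 by (simp add: le_mod_geq)
  qed (use assms in \<open>auto simp: gk_def\<close>)
  then show "gk N e x < N" "(x + gk N e x) mod N = 2 * e mod N" by auto
qed

lemma mod_add_left_cancel_less:
  assumes "(x + y) mod N = (x + z) mod N" "y < N" "z < (N::nat)"
  shows "y = z"
  using assms by (metis cong_add_lcancel_nat cong_def mod_less)

text \<open>For residues the condition is \<open>x + y = 2 * e\<close> modulo \<open>N\<close>, and
  2 is invertible since \<open>N\<close> is odd. If one of the points is \<open>N\<close>, then
  \<open>e\<close> is the other one.\<close>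

lemma gk_unique:
  assumes "odd N" "x \<le> N" "y \<le> N" "x \<noteq> y"
  shows "\<exists>!e. e < N \<and> gk N e x = y"
proof (rule ex_ex1I)
  obtain n where N: "N = 2 * n + 1" using \<open>odd N\<close> by (rule oddE)
  show "\<exists>e. e < N \<and> gk N e x = y"
  proof (cases "x = N \<or> y = N")
    case True
    then show ?thesis using assms by (intro exI[of _ "if x = N then y else x"]) (auto simp: gk_def)
  next
    case False
    show ?thesis
    proof (cases "even (x + y)")
      case True
      then obtain e where "x + y = 2 * e" by blast
      then show ?thesis using False assms by (intro exI[of _ e]) (auto simp: gk_def)
    next
      case odd: False
      then obtain e where e: "x + y = 2 * e + 1" by (elim oddE)
      \<comment> \<open>The odd sum \<open>2 * e + 1\<close> is halved modulo
        \<open>N = 2 * n + 1\<close> after adding or subtracting \<open>N\<close>, which gives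
        \<open>e + n + 1\<close> or \<open>e - n\<close>.\<close>
      show ?thesis
      proof (cases "e < n")
        case True
        then show ?thesis using False assms e
          by (intro exI[of _ "e + n + 1"]) (auto simp: gk_def N)
      next
        case False
        then show ?thesis using \<open>\<not> (x = N \<or> y = N)\<close> assms e
          by (intro exI[of _ "e - n"]) (auto simp: gk_def N)
      qed
    qed
  qed
  show "e = e'" if h: "e < N \<and> gk N e x = y" "e' < N \<and> gk N e' x = y" for e e'
  proof (cases "x = N \<or> y = N")
    case True
    have "x \<noteq> N \<Longrightarrow> e = x \<and> e' = x"
      using True h gk_mod(1)[of e N x] gk_mod(1)[of e' N x] assms(2) by auto
    moreover have "x = N \<Longrightarrow> e = y \<and> e' = y" using h by (simp add: gk_def)
    ultimately show ?thesis by blast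
  next
    case False
    then have "x < N" "x \<noteq> e" "x \<noteq> e'" using assms h by (auto simp: gk_def)
    then have "(2 * e) mod N = (2 * e') mod N" using h gk_mod(2) by metis
    moreover have "coprime 2 N" using \<open>odd N\<close> by simp
    ultimately have "e mod N = e' mod N" by (metis cong_def cong_mult_lcancel_nat)
    then show ?thesis using h by simp
  qed
qed

section \<open>Rotations of the 1-factors and the Hamiltonian cycles formed by two of them\<close>

definition shift :: "nat \<Rightarrow> nat \<Rightarrow> nat \<Rightarrow> nat" where
  "shift N k x = (if x = N then N else if x + k < N then x + k else x + k - N)"

lemma shift_le: "k < N \<Longrightarrow> x \<le> N \<Longrightarrow> shift N k x \<le> N"
  by (auto simp: shift_def)

lemma shift_inj: "k < N \<Longrightarrow> inj_on (shift N k) {..N}"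
  by (auto simp: inj_on_def shift_def split: if_splits)

lemma shift_mod: "x < N \<Longrightarrow> k < N \<Longrightarrow> shift N k x = (x + k) mod N"
  by (auto simp: shift_def mod_if)

text \<open>Conjugating the reflection at \<open>e\<close> by the rotation by \<open>k\<close> gives
  the reflection at \<open>e + k\<close>. Thus statements about the zigzag need to be checked in one
  position only.\<close>

lemma gk_shift:
  assumes "e < N" "k < N" "x \<le> N"
  shows "gk N ((e + k) mod N) (shift N k x) = shift N k (gk N e x)"
proof -
  consider "x = N" | "x = e" | "x < N" "x \<noteq> e" using assms by linarith
  then show ?thesis
  proof cases
    case 1
    then show ?thesis using assms by (simp add: gk_def shift_mod) (simp add: shift_def)
  next
    case 2
    then have "shift N k x = (e + k) mod N" "(e + k) mod N < N" using assms by (simp_all add: shift_mod)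
    then show ?thesis using 2 assms by (simp add: gk_def) (simp add: shift_def)
  next
    case 3
    note g = gk_mod[OF assms(1) 3]
    have "(x + k) mod N \<noteq> (e + k) mod N"
      using mod_add_left_cancel_less[of k x N e] 3 assms by (auto simp: add.commute)
    then have "gk N ((e + k) mod N) ((x + k) mod N) < N"
      "((x + k) mod N + gk N ((e + k) mod N) ((x + k) mod N)) mod N = 2 * ((e + k) mod N) mod N"
      using assms by (intro gk_mod; simp)+
    moreover have "((x + k) mod N + (gk N e x + k) mod N) mod N = 2 * ((e + k) mod N) mod N"
    proof -
      have "((x + k) mod N + (gk N e x + k) mod N) mod N = ((x + gk N e x) mod N + (k + k)) mod N"
        by (simp add: mod_simps) (simp add: ac_simps)
      also have "\<dots> = 2 * ((e + k) mod N) mod N" using g by (simp add: mod_simps) (simp add: algebra_simps mult_2_right)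
      finally show ?thesis .
    qed
    ultimately show ?thesis
      using mod_add_left_cancel_less[of "(x + k) mod N" _ N "(gk N e x + k) mod N"] 3 g assms
      by (simp add: shift_mod)
  qed
qed

text \<open>The zigzag \<open>0, 1, -1, 2, -2, \<dots>\<close> through the residues modulo \<open>N\<close>, followed by the
  additional point \<open>N\<close>.\<close>

definition zigzag :: "nat \<Rightarrow> nat \<Rightarrow> nat" where
  "zigzag N p = (if p = N then N else if p = 0 then 0
     else if even p then N - p div 2 else (p + 1) div 2)"

definition ham :: "nat \<Rightarrow> nat \<Rightarrow> nat \<Rightarrow> nat" where
  "ham N k p = shift N k (zigzag N p)"

lemma zigzag_bij:
  assumes "odd N"
  shows "bij_betw (zigzag N) {..N} {..N}"
proof -
  obtain n where N: "N = 2 * n + 1" using assms by (rule oddE)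
  have "inj_on (zigzag N) {..N}"
  proof (rule inj_onI)
    fix x y assume "x \<in> {..N}" "y \<in> {..N}" "zigzag N x = zigzag N y"
    then show "x = y"
      by (cases "even x"; cases "even y")
        (auto simp: zigzag_def N split: if_splits elim!: evenE oddE)
  qed
  moreover have "zigzag N ` {..N} \<subseteq> {..N}"
    by (auto simp: zigzag_def N)
  ultimately show ?thesis
    by (simp add: bij_betw_def endo_inj_surj)
qed

lemma ham_bij:
  assumes "odd N" "k < N"
  shows "bij_betw (ham N k) {..N} {..N}"
proof -
  have "bij_betw (shift N k) {..N} {..N}"
    using shift_inj[OF assms(2)] shift_le[OF assms(2)]
    by (simp add: bij_betw_def endo_inj_surj image_subset_iff)
  then have "bij_betw (shift N k \<circ> zigzag N) {..N} {..N}"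
    using zigzag_bij[OF assms(1)] bij_betw_trans by blast
  then show ?thesis by (simp add: ham_def comp_def cong: bij_betw_cong)
qed

lemma zigzag_le: "odd N \<Longrightarrow> p \<le> N \<Longrightarrow> zigzag N p \<le> N"
  using zigzag_bij bij_betwE by fastforce

lemma gk_zigzag_top: "N = Suc (2 * n) \<Longrightarrow> gk N 0 (zigzag N N) = zigzag N 0
    \<and> gk N (Suc n mod N) (zigzag N N) = zigzag N (N - 1)"
  by (cases "n = 0") (auto simp: gk_def zigzag_def)
lemma gk_zigzag_zero: "N = Suc (2 * n) \<Longrightarrow>  gk N 0 (zigzag N 0) = zigzag N N
    \<and> gk N (Suc n mod N) (zigzag N 0) = zigzag N 1"
  by (cases "n = 0") (auto simp: gk_def zigzag_def)
lemma gk_zigzag_even: "N = Suc (2 * n) \<Longrightarrow> 0 < r \<Longrightarrow> r \<le> n \<Longrightarrow> gk N 0 (zigzag N (2 * r)) = zigzag N (2 * r - 1)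
    \<and> gk N (Suc n mod N) (zigzag N (2*r)) = zigzag N (Suc (2*r))"
  by (subgoal_tac "Suc n mod N = Suc n") (auto simp: gk_def zigzag_def)
lemma gk_zigzag_odd: "N = Suc (2 * n) \<Longrightarrow> r < n \<Longrightarrow> gk N 0 (zigzag N (Suc (2 * r))) = zigzag N (Suc (Suc (2 * r)) mod Suc N)
    \<and> gk N (Suc n mod N) (zigzag N (Suc (2*r))) = zigzag N ((2*r))"
  by (subgoal_tac "Suc n mod N = Suc n") (auto simp: gk_def zigzag_def)
text \<open>Sums of neighbours along \<open>0, 1, -1, 2, -2, ...\<close> are alternately 1 and 0,
  and \<open>Suc n\<close> and 0 are the halves of 1 and 0 modulo \<open>N\<close>; both ends are
  joined to the point \<open>N\<close>. So these two 1-factors alternate along a Hamiltonian cycle.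
  The reduction of \<open>Suc n\<close> modulo \<open>N\<close> matters only for
  \<open>n = 0\<close>, where \<open>N = 1\<close>.\<close>

lemma gk_zigzag:
  assumes "N = Suc (2 * n)" "p \<le> N"
  shows "gk N 0 (zigzag N p) = zigzag N (if odd p then Suc p mod Suc N else if p = 0 then N else p - 1)
    \<and> gk N (Suc n mod N) (zigzag N p) = zigzag N (if even p then Suc p else p - 1)"
proof -
  consider (top) "p = N" | (zero) "p = 0" | (even) r where "p = 2 * r" "0 < r" "r \<le> n"
    | (odd) r where "p = Suc (2 * r)" "r < n"
  proof (cases "even p")
    case True
    then obtain r where "p = 2 * r" by blast
    then show ?thesis using that(2) that(3)[of r] assms by (cases "r = 0") auto
  next
    case False
    then obtain r where "p = Suc (2 * r)" by (auto elim: oddE)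
    then show ?thesis using that(1) that(4)[of r] assms by (cases "r = n") auto
  qed
  then show ?thesis
  proof cases
    case top
    then show ?thesis using gk_zigzag_top[OF assms(1)] assms(1) by simp
  next
    case zero
    then show ?thesis using gk_zigzag_zero[OF assms(1)] by simp
  next
    case even
    then show ?thesis using gk_zigzag_even[OF assms(1) even(2,3)] by simp
  next
    case odd
    then show ?thesis using gk_zigzag_odd[OF assms(1) odd(2)] by simp
  qed
qed

lemma gk_ham:
  assumes "N = Suc (2 * n)" "k < N" "p \<le> N"
  shows "gk N k (ham N k p) = ham N k (if odd p then Suc p mod Suc N else if p = 0 then N else p - 1)"
    and "gk N ((k + Suc n) mod N) (ham N k p) = ham N k (if even p then Suc p else p - 1)"
proof -
  have odd: "odd N" using assms by simp
  show "gk N k (ham N k p) = ham N k (if odd p then Suc p mod Suc N else if p = 0 then N else p - 1)"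
    using gk_shift[of 0 N k "zigzag N p"] gk_zigzag[OF assms(1,3)] assms zigzag_le[OF odd]
    by (simp add: ham_def)
  have "gk N ((Suc n mod N + k) mod N) (shift N k (zigzag N p)) = shift N k (gk N (Suc n mod N) (zigzag N p))"
    using assms zigzag_le[OF odd] by (intro gk_shift) auto
  moreover have "(Suc n mod N + k) mod N = (k + Suc n) mod N" by (metis add.commute mod_add_left_eq)
  ultimately show "gk N ((k + Suc n) mod N) (ham N k p) = ham N k (if even p then Suc p else p - 1)"
    using gk_zigzag[OF assms(1,3)] by (simp add: ham_def)
qed

lemma ham_cover:
  assumes "odd N" "k < N" "x \<le> N"
  obtains p where "p \<le> N" "x = ham N k p"
proof -
  have "x \<in> ham N k ` {..N}" using ham_bij[OF assms(1,2)] assms(3) by (simp add: bij_betw_def)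
  then show ?thesis using that by auto
qed

lemma ham_inj: "odd N \<Longrightarrow> k < N \<Longrightarrow> p \<le> N \<Longrightarrow> q \<le> N \<Longrightarrow> ham N k p = ham N k q \<longleftrightarrow> p = q"
  using ham_bij by (auto simp: bij_betw_def inj_on_def)

text \<open>The product of two 1-factors that alternate along a Hamiltonian cycle of length
  \<open>2 * n + 2\<close> moves every point by two places, forwards from even and backwards from
  odd places. Hence both parity classes are cycles of length \<open>n + 1\<close>.\<close>

lemma exper_gk_gk:
  assumes "N = Suc (2 * n)" "k < N" "x \<le> N"
  shows "exper (\<lambda>x. gk N k (gk N ((k + Suc n) mod N) x)) (Suc n) x"
proof -
  have odd: "odd N" using assms by simp
  obtain p where p: "p \<le> N" "x = ham N k p" using ham_cover[OF odd assms(2,3)] .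
  let ?f = "\<lambda>x. gk N k (gk N ((k + Suc n) mod N) x)"
  have ev: "?f (ham N k (2 * r)) = ham N k (2 * ((r + 1) mod Suc n))" if "r < Suc n" for r
  proof -
    have "gk N ((k + Suc n) mod N) (ham N k (2 * r)) = ham N k (2 * r + 1)"
      using gk_ham(2)[OF assms(1,2), of "2 * r"] that assms by simp
    moreover have "gk N k (ham N k (2 * r + 1)) = ham N k ((2 * (r + 1)) mod (2 * Suc n))"
      using gk_ham(1)[OF assms(1,2), of "2 * r + 1"] that assms by simp
    moreover have "(2 * (r + 1)) mod (2 * Suc n) = 2 * ((r + 1) mod Suc n)" by (rule mod_mult_mult1)
    ultimately show ?thesis by metis
  qed
  \<comment> \<open>\<open>N - 2 * r\<close> lists the odd places downwards, which is the direction
    in which the product moves them.\<close>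
  have od: "?f (ham N k (N - 2 * r)) = ham N k (N - 2 * ((r + 1) mod Suc n))" if "r < Suc n" for r
  proof -
    have "odd (N - 2 * r)" "N - 2 * r \<noteq> 0" using that assms by auto
    then have *: "gk N ((k + Suc n) mod N) (ham N k (N - 2 * r)) = ham N k (N - 2 * r - 1)"
      using gk_ham(2)[OF assms(1,2), of "N - 2 * r"] by simp
    have "gk N k (ham N k (N - 2 * r - 1)) = ham N k (N - 2 * ((r + 1) mod Suc n))"
    proof (cases "r = n")
      case True
      then have "N - 2 * r - 1 = 0" "(r + 1) mod Suc n = 0" using assms by auto
      then show ?thesis using gk_ham(1)[OF assms(1,2), of 0] by simp
    next
      case False
      then have "even (N - 2 * r - 1)" "N - 2 * r - 1 \<noteq> 0" "(r + 1) mod Suc n = r + 1"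
        "N - 2 * r - 1 - 1 = N - 2 * (r + 1)"
        using that assms by auto
      then show ?thesis using gk_ham(1)[OF assms(1,2), of "N - 2 * r - 1"] by simp
    qed
    then show ?thesis using * by simp
  qed
  show ?thesis
  proof (cases "even p")
    case True
    then obtain r where r: "p = 2 * r" by blast
    then have rc: "r < Suc n" using p assms by auto
    have "exper ?f (Suc n) (ham N k (2 * r)) \<longleftrightarrow> exper (\<lambda>r. (r + 1) mod Suc n) (Suc n) r"
      by (rule exper_conj[where A = "{..<Suc n}"])
        (use ev rc assms ham_inj[OF odd assms(2)] in \<open>auto simp: inj_on_def\<close>)
    then show ?thesis using exper_translation[of "Suc n" r] rc p r by simp
  next
    case False
    define r where "r = (N - p) div 2"
    have r: "p = N - 2 * r" "r < Suc n" using False p assms odd by (auto simp: r_def)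
    have "exper ?f (Suc n) (ham N k (N - 2 * r)) \<longleftrightarrow> exper (\<lambda>r. (r + 1) mod Suc n) (Suc n) r"
      by (rule exper_conj[where A = "{..<Suc n}"])
        (use od r assms ham_inj[OF odd assms(2)] in \<open>auto simp: inj_on_def\<close>)
    then show ?thesis using exper_translation[of "Suc n" r] r p by simp
  qed
qed

text \<open>The Walecki decomposition of the complete digraph on \<open>2 * n + 2\<close> points: for \<open>e < n\<close> the
  permutations with index \<open>e\<close> and \<open>e + n + 1\<close> run through the Hamiltonian cycle formed by the
  1-factors \<open>gk e\<close> and \<open>gk (e + n + 1)\<close> in the two directions, and \<open>gk n\<close> is left over.\<close>

definition forward :: "nat \<Rightarrow> nat \<Rightarrow> nat \<Rightarrow> bool" where
  "forward N k x \<longleftrightarrow> (\<exists>p\<le>N. even p \<and> x = ham N k p)"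

definition walecki_index :: "nat \<Rightarrow> nat \<Rightarrow> nat \<Rightarrow> nat" where
  "walecki_index n e x =
     (if e < n then (if forward (Suc (2 * n)) e x then e + Suc n else e)
      else if e = n then e
      else (if forward (Suc (2 * n)) (e - Suc n) x then e - Suc n else e))"

definition walecki :: "nat \<Rightarrow> nat \<Rightarrow> nat \<Rightarrow> nat" where
  "walecki n e x = gk (Suc (2 * n)) (walecki_index n e x) x"

definition opposite :: "nat \<Rightarrow> nat \<Rightarrow> nat" where
  "opposite n e = (if e < n then e + Suc n else if e = n then e else e - Suc n)"

lemma index_cases:
  assumes "e < Suc (2 * n)"
  obtains "e < n" | "e = n" | k where "e = k + Suc n" "k < n"
proof (cases "e \<le> n")
  case False
  then have "e = (e - Suc n) + Suc n" "e - Suc n < n" using assms by auto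
  then show ?thesis using that(3) by blast
qed (use that in linarith)

lemma walecki_index:
  assumes "e < Suc (2 * n)"
  shows "walecki_index n e x < Suc (2 * n)" "walecki_index n (walecki_index n e x) x = e"
  using assms by (cases rule: index_cases; auto simp: walecki_index_def)+

lemma opposite:
  assumes "e < Suc (2 * n)"
  shows "opposite n e < Suc (2 * n)" "opposite n (opposite n e) = e"
  using assms by (cases rule: index_cases; auto simp: opposite_def)+

text \<open>At a fixed point \<open>x\<close> passing from \<open>e\<close> to
  \<open>walecki_index n e x\<close> is an involution of the indices, so uniqueness is inherited
  from the 1-factorization \<open>gk\<close>.\<close>

lemma walecki_unique:
  assumes "x \<le> Suc (2 * n)" "y \<le> Suc (2 * n)" "x \<noteq> y"
  shows "\<exists>!e. e < Suc (2 * n) \<and> walecki n e x = y"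
proof -
  have "\<exists>!e. e < Suc (2 * n) \<and> gk (Suc (2 * n)) e x = y"
    using assms by (intro gk_unique) auto
  then obtain e where e: "e < Suc (2 * n)" "gk (Suc (2 * n)) e x = y"
    and un: "\<And>e'. e' < Suc (2 * n) \<Longrightarrow> gk (Suc (2 * n)) e' x = y \<Longrightarrow> e' = e" by blast
  show ?thesis
  proof (intro ex1I[of _ "walecki_index n e x"] conjI)
    show "walecki_index n e x < Suc (2 * n)" "walecki n (walecki_index n e x) x = y"
      using walecki_index[OF e(1), of x] e by (auto simp: walecki_def)
    fix e' assume "e' < Suc (2 * n) \<and> walecki n e' x = y"
    then show "e' = walecki_index n e x"
      using un[of "walecki_index n e' x"] walecki_index[of e' n x] by (auto simp: walecki_def)
  qed
qed

lemma walecki_ham: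
  assumes "N = Suc (2 * n)" "e < n" "p \<le> N"
  shows "walecki n e (ham N e p) = ham N e (Suc p mod Suc N)"
    and "walecki n (e + Suc n) (ham N e p) = ham N e (if p = 0 then N else p - 1)"
proof -
  have N: "N = Suc (2 * n)" "e < N" "p \<le> N" and odd: "odd N" using assms by auto
  have fwd: "forward N e (ham N e p) \<longleftrightarrow> even p"
    using ham_inj[OF odd N(2)] N(3) by (auto simp: forward_def)
  have ec: "(e + Suc n) mod N = e + Suc n" using assms by simp
  have ev: "Suc p mod Suc N = Suc p" if "even p" using that N(3) odd by (metis Suc_le_eq le_neq_implies_less less_Suc_eq_le mod_less not_less_eq_eq)
  show "walecki n e (ham N e p) = ham N e (Suc p mod Suc N)"
    using gk_ham[OF N] fwd assms(2) ec ev
    by (cases "even p") (simp_all add: walecki_def walecki_index_def flip: assms(1))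
  show "walecki n (e + Suc n) (ham N e p) = ham N e (if p = 0 then N else p - 1)"
    using gk_ham[OF N] fwd assms(2) ec
    by (cases "even p") (auto simp: walecki_def walecki_index_def odd_pos simp flip: assms(1))
qed

lemma walecki_mid: "walecki n n x = gk (Suc (2 * n)) n x"
  by (simp add: walecki_def walecki_index_def)

lemma walecki_le:
  assumes "e < Suc (2 * n)" "x \<le> Suc (2 * n)"
  shows "walecki n e x \<le> Suc (2 * n)" "walecki n e x \<noteq> x"
  using gk_le[of "walecki_index n e x" "Suc (2 * n)" x] gk_neq[of "Suc (2 * n)" "walecki_index n e x" x]
    walecki_index(1)[OF assms(1), of x] assms(2) by (auto simp: walecki_def)

lemma walecki_opposite_low:
  assumes "e < n" "x \<le> Suc (2 * n)"
  shows "walecki n (e + Suc n) (walecki n e x) = x" "walecki n e (walecki n (e + Suc n) x) = x"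
proof -
  define N where N: "N = Suc (2 * n)"
  have "odd N" "e < N" "x \<le> N" using assms N by auto
  then obtain p where p: "p \<le> N" "x = ham N e p" using ham_cover by blast
  define q where "q = Suc p mod Suc N"
  define r where "r = (if p = 0 then N else p - 1)"
  have q: "q \<le> N" "(if q = 0 then N else q - 1) = p" using p(1) by (auto simp: q_def mod_Suc)
  have r: "r \<le> N" "Suc r mod Suc N = p" using p(1) by (auto simp: r_def)
  note w = walecki_ham[OF N assms(1)]
  show "walecki n (e + Suc n) (walecki n e x) = x"
    unfolding p(2) w(1)[OF p(1), folded q_def] w(2)[OF q(1), unfolded q(2)] ..
  show "walecki n e (walecki n (e + Suc n) x) = x"
    unfolding p(2) w(2)[OF p(1), folded r_def] w(1)[OF r(1), unfolded r(2)] ..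
qed

lemma walecki_opposite:
  assumes "e < Suc (2 * n)" "x \<le> Suc (2 * n)"
  shows "walecki n (opposite n e) (walecki n e x) = x"
  using assms(1)
proof (cases rule: index_cases)
  case 2
  then show ?thesis using assms gk_invol[of n "Suc (2 * n)" x]
    by (simp add: opposite_def walecki_mid)
qed (use walecki_opposite_low assms in \<open>auto simp: opposite_def simp del: add_Suc_right\<close>)

lemma exper_walecki:
  assumes "e < Suc (2 * n)" "e \<noteq> n" "x \<le> Suc (2 * n)"
  shows "exper (walecki n e) (Suc (Suc (2 * n))) x"
proof -
  define N where N: "N = Suc (2 * n)"
  have low: "exper (walecki n e) (Suc N) x" if en: "e < n" and xN: "x \<le> N" for e x
  proof -
    have oe: "odd N" "e < N" using en N by auto
    then obtain p where p: "p \<le> N" "x = ham N e p" using ham_cover xN by blast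
    have "exper (walecki n e) (Suc N) (ham N e p) \<longleftrightarrow> exper (\<lambda>p. (p + 1) mod Suc N) (Suc N) p"
      by (rule exper_conj[where A = "{..N}"])
        (use walecki_ham(1)[OF N en] p ham_inj[OF oe] in
          \<open>auto simp: inj_on_def less_Suc_eq_le[symmetric]\<close>)
    then show ?thesis using exper_translation[of "Suc N" p] p by simp
  qed
  from assms(1) have "exper (walecki n e) (Suc N) x"
  proof (cases rule: index_cases)
    case (3 k)
    show ?thesis
      by (rule exper_inverse[OF low[OF 3(2)], where A = "{..N}"])
        (use walecki_opposite_low[OF 3(2)] walecki_le assms 3 N in auto)
  qed (use low assms N in auto)
  then show ?thesis by (simp add: N)
qed

section \<open>Layers\<close>

lemma ex1_residue:
  assumes "0 < c" "(w::nat) < c"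
  shows "\<exists>!z. z < c \<and> (z + k) mod c = w"
proof (rule ex_ex1I)
  have "((w + (c - k mod c)) mod c + k) mod c = (w + (c - k mod c) + k mod c) mod c"
    by (metis mod_add_eq mod_mod_trivial)
  also have "w + (c - k mod c) + k mod c = w + c" using mod_less_divisor[OF assms(1), of k] by simp
  also have "(w + c) mod c = w" using assms by simp
  finally show "\<exists>z. z < c \<and> (z + k) mod c = w" using assms by (intro exI[of _ "(w + (c - k mod c)) mod c"]) simp
  show "z = z'" if "z < c \<and> (z + k) mod c = w" "z' < c \<and> (z' + k) mod c = w" for z z'
    using that mod_add_left_cancel_less[of k z c z'] by (auto simp: add.commute)
qed

lemma reflect_add:
  assumes "w < (c::nat)"
  shows "((k + c - w) mod c + w) mod c = k mod c"
proof -
  have "((k + c - w) mod c + w) mod c = (k + c - w + w) mod c" by (simp add: mod_simps)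
  then show ?thesis using assms by simp
qed

text \<open>Reflecting with constant \<open>l\<close> and then with constant \<open>k\<close> is the
  translation by \<open>k - l\<close>. The hypothesis on \<open>w'\<close> states this without a
  subtraction of natural numbers; \<open>k = l\<close> shows that a reflection is an
  involution.\<close>

lemma reflect_reflect:
  assumes "w < (c::nat)" "(w' + l) mod c = (w + k) mod c" "w' < c"
  shows "(k + c - ((l + c - w) mod c)) mod c = w'"
proof (rule mod_add_left_cancel_less[of "(l + c - w) mod c"])
  define r where "r = (l + c - w) mod c"
  have r: "r < c" "(r + w) mod c = l mod c" using assms reflect_add[OF assms(1), of l] by (auto simp: r_def)
  have "(w + (r + w')) mod c = ((r + w) mod c + w') mod c" by (simp add: mod_simps ac_simps)
  also have "\<dots> = (w' + l) mod c" using r by (simp add: mod_simps add.commute)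
  finally have "(w + (r + w')) mod c = (w + k) mod c" using assms by simp
  then have "(r + w') mod c = k mod c" by (metis cong_add_lcancel_nat cong_def)
  moreover have "(r + (k + c - r) mod c) mod c = k mod c"
    using reflect_add[OF r(1), of k] by (simp add: add.commute)
  ultimately show "((l + c - w) mod c + (k + c - (l + c - w) mod c) mod c) mod c =
      ((l + c - w) mod c + w') mod c" by (simp add: r_def)
qed (use assms in auto)

text \<open>The colour set is \<open>{..N} \<times> {..<c}\<close> with \<open>N = 2 * m + 1\<close>, and \<open>gk N 0\<close> pairs \<open>x\<close> with \<open>N - x\<close>:
  the blocks \<open>{q, N - q} \<times> {..<c}\<close> are identified with \<open>{..<2 * c}\<close>, and \<open>gk N e\<close> for \<open>0 < e < N\<close>
  takes care of the pairs in different blocks.\<close>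

definition to_block :: "nat \<Rightarrow> nat \<Rightarrow> nat \<times> nat \<Rightarrow> nat \<times> nat" where
  "to_block m c v = (if fst v \<le> m then v else (Suc (2 * m) - fst v, snd v + c))"

definition of_block :: "nat \<Rightarrow> nat \<Rightarrow> nat \<times> nat \<Rightarrow> nat \<times> nat" where
  "of_block m c v = (if snd v < c then v else (Suc (2 * m) - fst v, snd v - c))"

definition colours :: "nat \<Rightarrow> nat \<Rightarrow> (nat \<times> nat) set" where
  "colours m c = {..Suc (2 * m)} \<times> {..<c}"

text \<open>There are \<open>2 * c - 1 + 2 * m * c\<close> classes, one fewer than there are
  colours, as a sharp family requires. They index the factors that miss a given part.\<close>

definition classes :: "nat \<Rightarrow> nat \<Rightarrow> (nat \<times> nat) set" where
  "classes m c = {(e, z). e = 0 \<and> z < 2 * c - 1 \<or> 0 < e \<and> e < Suc (2 * m) \<and> z < c}"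

text \<open>Between the fibres over \<open>x\<close> and \<open>gk e x\<close> the reflections
  \<open>w -> z - w\<close> form \<open>c\<close> disjoint perfect matchings. The offset
  \<open>d\<close> may differ at the two ends, so that walking back and forth becomes a
  translation.\<close>

definition recolour :: "nat \<Rightarrow> nat \<Rightarrow> (nat \<Rightarrow> nat \<Rightarrow> nat) \<Rightarrow> (nat \<Rightarrow> nat \<Rightarrow> nat) \<Rightarrow>
    nat \<times> nat \<Rightarrow> nat \<times> nat \<Rightarrow> nat \<times> nat" where
  "recolour m c f d s v =
     (if fst s = 0 then of_block m c (fst (to_block m c v), f (snd s) (snd (to_block m c v)))
      else (gk (Suc (2 * m)) (fst s) (fst v), (snd s + d (fst s) (fst v) + c - snd v) mod c))"

lemma to_block:
  assumes "v \<in> colours m c"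
  shows "fst (to_block m c v) \<le> m" "snd (to_block m c v) < 2 * c" "of_block m c (to_block m c v) = v"
  using assms by (auto simp: colours_def to_block_def of_block_def)

lemma of_block:
  assumes "q \<le> m" "x < 2 * c"
  shows "of_block m c (q, x) \<in> colours m c" "to_block m c (of_block m c (q, x)) = (q, x)"
  using assms by (auto simp: colours_def to_block_def of_block_def)

lemma finite_classes: "finite (classes m c)"
  by (rule finite_subset[of _ "{..Suc (2 * m)} \<times> {..<2 * c}"]) (auto simp: classes_def)

lemma same_block:
  assumes "v \<in> colours m c" "w \<in> colours m c"
  shows "fst (to_block m c v) = fst (to_block m c w) \<longleftrightarrow> fst w = fst v \<or> fst w = Suc (2 * m) - fst v"
  using assms by (auto simp: colours_def to_block_def)

text \<open>The offset \<open>d'\<close> at the image must equal \<open>d\<close> at the source: the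
  same reflection then leads back.\<close>

lemma derangements_recolour:
  assumes "\<And>e x. e < 2 * c - 1 \<Longrightarrow> x < 2 * c \<Longrightarrow> f e x < 2 * c \<and> f' e x < 2 * c \<and> f e x \<noteq> x \<and>
      f' e (f e x) = x \<and> f e (f' e x) = x"
    and "\<And>e x. e < Suc (2 * m) \<Longrightarrow> x \<le> Suc (2 * m) \<Longrightarrow> d' e (gk (Suc (2 * m)) e x) = d e x"
  shows "derangements (classes m c) (colours m c) (recolour m c f d) (recolour m c f' d')"
  unfolding derangements_def
proof (intro ballI)
  fix s v assume s: "s \<in> classes m c" and v: "v \<in> colours m c"
  show "recolour m c f d s v \<in> colours m c \<and> recolour m c f' d' s v \<in> colours m c \<and>
     recolour m c f' d' s (recolour m c f d s v) = v \<and> recolour m c f d s (recolour m c f' d' s v) = v \<and>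
     recolour m c f d s v \<noteq> v"
  proof (cases "fst s = 0")
    case True
    then have e: "snd s < 2 * c - 1" using s by (auto simp: classes_def)
    note b = to_block[OF v]
    note a = assms(1)[OF e b(2)]
    have "of_block m c (fst (to_block m c v), f (snd s) (snd (to_block m c v))) \<noteq> v"
      using of_block(2)[OF b(1), of "f (snd s) (snd (to_block m c v))"] a by (metis snd_conv)
    then show ?thesis using True of_block[OF b(1)] a b(3) by (simp add: recolour_def)
  next
    case False
    then have e: "0 < fst s" "fst s < Suc (2 * m)" "snd s < c" using s by (auto simp: classes_def)
    obtain x w where xw: "v = (x, w)" "x \<le> Suc (2 * m)" "w < c" using v by (auto simp: colours_def)
    have g: "gk (Suc (2 * m)) (fst s) x \<le> Suc (2 * m)" "gk (Suc (2 * m)) (fst s) x \<noteq> x"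
      "gk (Suc (2 * m)) (fst s) (gk (Suc (2 * m)) (fst s) x) = x"
      using gk_le gk_neq gk_invol e xw by auto
    have d: "d' (fst s) (gk (Suc (2 * m)) (fst s) x) = d (fst s) x"
      "d (fst s) (gk (Suc (2 * m)) (fst s) x) = d' (fst s) x"
      using assms(2)[of "fst s" x] assms(2)[of "fst s" "gk (Suc (2 * m)) (fst s) x"] e xw g by auto
    have r: "(k + c - (k + c - w) mod c) mod c = w" for k
      using reflect_reflect[OF xw(3) _ xw(3), of k k] by simp
    show ?thesis using False xw e g d r by (auto simp: recolour_def colours_def)
  qed
qed

text \<open>The blocks are exactly the pairs of \<open>gk N 0\<close>. Two colours in one block are
  therefore joined inside the block only, by \<open>f\<close>; for all others \<open>gk\<close>
  determines a nonzero first index, and then the residue determines the second one.\<close>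

lemma sharp_recolour:
  assumes f: "\<And>x y. x < 2 * c \<Longrightarrow> y < 2 * c \<Longrightarrow> x \<noteq> y \<Longrightarrow> \<exists>!e. e < 2 * c - 1 \<and> f e x = y"
    and fle: "\<And>e x. e < 2 * c - 1 \<Longrightarrow> x < 2 * c \<Longrightarrow> f e x < 2 * c"
  shows "sharp (classes m c) (colours m c) (recolour m c f d)"
  unfolding sharp_def
proof (intro ballI impI)
  fix v w assume v: "v \<in> colours m c" and w: "w \<in> colours m c" and "v \<noteq> w"
  let ?N = "Suc (2 * m)"
  note bv = to_block[OF v] and bw = to_block[OF w]
  have vw: "fst v \<le> ?N" "fst w \<le> ?N" "snd v < c" "snd w < c" using v w by (auto simp: colours_def)
  have blk: "fst (to_block m c (recolour m c f d s v)) = fst (to_block m c v)"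
    "snd (to_block m c (recolour m c f d s v)) = f (snd s) (snd (to_block m c v))"
    if "s \<in> classes m c" "fst s = 0" for s
    using that of_block(2)[OF bv(1) fle[OF _ bv(2)], of "snd s"] by (auto simp: recolour_def classes_def)
  show "\<exists>!s. s \<in> classes m c \<and> recolour m c f d s v = w"
  proof (cases "fst (to_block m c v) = fst (to_block m c w)")
    case True
    then have "snd (to_block m c v) \<noteq> snd (to_block m c w)" using \<open>v \<noteq> w\<close> bv bw by (metis prod.expand)
    then obtain e where e: "e < 2 * c - 1" "f e (snd (to_block m c v)) = snd (to_block m c w)"
      and un: "\<And>e'. e' < 2 * c - 1 \<Longrightarrow> f e' (snd (to_block m c v)) = snd (to_block m c w) \<Longrightarrow> e' = e"
      using f[OF bv(2) bw(2)] by metis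
    show ?thesis
    proof (intro ex1I[of _ "(0, e)"] conjI)
      show "(0, e) \<in> classes m c" using e by (simp add: classes_def)
      show "recolour m c f d (0, e) v = w" using True e bw by (simp add: recolour_def)
      fix s assume s: "s \<in> classes m c \<and> recolour m c f d s v = w"
      have "fst s = 0"
      proof (rule ccontr)
        assume n0: "fst s \<noteq> 0"
        then have g: "gk ?N (fst s) (fst v) = fst w" "fst s < ?N" using s by (auto simp: recolour_def classes_def)
        then have "fst w \<noteq> fst v" using gk_neq[of ?N "fst s" "fst v"] vw by auto
        then have "fst w = ?N - fst v" using True same_block[OF v w] by auto
        then have "gk ?N 0 (fst v) = fst w" using gk_zero[of "fst s" ?N "fst v"] g vw by simp
        moreover have "\<exists>!e. e < ?N \<and> gk ?N e (fst v) = fst w"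
          using \<open>fst w \<noteq> fst v\<close> vw by (intro gk_unique) simp_all
        ultimately show False using g n0 by (metis zero_less_Suc)
      qed
      then show "s = (0, e)" using s un blk(2)[of s] by (cases s) (auto simp: classes_def)
    qed
  next
    case False
    then have ne: "fst w \<noteq> fst v" "fst w \<noteq> ?N - fst v" using same_block[OF v w] by auto
    have "\<exists>!e. e < ?N \<and> gk ?N e (fst v) = fst w"
      using ne(1) vw by (intro gk_unique) simp_all
    then obtain e where e: "e < ?N" "gk ?N e (fst v) = fst w"
      and un: "\<And>e'. e' < ?N \<Longrightarrow> gk ?N e' (fst v) = fst w \<Longrightarrow> e' = e"
      by blast
    have e0: "0 < e" using ne(2) e(2) gk_zero[OF e(1) vw(1)] by (cases "e = 0") simp_all
    have "\<exists>!z. z < c \<and> (z + (d e (fst v) + c - snd v)) mod c = snd w"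
      using vw by (intro ex1_residue) auto
    then obtain z where z: "z < c" "(z + (d e (fst v) + c - snd v)) mod c = snd w"
      and unz: "\<And>z'. z' < c \<Longrightarrow> (z' + (d e (fst v) + c - snd v)) mod c = snd w \<Longrightarrow> z' = z"
      by blast
    have assoc: "z' + d e (fst v) + c - snd v = z' + (d e (fst v) + c - snd v)" for z' using vw by simp
    show ?thesis
    proof (intro ex1I[of _ "(e, z)"] conjI)
      show "(e, z) \<in> classes m c" using e e0 z by (simp add: classes_def)
      show "recolour m c f d (e, z) v = w" using e e0 z assoc by (simp add: recolour_def)
      fix s assume s: "s \<in> classes m c \<and> recolour m c f d s v = w"
      then have n0: "fst s \<noteq> 0" using blk(1)[of s] False by auto
      then have "gk ?N (fst s) (fst v) = fst w" "fst s < ?N" using s by (auto simp: recolour_def classes_def)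
      then have fs: "fst s = e" using un by blast
      then have "snd s < c" "(snd s + d e (fst v) + c - snd v) mod c = snd w"
        using s n0 by (auto simp: recolour_def classes_def)
      then show "s = (e, z)" using fs unz assoc by (cases s) auto
    qed
  qed
qed

lemma exper_block:
  assumes "v \<in> colours m c" "\<And>x. x < 2 * c \<Longrightarrow> f x < 2 * c"
    and "\<And>v. v \<in> colours m c \<Longrightarrow> F v = of_block m c (fst (to_block m c v), f (snd (to_block m c v)))"
    and "\<And>x. x < 2 * c \<Longrightarrow> exper f k x"
  shows "exper F k v"
proof -
  define q where "q = fst (to_block m c v)"
  note b = to_block[OF assms(1)]
  have ob: "of_block m c (q, x) \<in> colours m c \<and> to_block m c (of_block m c (q, x)) = (q, x)" if "x < 2 * c" for x
    using of_block[OF b(1) that] by (simp add: q_def)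
  have "exper F k (of_block m c (q, snd (to_block m c v))) \<longleftrightarrow> exper f k (snd (to_block m c v))"
  proof (rule exper_conj[where A = "{..<2 * c}"])
    show "inj_on (\<lambda>x. of_block m c (q, x)) {..<2 * c}"
      by (rule inj_onI) (metis lessThan_iff ob snd_conv)
  qed (use assms ob b in auto)
  then show ?thesis using assms(4) b by (simp add: q_def)
qed

section \<open>The layer families for base cycles of even and of odd length\<close>

definition lam :: "nat \<Rightarrow> nat \<Rightarrow> nat \<times> nat \<Rightarrow> nat \<times> nat \<Rightarrow> nat \<times> nat" where
  "lam m n = recolour m (Suc n) (gk (Suc (2 * n))) (\<lambda>_ _. 0)"

text \<open>Inside the blocks this takes the 1-factor that closes up with that of \<open>lam\<close>
  to a Hamiltonian cycle. Between blocks the constants of the two reflections differ by 1, so their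
  product is a translation of order \<open>c\<close>.\<close>

definition lam' :: "nat \<Rightarrow> nat \<Rightarrow> nat \<times> nat \<Rightarrow> nat \<times> nat \<Rightarrow> nat \<times> nat" where
  "lam' m n = recolour m (Suc n) (\<lambda>e. gk (Suc (2 * n)) ((e + Suc n) mod Suc (2 * n))) (\<lambda>_ _. 1)"

text \<open>The offset is 1 only on the way from the larger to the smaller first coordinate. A round
  trip thus adds 1 to the second coordinate, and the two fibres form one cycle of length
  \<open>2 * c\<close>, matching the Hamiltonian cycles inside the blocks.\<close>

definition kap :: "nat \<Rightarrow> nat \<Rightarrow> nat \<times> nat \<Rightarrow> nat \<times> nat \<Rightarrow> nat \<times> nat" where
  "kap m n = recolour m (Suc n) (walecki n) (\<lambda>e x. if gk (Suc (2 * m)) e x < x then 1 else 0)"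

definition kap' :: "nat \<Rightarrow> nat \<Rightarrow> nat \<times> nat \<Rightarrow> nat \<times> nat \<Rightarrow> nat \<times> nat" where
  "kap' m n = recolour m (Suc n) (\<lambda>e. walecki n (opposite n e)) (\<lambda>e x. if x < gk (Suc (2 * m)) e x then 1 else 0)"

lemma derangements_lam: "derangements (classes m (Suc n)) (colours m (Suc n)) (lam m n) (lam m n)"
  unfolding lam_def
proof (rule derangements_recolour, goal_cases)
  case (1 e x)
  then have *: "e < Suc (2 * n)" "x \<le> Suc (2 * n)" by auto
  show ?case using gk_le[OF *] gk_neq[OF _ *] gk_invol[OF *] by simp
qed simp

lemma derangements_lam': "derangements (classes m (Suc n)) (colours m (Suc n)) (lam' m n) (lam' m n)"
  unfolding lam'_def
proof (rule derangements_recolour, goal_cases)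
  case (1 e x)
  then have *: "(e + Suc n) mod Suc (2 * n) < Suc (2 * n)" "x \<le> Suc (2 * n)" by auto
  show ?case using gk_le[OF *] gk_neq[OF _ *] gk_invol[OF *] by simp
qed simp

lemma derangements_kap: "derangements (classes m (Suc n)) (colours m (Suc n)) (kap m n) (kap' m n)"
  unfolding kap_def kap'_def
proof (rule derangements_recolour, goal_cases)
  case (1 e x)
  then have *: "e < Suc (2 * n)" "x \<le> Suc (2 * n)" by auto
  note o = opposite[OF *(1)]
  show ?case
    using walecki_le[OF *] walecki_le(1)[OF o(1) *(2)] walecki_opposite[OF *] walecki_opposite[OF o(1) *(2)]
    by (simp add: o(2))
next
  case (2 e x)
  then show ?case by (simp add: gk_invol)
qed

lemma sharp_lam: "sharp (classes m (Suc n)) (colours m (Suc n)) (lam m n)"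
  unfolding lam_def
proof (rule sharp_recolour, goal_cases)
  case (1 x y)
  then show ?case using gk_unique[of "Suc (2 * n)" x y] by simp
next
  case (2 e x)
  then show ?case using gk_le[of e "Suc (2 * n)" x] by simp
qed

lemma sharp_lam': "sharp (classes m (Suc n)) (colours m (Suc n)) (lam' m n)"
  unfolding lam'_def
proof (rule sharp_recolour, goal_cases)
  case (1 x y)
  let ?N = "Suc (2 * n)"
  have "\<exists>!e. e < ?N \<and> gk ?N e x = y" using 1 gk_unique[of ?N x y] by simp
  then obtain e where e: "e < ?N" "gk ?N e x = y"
    and un: "\<And>e'. e' < ?N \<Longrightarrow> gk ?N e' x = y \<Longrightarrow> e' = e" by blast
  have "\<exists>!z. z < ?N \<and> (z + Suc n) mod ?N = e"
    using e by (intro ex1_residue) auto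
  then obtain z where z: "z < ?N" "(z + Suc n) mod ?N = e"
    and uz: "\<And>z'. z' < ?N \<Longrightarrow> (z' + Suc n) mod ?N = e \<Longrightarrow> z' = z" by blast
  show ?case
  proof (intro ex1I[of _ z] conjI)
    show "z < 2 * Suc n - 1" "gk ?N ((z + Suc n) mod ?N) x = y" using z e by simp_all
    fix z' assume h: "z' < 2 * Suc n - 1 \<and> gk ?N ((z' + Suc n) mod ?N) x = y"
    then have "(z' + Suc n) mod ?N = e" using un[of "(z' + Suc n) mod ?N"] by simp
    then show "z' = z" using uz h by simp
  qed
next
  case (2 e x)
  then show ?case using gk_le[of "(e + Suc n) mod Suc (2 * n)" "Suc (2 * n)" x] by simp
qed

lemma sharp_kap: "sharp (classes m (Suc n)) (colours m (Suc n)) (kap m n)"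
  unfolding kap_def
proof (rule sharp_recolour, goal_cases)
  case (1 x y)
  then show ?case using walecki_unique[of x n y] by simp
next
  case (2 e x)
  then show ?case using walecki_le[of e n x] by simp
qed

lemma exper_lam_lam':
  assumes s: "s \<in> classes m (Suc n)" and v: "v \<in> colours m (Suc n)"
  shows "exper (\<lambda>v. lam m n s (lam' m n s v)) (Suc n) v"
proof (cases "fst s = 0")
  case True
  let ?f = "\<lambda>x. gk (Suc (2 * n)) (snd s) (gk (Suc (2 * n)) ((snd s + Suc n) mod Suc (2 * n)) x)"
  have e: "snd s < Suc (2 * n)" using s True by (auto simp: classes_def)
  have le: "gk (Suc (2 * n)) ((snd s + Suc n) mod Suc (2 * n)) x < 2 * Suc n" if "x < 2 * Suc n" for x
    using gk_le[of "(snd s + Suc n) mod Suc (2 * n)" "Suc (2 * n)" x] that by simp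
  show ?thesis
  proof (rule exper_block[OF v, where f = ?f])
    fix x assume x: "x < 2 * Suc n"
    show "?f x < 2 * Suc n" using gk_le[OF e, of "gk (Suc (2 * n)) ((snd s + Suc n) mod Suc (2 * n)) x"] le[OF x] by simp
    show "exper ?f (Suc n) x" using exper_gk_gk[OF refl e, of x] x by simp
  next
    fix v assume v: "v \<in> colours m (Suc n)"
    note b = to_block[OF v]
    show "lam m n s (lam' m n s v) = of_block m (Suc n) (fst (to_block m (Suc n) v), ?f (snd (to_block m (Suc n) v)))"
      using True of_block[OF b(1) le[OF b(2)]] by (simp add: lam_def lam'_def recolour_def)
  qed
next
  case False
  then have e: "fst s < Suc (2 * m)" "snd s < Suc n" using s by (auto simp: classes_def)
  obtain x w where xw: "v = (x, w)" "x \<le> Suc (2 * m)" "w \<le> n" using v by (auto simp: colours_def)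
  let ?F = "\<lambda>v. lam m n s (lam' m n s v)"
  \<comment> \<open>The product subtracts 1 from the second coordinate; reading it as
    \<open>n - r\<close> turns this into the successor modulo \<open>Suc n\<close>.\<close>
  have F: "?F (x, n - r) = (x, n - (r + 1) mod Suc n)" if r: "r < Suc n" for r
  proof -
    have "(snd s + Suc n - ((snd s + 1 + Suc n - (n - r)) mod Suc n)) mod Suc n = n - (r + 1) mod Suc n"
    proof (rule reflect_reflect)
      show "(n - (r + 1) mod Suc n + (snd s + 1)) mod Suc n = (n - r + snd s) mod Suc n"
      proof (cases "r = n")
        case True
        then have "n - (r + 1) mod Suc n + (snd s + 1) = n - r + snd s + Suc n" by simp
        then show ?thesis by (metis mod_add_self2)
      next
        case False
        then have "(r + 1) mod Suc n = r + 1" using r by simp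
        then have "n - (r + 1) mod Suc n + (snd s + 1) = n - r + snd s" using r False by simp
        then show ?thesis by simp
      qed
    qed (use r in auto)
    then show ?thesis using False gk_invol[OF e(1) xw(2)]
      by (simp add: lam_def lam'_def recolour_def)
  qed
  have "exper ?F (Suc n) (x, n - (n - w)) \<longleftrightarrow> exper (\<lambda>r. (r + 1) mod Suc n) (Suc n) (n - w)"
    by (rule exper_conj[where A = "{..<Suc n}" and h = "\<lambda>r. (x, n - r)"]) (use F in \<open>auto simp: inj_on_def\<close>)
  then show ?thesis using exper_translation[of "Suc n" "n - w"] xw by simp
qed

lemma exper_kap:
  assumes s: "s \<in> classes m (Suc n)" "s \<noteq> (0, n)" and v: "v \<in> colours m (Suc n)"
  shows "exper (kap m n s) (2 * Suc n) v"
proof (cases "fst s = 0")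
  case True
  then have e: "snd s < Suc (2 * n)" "snd s \<noteq> n" using s by (auto simp: classes_def prod_eq_iff)
  show ?thesis
  proof (rule exper_block[OF v, where f = "walecki n (snd s)"])
    fix x assume "x < 2 * Suc n"
    then show "walecki n (snd s) x < 2 * Suc n" "exper (walecki n (snd s)) (2 * Suc n) x"
      using walecki_le[OF e(1), of x] exper_walecki[OF e, of x] by simp_all
  qed (use True in \<open>simp add: kap_def recolour_def\<close>)
next
  case False
  then have e: "fst s < Suc (2 * m)" "snd s < Suc n" using s by (auto simp: classes_def)
  let ?g = "gk (Suc (2 * m)) (fst s)"
  let ?c = "Suc n"
  \<comment> \<open>A base cycle of length 2 starting at the smaller coordinate \<open>x\<close>,
    where the offset is 0; it is 1 at \<open>?g x\<close>, so layer \<open>p\<close> reflects with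
    constant \<open>snd s + p\<close>.\<close>
  have low: "exper (kap m n s) (2 * ?c) (if p = 0 then x else ?g x, w)"
    if "x \<le> Suc (2 * m)" "x < ?g x" "w < ?c" "p < 2" for x w and p :: nat
  proof (rule exper_lift_cycle[where G = "{..<?c}" and h = "\<lambda>p. if p = 0 then x else ?g x"
        and f = "\<lambda>p w. (snd s + p + ?c - w) mod ?c"])
    note g = gk_invol[OF e(1) that(1)]
    fix p y :: nat assume "p < 2" "y \<in> {..<?c}"
    then show "kap m n s (if p = 0 then x else ?g x, y) =
      (if Suc p mod 2 = 0 then x else ?g x, (snd s + p + ?c - y) mod ?c)"
      using False that(2) g by (auto simp: kap_def recolour_def less_2_cases_iff)
  next
    fix p
    show "bij_betw (\<lambda>w. (snd s + p + ?c - w) mod ?c) {..<?c} {..<?c}"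
      by (rule bij_betw_byWitness[where f' = "\<lambda>w. (snd s + p + ?c - w) mod ?c"])
        (use reflect_reflect[of _ ?c _ "snd s + p" "snd s + p"] in auto)
  next
    show "inj_on (\<lambda>p. if p = 0 then x else ?g x) {..<2 :: nat}"
      using that by (auto simp: inj_on_def less_2_cases_iff)
  next
    fix y assume y: "y \<in> {..<?c}"
    have "exper (layers (\<lambda>p w. (snd s + p + ?c - w) mod ?c) 2) ?c y \<longleftrightarrow> exper (\<lambda>w. (w + 1) mod ?c) ?c y"
    proof (rule exper_cong[OF _ _ y])
      fix v assume v: "v \<in> {..<?c}"
      have "(snd s + 1 + ?c - ((snd s + ?c - v) mod ?c)) mod ?c = (v + 1) mod ?c"
        using v by (intro reflect_reflect) (auto simp: mod_simps)
      then show "layers (\<lambda>p w. (snd s + p + ?c - w) mod ?c) 2 v = (v + 1) mod ?c"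
        by (simp add: numeral_2_eq_2)
      show "layers (\<lambda>p w. (snd s + p + ?c - w) mod ?c) 2 v \<in> {..<?c}" by (simp add: numeral_2_eq_2)
    qed
    then show "exper (layers (\<lambda>p w. (snd s + p + ?c - w) mod ?c) 2) ?c y"
      using exper_translation[of ?c y] y by simp
  qed (use that in auto)
  obtain x w where xw: "v = (x, w)" "x \<le> Suc (2 * m)" "w < ?c" using v by (auto simp: colours_def)
  have g: "?g x \<le> Suc (2 * m)" "?g (?g x) = x" "?g x \<noteq> x"
    using gk_le[OF e(1) xw(2)] gk_invol[OF e(1) xw(2)] gk_neq[OF _ e(1) xw(2)] by simp_all
  show ?thesis
  proof (cases "x < ?g x")
    case True
    then show ?thesis using low[OF xw(2) True xw(3), of 0] xw by simp
  next
    case False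
    then show ?thesis using low[OF g(1) _ xw(3), of 1] xw g by simp
  qed
qed

text \<open>The distinguished members of an odd kit: the 1-factor left over is its own inverse, and
  the indices 0 and \<open>Suc n\<close> are one Hamiltonian cycle in its two directions. For
  \<open>n = 0\<close> there is no such cycle.\<close>

lemma kap_exceptional:
  shows "kap' m n (0, n) = kap m n (0, n)"
    and "0 < n \<Longrightarrow> kap m n (0, Suc n) = kap' m n (0, 0)"
    and "0 < n \<Longrightarrow> kap' m n (0, Suc n) = kap m n (0, 0)"
  by (auto simp: kap_def kap'_def recolour_def opposite_def fun_eq_iff)

lemma card_colours: "card (colours m c) = Suc (Suc (2 * m)) * c"
  by (simp add: colours_def)

section \<open>Systems of factors\<close>

text \<open>\<open>\<phi> j s\<close> permutes the vertices outside the part \<open>j\<close> in cycles of length \<open>k\<close>; the sums count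
  how often the edge between \<open>(x, y)\<close> and \<open>(x', z)\<close> is traversed in the two directions.\<close>

definition arc_system :: "'s set \<Rightarrow> 'g set \<Rightarrow> nat \<Rightarrow> 'v set \<Rightarrow>
    ('v \<Rightarrow> 's \<Rightarrow> 'v \<times> 'g \<Rightarrow> 'v \<times> 'g) \<Rightarrow> bool" where
  "arc_system S G k V \<phi> \<longleftrightarrow>
     (\<forall>j\<in>V. \<forall>s\<in>S. \<forall>x\<in>V - {j}. \<forall>y\<in>G.
        fst (\<phi> j s (x, y)) \<in> V - {j, x} \<and> snd (\<phi> j s (x, y)) \<in> G - {y} \<and> exper (\<phi> j s) k (x, y)) \<and>
     (\<forall>x\<in>V. \<forall>x'\<in>V. \<forall>y\<in>G. \<forall>z\<in>G. x \<noteq> x' \<longrightarrow> y \<noteq> z \<longrightarrow>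
        (\<Sum>j\<in>V - {x, x'}. card {s \<in> S. \<phi> j s (x, y) = (x', z)}) +
        (\<Sum>j\<in>V - {x, x'}. card {s \<in> S. \<phi> j s (x', z) = (x, y)}) = 2)"

definition ARC :: "'s set \<Rightarrow> 'g set \<Rightarrow> nat \<Rightarrow> 'v set \<Rightarrow> bool" where
  "ARC S G k V \<longleftrightarrow> (\<exists>\<phi>. arc_system S G k V \<phi>)"

lemma arc_systemD:
  assumes "arc_system S G k V \<phi>" "j \<in> V" "s \<in> S" "x \<in> V" "x \<noteq> j" "y \<in> G"
  shows "fst (\<phi> j s (x, y)) \<in> V" "fst (\<phi> j s (x, y)) \<noteq> j" "fst (\<phi> j s (x, y)) \<noteq> x"
    "snd (\<phi> j s (x, y)) \<in> G" "snd (\<phi> j s (x, y)) \<noteq> y" "exper (\<phi> j s) k (x, y)"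
  using assms unfolding arc_system_def by auto

lemma arc_system_count:
  assumes "arc_system S G k V \<phi>" "x \<in> V" "x' \<in> V" "y \<in> G" "z \<in> G" "x \<noteq> x'" "y \<noteq> z"
  shows "(\<Sum>j\<in>V - {x, x'}. card {s \<in> S. \<phi> j s (x, y) = (x', z)}) +
     (\<Sum>j\<in>V - {x, x'}. card {s \<in> S. \<phi> j s (x', z) = (x, y)}) = 2"
  using assms unfolding arc_system_def by auto

lemma arc_systemI:
  assumes "\<And>j s x y. j \<in> V \<Longrightarrow> s \<in> S \<Longrightarrow> x \<in> V \<Longrightarrow> x \<noteq> j \<Longrightarrow> y \<in> G \<Longrightarrow>
      fst (\<phi> j s (x, y)) \<in> V - {j, x} \<and> snd (\<phi> j s (x, y)) \<in> G - {y} \<and> exper (\<phi> j s) k (x, y)"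
    and "\<And>x x' y z. x \<in> V \<Longrightarrow> x' \<in> V \<Longrightarrow> y \<in> G \<Longrightarrow> z \<in> G \<Longrightarrow> x \<noteq> x' \<Longrightarrow> y \<noteq> z \<Longrightarrow>
      (\<Sum>j\<in>V - {x, x'}. card {s \<in> S. \<phi> j s (x, y) = (x', z)}) +
      (\<Sum>j\<in>V - {x, x'}. card {s \<in> S. \<phi> j s (x', z) = (x, y)}) = 2"
  shows "arc_system S G k V \<phi>"
  using assms unfolding arc_system_def by auto

lemma sum_card_eq_1:
  assumes "finite J" "j0 \<in> J" "\<exists>!s. s \<in> S \<and> P j0 s"
    and "\<And>j s. j \<in> J \<Longrightarrow> s \<in> S \<Longrightarrow> P j s \<Longrightarrow> j = j0"
  shows "(\<Sum>j\<in>J. card {s \<in> S. P j s}) = (1 :: nat)"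
proof -
  obtain s0 where "{s \<in> S. P j0 s} = {s0}" using assms(3) by blast
  moreover have "card {s \<in> S. P j s} = 0" if "j \<in> J" "j \<noteq> j0" for j
    using assms(4) that by (intro card_eq_0_iff[THEN iffD2] disjI1) blast
  ultimately have "card {s \<in> S. P j s} = (if j = j0 then 1 else 0)" if "j \<in> J" for j
    using that by (cases "j = j0") simp_all
  then have "(\<Sum>j\<in>J. card {s \<in> S. P j s}) = (\<Sum>j\<in>J. if j = j0 then 1 else 0)" by (rule sum.cong[OF refl])
  then show ?thesis using assms(1,2) by simp
qed

lemma ARC_transport:
  assumes "ARC S G k V" and h: "bij_betw h V V'" and g: "bij_betw g G G'"
  shows "ARC S G' k V'"
proof -
  from assms(1) obtain \<phi> where sys: "arc_system S G k V \<phi>" unfolding ARC_def ..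
  define h' where "h' = inv_into V h"
  define g' where "g' = inv_into G g"
  have h': "h' (h x) = x" if "x \<in> V" for x using h that by (simp add: h'_def bij_betw_def)
  have g': "g' (g x) = x" if "x \<in> G" for x using g that by (simp add: g'_def bij_betw_def)
  define \<psi> where "\<psi> = (\<lambda>j s (x, y). map_prod h g (\<phi> (h' j) s (h' x, g' y)))"
  have hV: "V' = h ` V" and gG: "G' = g ` G" and injh: "inj_on h V" and injg: "inj_on g G"
    using h g by (auto simp: bij_betw_def)
  have \<psi>: "\<psi> (h j) s (h x, g y) = map_prod h g (\<phi> j s (x, y))" if "j \<in> V" "x \<in> V" "y \<in> G" for j s x y
    using that h' g' by (simp add: \<psi>_def)
  have 1: "fst (\<psi> (h j) s (h x, g y)) \<in> V' - {h j, h x} \<and> snd (\<psi> (h j) s (h x, g y)) \<in> G' - {g y} \<and>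
      exper (\<psi> (h j) s) k (h x, g y)" if j: "j \<in> V" and s: "s \<in> S" and x: "x \<in> V" "x \<noteq> j" and y: "y \<in> G" for j s x y
  proof -
    note p = arc_systemD[OF sys j s x y]
    have "exper (\<psi> (h j) s) k (map_prod h g (x, y)) \<longleftrightarrow> exper (\<phi> j s) k (x, y)"
    proof (rule exper_conj[where A = "(V - {j}) \<times> G"])
      show "inj_on (map_prod h g) ((V - {j}) \<times> G)"
        using injh injg by (auto simp: inj_on_def)
    next
      fix v assume v: "v \<in> (V - {j}) \<times> G"
      then show "\<psi> (h j) s (map_prod h g v) = map_prod h g (\<phi> j s v)"
        using \<psi> j by auto
      show "\<phi> j s v \<in> (V - {j}) \<times> G"
        using arc_systemD[OF sys j s, of "fst v" "snd v"] v by (auto simp: mem_Times_iff)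
    qed (use x y in auto)
    moreover have "h (fst (\<phi> j s (x, y))) \<noteq> h j" "h (fst (\<phi> j s (x, y))) \<noteq> h x"
      "g (snd (\<phi> j s (x, y))) \<noteq> g y"
      using p injh injg j x y by (auto simp: inj_on_def)
    ultimately show ?thesis using \<psi>[OF j x(1) y, of s] p by (simp add: hV gG)
  qed
  have 2: "(\<Sum>j\<in>V' - {h x, h x'}. card {s \<in> S. \<psi> j s (h x, g y) = (h x', g z)})
      = (\<Sum>j\<in>V - {x, x'}. card {s \<in> S. \<phi> j s (x, y) = (x', z)})"
    if "x \<in> V" "x' \<in> V" "y \<in> G" "z \<in> G" for x x' y z
  proof -
    have "bij_betw h (V - {x, x'}) (V' - {h x, h x'})"
      using injh that by (auto simp: bij_betw_def hV inj_on_def)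
    then have "(\<Sum>j\<in>V' - {h x, h x'}. card {s \<in> S. \<psi> j s (h x, g y) = (h x', g z)})
      = (\<Sum>j\<in>V - {x, x'}. card {s \<in> S. \<psi> (h j) s (h x, g y) = (h x', g z)})"
      by (rule sum.reindex_bij_betw[symmetric])
    also have "\<dots> = (\<Sum>j\<in>V - {x, x'}. card {s \<in> S. \<phi> j s (x, y) = (x', z)})"
    proof (rule sum.cong[OF refl])
      fix j assume j: "j \<in> V - {x, x'}"
      have "\<psi> (h j) s (h x, g y) = (h x', g z) \<longleftrightarrow> \<phi> j s (x, y) = (x', z)" if s: "s \<in> S" for s
      proof -
        have jj: "j \<in> V" "x \<noteq> j" using j by auto
        note p = arc_systemD[OF sys jj(1) s \<open>x \<in> V\<close> jj(2) \<open>y \<in> G\<close>]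
        have "h (fst (\<phi> j s (x, y))) = h x' \<longleftrightarrow> fst (\<phi> j s (x, y)) = x'"
          "g (snd (\<phi> j s (x, y))) = g z \<longleftrightarrow> snd (\<phi> j s (x, y)) = z"
          using p injh injg \<open>x' \<in> V\<close> \<open>z \<in> G\<close> by (auto simp: inj_on_def)
        then show ?thesis using \<psi>[OF jj(1) \<open>x \<in> V\<close> \<open>y \<in> G\<close>, of s] by (simp add: prod_eq_iff)
      qed
      then show "card {s \<in> S. \<psi> (h j) s (h x, g y) = (h x', g z)} = card {s \<in> S. \<phi> j s (x, y) = (x', z)}"
        by (metis (mono_tags, lifting))
    qed
    finally show ?thesis .
  qed
  have 3: "(\<Sum>j\<in>V' - {h x, h x'}. card {s \<in> S. \<psi> j s (h x, g y) = (h x', g z)}) +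
        (\<Sum>j\<in>V' - {h x, h x'}. card {s \<in> S. \<psi> j s (h x', g z) = (h x, g y)}) = 2"
    if "x \<in> V" "x' \<in> V" "y \<in> G" "z \<in> G" "h x \<noteq> h x'" "g y \<noteq> g z" for x x' y z
  proof -
    have "x \<noteq> x'" "y \<noteq> z" using that by auto
    then show ?thesis
      using 2[OF that(1-4)] 2[OF that(2,1,4,3)] arc_system_count[OF sys that(1-4)]
      by (simp add: insert_commute)
  qed
  have "arc_system S G' k V' \<psi>"
  proof (rule arc_systemI)
    fix j s x y assume "j \<in> V'" "s \<in> S" "x \<in> V'" "x \<noteq> j" "y \<in> G'"
    then show "fst (\<psi> j s (x, y)) \<in> V' - {j, x} \<and> snd (\<psi> j s (x, y)) \<in> G' - {y} \<and> exper (\<psi> j s) k (x, y)"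
      using 1 unfolding hV gG by blast
  next
    fix x x' y z assume "x \<in> V'" "x' \<in> V'" "y \<in> G'" "z \<in> G'" "x \<noteq> x'" "y \<noteq> z"
    then obtain x0 x0' y0 z0 where "x = h x0" "x' = h x0'" "y = g y0" "z = g z0"
      "x0 \<in> V" "x0' \<in> V" "y0 \<in> G" "z0 \<in> G"
      unfolding hV gG by blast
    with \<open>x \<noteq> x'\<close> \<open>y \<noteq> z\<close> show "(\<Sum>j\<in>V' - {x, x'}. card {s \<in> S. \<psi> j s (x, y) = (x', z)}) +
      (\<Sum>j\<in>V' - {x, x'}. card {s \<in> S. \<psi> j s (x', z) = (x, y)}) = 2"
      using 3[of x0 x0' y0 z0] by simp
  qed
  then show ?thesis unfolding ARC_def by blast
qed

section \<open>Lifting base cycles of even length, and systems on sets of given size\<close>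

definition even_kit :: "'s set \<Rightarrow> 'g set \<Rightarrow> nat \<Rightarrow> ('s \<Rightarrow> 'g \<Rightarrow> 'g) \<Rightarrow> ('s \<Rightarrow> 'g \<Rightarrow> 'g) \<Rightarrow> bool" where
  "even_kit S G c l l' \<longleftrightarrow> derangements S G l l \<and> derangements S G l' l' \<and> sharp S G l \<and> sharp S G l' \<and>
     (\<forall>s\<in>S. \<forall>y\<in>G. exper (\<lambda>y. l s (l' s y)) c y)"

lemma derangements_bij:
  "derangements S G f f' \<Longrightarrow> s \<in> S \<Longrightarrow> bij_betw (f s) G G"
  by (rule bij_betw_byWitness[where f' = "f' s"]) (auto simp: derangements_def)

text \<open>After the first two layers an even number of copies of the involution \<open>l s\<close>
  remains and cancels, so the return map is \<open>l s\<close> after \<open>l' s\<close>, of period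
  \<open>c\<close>.\<close>

lemma exper_even_cycle:
  assumes kit: "even_kit S G c l l'" and "s \<in> S" "even L" "2 \<le> L" "p < L" "y \<in> G" "inj_on h {..<L}"
    and "\<And>p y. p < L \<Longrightarrow> y \<in> G \<Longrightarrow> \<phi> (h p, y) = (h (Suc p mod L), if p = 0 then l' s y else l s y)"
  shows "exper \<phi> (L * c) (h p, y)"
proof (rule exper_lift_cycle[where f = "\<lambda>p. if p = 0 then l' s else l s" and G = G])
  have d: "derangements S G l l" "derangements S G l' l'" using kit by (auto simp: even_kit_def)
  show "bij_betw (if p = 0 then l' s else l s) G G" for p :: nat
    using derangements_bij d assms(2) by auto
  fix y assume y: "y \<in> G"
  have lay: "layers (\<lambda>p. if p = 0 then l' s else l s) L v = l s (l' s v)" if "v \<in> G" for v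
  proof -
    have "layers (\<lambda>p. if p = 0 then l' s else l s) (2 + (L - 2)) v = layers (\<lambda>p. if p = 0 then l' s else l s) 2 v"
      by (rule layers_involution_tail[where g = "l s" and G = G])
        (use d assms(2,3) that in \<open>auto simp: derangements_def numeral_2_eq_2\<close>)
    moreover have "2 + (L - 2) = L" using assms(4) by simp
    ultimately have "layers (\<lambda>p. if p = 0 then l' s else l s) L v = layers (\<lambda>p. if p = 0 then l' s else l s) 2 v"
      by (simp only:)
    then show ?thesis by (simp add: numeral_2_eq_2)
  qed
  have "exper (layers (\<lambda>p. if p = 0 then l' s else l s) L) c y \<longleftrightarrow> exper (\<lambda>y. l s (l' s y)) c y"
    by (rule exper_cong[where A = G]) (use lay d assms(2) y in \<open>auto simp: derangements_def\<close>)
  then show "exper (layers (\<lambda>p. if p = 0 then l' s else l s) L) c y"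
    using kit assms(2) y by (auto simp: even_kit_def)
qed (use assms in auto)

definition good :: "'s set \<Rightarrow> 'g set \<Rightarrow> nat \<Rightarrow> nat \<Rightarrow> bool" where
  "good S G k n \<longleftrightarrow> ARC S G k {..<n}"

lemma goodD:
  assumes "good S G k n" "finite V" "card V = n"
  shows "ARC S G k V"
proof -
  obtain h where "bij_betw h {0..<card V} V" using ex_bij_betw_nat_finite[OF assms(2)] by blast
  then show ?thesis using ARC_transport[of S G k "{..<n}" h V id G] assms
    by (simp add: good_def atLeast0LessThan)
qed

lemma goodI:
  assumes "ARC S G k V" "finite V" "card V = n"
  shows "good S G k n"
proof -
  obtain h where "bij_betw h V {0..<card V}" using ex_bij_betw_finite_nat[OF assms(2)] by blast
  then show ?thesis using ARC_transport[of S G k V h "{..<n}" id G] assms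
    by (simp add: good_def atLeast0LessThan)
qed

section \<open>Frames\<close>

lemma exists_residue_add:
  assumes "(b::nat) < a"
  shows "\<exists>r<a. (a - r + k) mod a = b"
proof -
  obtain z where z: "z < a" "(z + k) mod a = b" using ex1_residue[of a b k] assms by auto
  show ?thesis
  proof (cases "z = 0")
    case True
    then show ?thesis using z by (intro exI[of _ 0]) simp
  next
    case False
    then show ?thesis using z by (intro exI[of _ "a - z"]) simp
  qed
qed

text \<open>\<open>None\<close> is a point at infinity common to the filled holes. It accounts for
  the summand 1 in the number of parts.\<close>

definition points :: "nat \<Rightarrow> 'q set \<Rightarrow> ('q \<times> nat) option set" where
  "points a X = insert None (Some ` (X \<times> {..<a}))"

lemma points_iff [simp]: "None \<in> points a X" "Some (x, b) \<in> points a X \<longleftrightarrow> x \<in> X \<and> b < a"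
  by (auto simp: points_def)

lemma finite_points: "finite X \<Longrightarrow> finite (points a X)"
  by (simp add: points_def)

lemma card_points: "finite X \<Longrightarrow> card (points a X) = a * card X + 1"
  by (simp add: points_def card_image card_insert_if image_iff mult.commute)

text \<open>Filling the holes of a frame. The partition of \<open>Q\<close> into holes is given by a labelling, and
  \<open>\<mu> i\<close> pairs up the elements outside the hole of \<open>i\<close> in such a way that every pair from two
  different holes occurs for exactly one \<open>i\<close>; each such pair carries a cycle of length \<open>2 * a\<close>
  that passes the two copies of \<open>{..<a}\<close> alternately. The predicate \<open>fore\<close> selects one element of
  each pair.\<close>

lemma frame:
  fixes Q :: "'q set" and hole :: "'q \<Rightarrow> 'b" and \<mu> :: "'q \<Rightarrow> 'q \<Rightarrow> 'q"
  assumes fin: "finite Q" and finS: "finite S" and a: "0 < a" and k: "k = 2 * a * c"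
    and kit: "even_kit S G c l l'"
    and mu: "\<And>i x. i \<in> Q \<Longrightarrow> x \<in> Q \<Longrightarrow> hole x \<noteq> hole i \<Longrightarrow>
      \<mu> i x \<in> Q \<and> hole (\<mu> i x) \<noteq> hole i \<and> hole (\<mu> i x) \<noteq> hole x \<and> \<mu> i (\<mu> i x) = x \<and>
      (fore i x \<longleftrightarrow> \<not> fore i (\<mu> i x))"
    and ex1: "\<And>x x'. x \<in> Q \<Longrightarrow> x' \<in> Q \<Longrightarrow> hole x \<noteq> hole x' \<Longrightarrow>
      \<exists>!i. i \<in> Q \<and> hole i \<noteq> hole x \<and> \<mu> i x = x'"
    and fill: "\<And>b. b \<in> hole ` Q \<Longrightarrow> ARC S G k (points a {x \<in> Q. hole x = b})"
  shows "ARC S G k (points a Q)"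
proof -
  define V where "V = points a Q"
  define P where "P = (\<lambda>b. points a {x \<in> Q. hole x = b})"
  have finV: "finite V" by (simp add: V_def finite_points fin)
  have PV: "P b \<subseteq> V" for b by (auto simp: P_def V_def points_def)
  have "\<forall>b\<in>hole ` Q. \<exists>\<phi>. arc_system S G k (P b) \<phi>" using fill by (auto simp: ARC_def P_def)
  then obtain \<Psi> where \<Psi>: "\<And>b. b \<in> hole ` Q \<Longrightarrow> arc_system S G k (P b) (\<Psi> b)" by metis
  \<comment> \<open>The matchings \<open>g -> g + d\<close> forwards and
    \<open>g -> g + (a - 1 - d)\<close> backwards: a round trip adds \<open>a - 1\<close>, that is
    -1, whatever \<open>d\<close> is, so they close to a single cycle of length
    \<open>2 * a\<close>. Every arc in either direction belongs to exactly one \<open>d\<close>. The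
    layer \<open>l'\<close> is used at one place of the cycle only.\<close>
  define cross where "cross = (\<lambda>i d s x g y.
     (Some (\<mu> i x, if fore i x then (g + d) mod a else (g + (a - 1 - d)) mod a),
      if fore i x \<and> g = 0 then l' s y else l s y))"
  \<comment> \<open>If the missing point is \<open>Some (i, d)\<close>, the hole of \<open>i\<close>
    is filled by its own system and \<open>d\<close> selects the crossing cycles outside. If it is
    \<open>None\<close>, every hole is filled separately.\<close>
  define \<phi> where "\<phi> = (\<lambda>j s (v, y). case j of
       None \<Rightarrow> \<Psi> (hole (fst (the v))) None s (v, y)
     | Some (i, d) \<Rightarrow> if v \<in> P (hole i) then \<Psi> (hole i) j s (v, y)
         else cross i d s (fst (the v)) (snd (the v)) y)"
  have in_hole: "\<phi> j s (v, y) = \<Psi> b j s (v, y)"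
    if "v \<in> P b" "j \<in> P b" "v \<noteq> j" "b \<in> hole ` Q" for j s v y b
    using that by (cases j; cases v) (auto simp: \<phi>_def P_def)
  have out: "\<phi> (Some (i, d)) s (Some (x, g), y) = cross i d s x g y" if "hole x \<noteq> hole i" for i d s x g y
    using that by (auto simp: \<phi>_def P_def)
  have closed: "\<Psi> b j s (v, y) \<in> P b \<times> G" "fst (\<Psi> b j s (v, y)) \<noteq> j"
      "fst (\<Psi> b j s (v, y)) \<noteq> v" "snd (\<Psi> b j s (v, y)) \<noteq> y" "exper (\<Psi> b j s) k (v, y)"
    if "b \<in> hole ` Q" "j \<in> P b" "v \<in> P b" "v \<noteq> j" "y \<in> G" "s \<in> S" for b j s v y
    using arc_systemD[OF \<Psi>[OF that(1)] that(2,6,3,4,5)] by (auto simp: mem_Times_iff)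
  have lG: "l s y \<in> G" "l' s y \<in> G" "l s y \<noteq> y" "l' s y \<noteq> y" if "s \<in> S" "y \<in> G" for s y
    using kit that by (auto simp: even_kit_def derangements_def)
  have cross_exper: "exper (\<phi> (Some (i, d)) s) k (Some (x, g), y)"
    if i: "i \<in> Q" "d < a" and x: "x \<in> Q" "g < a" "hole x \<noteq> hole i" and s: "s \<in> S" and y: "y \<in> G"
    for i d s x g y
  proof -
    define x0 where "x0 = (if fore i x then x else \<mu> i x)"
    note mx = mu[OF i(1) x(1,3)]
    have x0: "x0 \<in> Q" "hole x0 \<noteq> hole i" "fore i x0" using mx x by (auto simp: x0_def)
    note m0 = mu[OF i(1) x0(1,2)]
    \<comment> \<open>The cycle is listed from \<open>(x0, 0)\<close>, where the exceptional layer
      sits; the copies then run through \<open>0, -1, -2, ...\<close> on the side of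
      \<open>x0\<close>.\<close>
    define h where "h = (\<lambda>p. Some (if even p then (x0, (a - p div 2) mod a)
        else (\<mu> i x0, (a - p div 2 + d) mod a)))"
    have step: "\<phi> (Some (i, d)) s (h p, y) = (h (Suc p mod (2 * a)), if p = 0 then l' s y else l s y)"
      if p: "p < 2 * a" for p y
    proof (cases "even p")
      case True
      then obtain r where r: "p = 2 * r" by blast
      have "Suc p mod (2 * a) = Suc (2 * r)" using p r by (metis Suc_double_not_eq_double Suc_lessI mod_less)
      moreover have "(a - r) mod a = 0 \<longleftrightarrow> r = 0" using p r by (cases "r = 0") auto
      ultimately show ?thesis using out[OF x0(2)] x0(3) r by (simp add: h_def cross_def mod_simps)
    next
      case False
      then obtain r where r: "p = Suc (2 * r)" by (auto elim: oddE)
      have ra: "r < a" using p r by simp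
      have "Suc p mod (2 * a) = 2 * (Suc r mod a)" using r by (simp add: mod_mult_mult1[of 2 "Suc r" a, simplified])
      moreover have "((a - r + d) mod a + (a - 1 - d)) mod a = (a - Suc r mod a) mod a"
      proof -
        have "((a - r + d) mod a + (a - 1 - d)) mod a = (a - r + d + (a - 1 - d)) mod a" by (simp add: mod_simps)
        also have "a - r + d + (a - 1 - d) = (a - Suc r) + a" using ra i(2) by simp
        also have "\<dots> mod a = (a - Suc r) mod a" by (rule mod_add_self2)
        also have "\<dots> = (a - Suc r mod a) mod a" using ra by (cases "Suc r = a") auto
        finally show ?thesis .
      qed
      moreover have "Suc (2 * r) div 2 = r" by simp
      moreover have "hole (\<mu> i x0) \<noteq> hole i" using m0 by blast
      ultimately show ?thesis using out[of "\<mu> i x0"] m0 x0(3) r by (simp add: h_def cross_def)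
    qed
    have inj: "inj_on h {..<2 * a}"
    proof (rule inj_onI)
      fix p q assume p: "p \<in> {..<2 * a}" and q: "q \<in> {..<2 * a}" and e: "h p = h q"
      have "x0 \<noteq> \<mu> i x0" using m0 by metis
      then have par: "even p \<longleftrightarrow> even q" using e by (auto simp: h_def split: if_splits)
      define r t where "r = p div 2" and "t = q div 2"
      have rt: "r < a" "t < a" using p q by (auto simp: r_def t_def)
      have "\<exists>k. (k + (a - r)) mod a = (k + (a - t)) mod a"
        using e par by (cases "even p") (auto simp: h_def r_def t_def add.commute intro: exI[of _ 0] exI[of _ d])
      then have "(a - r) mod a = (a - t) mod a" by (metis cong_add_lcancel_nat cong_def)
      then have "r = t" using rt by (cases "r = 0"; cases "t = 0") auto
      then show "p = q" using par by (metis r_def t_def even_two_times_div_two odd_two_times_div_two_succ)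
    qed
    have "\<exists>p<2 * a. h p = Some (x, g)"
    proof (cases "fore i x")
      case True
      obtain r where "r < a" "(a - r + 0) mod a = g" using exists_residue_add[OF x(2), of 0] by blast
      then show ?thesis using True by (intro exI[of _ "2 * r"]) (simp add: h_def x0_def)
    next
      case False
      obtain r where "r < a" "(a - r + d) mod a = g" using exists_residue_add[OF x(2)] by blast
      then show ?thesis using False mx by (intro exI[of _ "Suc (2 * r)"]) (simp add: h_def x0_def)
    qed
    then obtain p where p: "p < 2 * a" "h p = Some (x, g)" by blast
    have "exper (\<phi> (Some (i, d)) s) (2 * a * c) (h p, y)"
      by (rule exper_even_cycle[OF kit s _ _ p(1) y inj step]) (use a in auto)
    then show ?thesis using p k by simp
  qed
  have cross_count: "(\<Sum>j\<in>V - {v, v'}. card {s \<in> S. \<phi> j s (v, y) = (v', z)}) = 1"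
    if v: "v = Some (x, g)" "v' = Some (x', g')" and V: "v \<in> V" "v' \<in> V" and hh: "hole x \<noteq> hole x'"
      and yz: "y \<in> G" "z \<in> G" "y \<noteq> z" for v v' x g x' g' y z
  proof -
    have x: "x \<in> Q" "g < a" "x' \<in> Q" "g' < a" using v V by (auto simp: V_def)
    obtain i where i: "i \<in> Q" "hole i \<noteq> hole x" "\<mu> i x = x'"
      and un: "\<And>i'. i' \<in> Q \<Longrightarrow> hole i' \<noteq> hole x \<Longrightarrow> \<mu> i' x = x' \<Longrightarrow> i' = i"
      using ex1[OF x(1,3) hh] by blast
    have hi': "hole i \<noteq> hole x'" using mu[of i x] i x by auto
    have "\<exists>!d. d < a \<and> (if fore i x then (g + d) mod a else (g + (a - 1 - d)) mod a) = g'"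
    proof (cases "fore i x")
      case True
      then show ?thesis using ex1_residue[of a g' g] a x(4) by (simp add: add.commute)
    next
      case False
      have "\<exists>!z. z < a \<and> (z + g) mod a = g'" using a x(4) by (intro ex1_residue)
      then obtain z where z: "z < a" "(z + g) mod a = g'" "\<And>z'. z' < a \<Longrightarrow> (z' + g) mod a = g' \<Longrightarrow> z' = z"
        by blast
      show ?thesis
      proof (rule ex1I[of _ "a - 1 - z"])
        show "a - 1 - z < a \<and> (if fore i x then (g + (a - 1 - z)) mod a else (g + (a - 1 - (a - 1 - z))) mod a) = g'"
        proof -
          have "a - 1 - (a - 1 - z) = z" using z(1) by simp
          then show ?thesis using False z(1,2) by (simp add: add.commute)
        qed
        fix d assume "d < a \<and> (if fore i x then (g + d) mod a else (g + (a - 1 - d)) mod a) = g'"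
        then have "d < a" "(a - 1 - d + g) mod a = g'"
          using False by (simp_all only: if_False add.commute[of "a - 1 - d"])
        then have "a - 1 - d = z" using z(3) a by simp
        then show "d = a - 1 - z" using \<open>d < a\<close> by simp
      qed
    qed
    then obtain d where d: "d < a" "(if fore i x then (g + d) mod a else (g + (a - 1 - d)) mod a) = g'"
      and und: "\<And>d'. d' < a \<Longrightarrow> (if fore i x then (g + d') mod a else (g + (a - 1 - d')) mod a) = g' \<Longrightarrow> d' = d"
      by metis
    show ?thesis
    proof (rule sum_card_eq_1[where ?j0.0 = "Some (i, d)"])
      show "finite (V - {v, v'})" using finV by simp
      show "Some (i, d) \<in> V - {v, v'}" using i d hi' by (auto simp: V_def v)
      have "\<exists>!s. s \<in> S \<and> (if fore i x \<and> g = 0 then l' s y else l s y) = z"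
      proof -
        have "\<exists>!s. s \<in> S \<and> l s y = z" "\<exists>!s. s \<in> S \<and> l' s y = z"
          using kit yz unfolding even_kit_def sharp_def by blast+
        then show ?thesis by (cases "fore i x \<and> g = 0") (simp_all only: if_True if_False simp_thms)
      qed
      then show "\<exists>!s. s \<in> S \<and> \<phi> (Some (i, d)) s (v, y) = (v', z)"
        using out[of x i d _ g y] i d by (simp add: v cross_def)
    next
      fix j s assume j: "j \<in> V - {v, v'}" and s: "s \<in> S" and e: "\<phi> j s (v, y) = (v', z)"
      show "j = Some (i, d)"
      proof (cases "j \<in> P (hole x)")
        case True
        have "\<phi> j s (v, y) = \<Psi> (hole x) j s (v, y)"
          using True j x by (intro in_hole) (auto simp: v P_def)
        moreover have "\<Psi> (hole x) j s (v, y) \<in> P (hole x) \<times> G"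
          using True j x s yz by (intro closed) (auto simp: v P_def)
        ultimately show ?thesis using e v hh by (auto simp: P_def)
      next
        case False
        then obtain i' d' where j': "j = Some (i', d')" "i' \<in> Q" "d' < a" "hole i' \<noteq> hole x"
          using j by (cases j) (auto simp: V_def P_def)
        then have "cross i' d' s x g y = (v', z)" using out[of x i' d' s g y] e v by simp
        then have "\<mu> i' x = x'" "(if fore i' x then (g + d') mod a else (g + (a - 1 - d')) mod a) = g'"
          by (auto simp: cross_def v)
        then show ?thesis using un und j' by metis
      qed
    qed
  qed
  have "arc_system S G k V \<phi>"
  proof (rule arc_systemI, goal_cases)
    case (1 j s v y)
    note j = 1(1) and s = 1(2) and v = 1(3,4) and y = 1(5)
    show ?case
    proof (cases "\<exists>b\<in>hole ` Q. v \<in> P b \<and> j \<in> P b")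
      case True
      then obtain b where b: "b \<in> hole ` Q" "v \<in> P b" "j \<in> P b" by blast
      note cl = closed[OF b(1,3,2) v(2) y s]
      have "exper (\<phi> j s) k (v, y) \<longleftrightarrow> exper (\<Psi> b j s) k (v, y)"
      proof (rule exper_cong[where A = "(P b - {j}) \<times> G"])
        fix u assume "u \<in> (P b - {j}) \<times> G"
        then have u: "fst u \<in> P b" "fst u \<noteq> j" "snd u \<in> G" by auto
        show "\<phi> j s u = \<Psi> b j s u" using in_hole[OF u(1) b(3) u(2) b(1), of s "snd u"] by simp
        then show "\<phi> j s u \<in> (P b - {j}) \<times> G"
          using closed(1,2)[OF b(1,3) u(1,2,3) s] by (simp add: mem_Times_iff)
      qed (use b v y in auto)
      then show ?thesis using in_hole[OF b(2,3) v(2) b(1), of s y] cl PV[of b] by (auto simp: mem_Times_iff)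
    next
      case False
      have "j \<noteq> None"
      proof
        assume "j = None"
        then have "v \<in> P (hole (fst (the v)))" "hole (fst (the v)) \<in> hole ` Q" "j \<in> P (hole (fst (the v)))"
          using v by (cases v; auto simp: V_def P_def)+
        then show False using False by blast
      qed
      then obtain i d where i: "j = Some (i, d)" "i \<in> Q" "d < a" using j by (cases j) (auto simp: V_def)
      have jP: "j \<in> P (hole i)" "hole i \<in> hole ` Q" using i by (auto simp: P_def)
      then have vP: "v \<notin> P (hole i)" using False by blast
      then have "v \<noteq> None" by (metis P_def points_iff(1))
      then obtain x g where x: "v = Some (x, g)" "x \<in> Q" "g < a" using v by (cases v) (auto simp: V_def)
      have hx: "hole x \<noteq> hole i" using vP x by (auto simp: P_def)
      have "\<phi> j s (v, y) = cross i d s x g y" using out[OF hx] i x by simp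
      moreover have "\<mu> i x \<in> Q" "\<mu> i x \<noteq> i" "\<mu> i x \<noteq> x"
        using mu[OF i(2) x(2) hx] by metis+
      then have "fst (cross i d s x g y) \<in> V - {j, v}"
        using a by (simp add: cross_def V_def i(1) x(1))
      moreover have "snd (cross i d s x g y) \<in> G - {y}"
        using lG[OF s y] by (simp add: cross_def)
      moreover have "exper (\<phi> j s) k (v, y)"
        using cross_exper[OF i(2,3) x(2,3) hx s y] by (simp only: i(1) x(1))
      ultimately show ?thesis by simp
    qed
  next
    case (2 v v' y z)
    note V = 2(1,2) and yz = 2(3,4) and ne = 2(5,6)
    show ?case
    proof (cases "\<exists>b\<in>hole ` Q. v \<in> P b \<and> v' \<in> P b")
      case True
      then obtain b where b: "b \<in> hole ` Q" "v \<in> P b" "v' \<in> P b" by blast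
      \<comment> \<open>For two points of one hole with infinity only the missing points of the same
        hole contribute: crossing cycles always change the hole, and two different holes share only
        infinity.\<close>
      have restrict: "(\<Sum>j\<in>V - {w, w'}. card {s \<in> S. \<phi> j s (w, y) = (w', z)}) =
        (\<Sum>j\<in>P b - {w, w'}. card {s \<in> S. \<Psi> b j s (w, y) = (w', z)})"
        if w: "w \<in> P b" "w' \<in> P b" "w \<noteq> w'" and yz: "y \<in> G" "z \<in> G" for w w' y z
      proof -
        have "(\<Sum>j\<in>P b - {w, w'}. card {s \<in> S. \<Psi> b j s (w, y) = (w', z)}) =
          (\<Sum>j\<in>P b - {w, w'}. card {s \<in> S. \<phi> j s (w, y) = (w', z)})"
          by (rule sum.cong[OF refl]) (use in_hole[OF w(1) _ _ b(1)] in auto)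
        also have "\<dots> = (\<Sum>j\<in>V - {w, w'}. card {s \<in> S. \<phi> j s (w, y) = (w', z)})"
        proof (rule sum.mono_neutral_left)
          show "finite (V - {w, w'})" using finV by simp
          show "P b - {w, w'} \<subseteq> V - {w, w'}" using PV by blast
          show "\<forall>j\<in>V - {w, w'} - (P b - {w, w'}). card {s \<in> S. \<phi> j s (w, y) = (w', z)} = 0"
          proof
            fix j assume j: "j \<in> V - {w, w'} - (P b - {w, w'})"
            then obtain i d where i: "j = Some (i, d)" "i \<in> Q" "d < a" "hole i \<noteq> b"
              by (cases j) (auto simp: V_def P_def)
            have False if s: "s \<in> S" and e: "\<phi> j s (w, y) = (w', z)" for s
            proof (cases w)
              case None
              then have "\<phi> j s (w, y) = \<Psi> (hole i) j s (w, y)"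
                using i by (intro in_hole) (auto simp: P_def)
              then have "w' \<in> P (hole i)"
                using closed(1)[of "hole i" j w y s] e i None s yz by (auto simp: P_def)
              then show False using w None i by (cases w') (auto simp: P_def)
            next
              case (Some p)
              then obtain x g where x: "w = Some (x, g)" "x \<in> Q" "hole x = b"
                using w by (cases p) (auto simp: P_def)
              then have "\<phi> j s (w, y) = cross i d s x g y" using out[of x i d s g y] i by auto
              then have "\<exists>\<gamma>. w' = Some (\<mu> i x, \<gamma>)" using e by (auto simp: cross_def)
              moreover have "hole (\<mu> i x) \<noteq> hole x" using mu[of i x] i x by auto
              ultimately show False using w x by (auto simp: P_def)
            qed
            then have "{s \<in> S. \<phi> j s (w, y) = (w', z)} = {}" by blast
            then show "card {s \<in> S. \<phi> j s (w, y) = (w', z)} = 0" by (metis card.empty)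
          qed
        qed
        finally show ?thesis by simp
      qed
      show ?thesis
        using restrict[OF b(2,3) ne(1) yz] restrict[OF b(3,2) ne(1)[symmetric] yz(2,1)]
          arc_system_count[OF \<Psi>[OF b(1)] b(2,3) yz ne] by (simp add: insert_commute)
    next
      case False
      have "v \<noteq> None"
      proof
        assume "v = None"
        then have "v' \<in> P (hole (fst (the v')))" "hole (fst (the v')) \<in> hole ` Q" "v \<in> P (hole (fst (the v')))"
          using V ne by (cases v'; auto simp: V_def P_def)+
        then show False using False by blast
      qed
      moreover have "v' \<noteq> None"
      proof
        assume "v' = None"
        then have "v \<in> P (hole (fst (the v)))" "hole (fst (the v)) \<in> hole ` Q" "v' \<in> P (hole (fst (the v)))"
          using V ne by (cases v; auto simp: V_def P_def)+
        then show False using False by blast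
      qed
      ultimately obtain x g x' g' where x: "v = Some (x, g)" "v' = Some (x', g')" by auto
      then have "hole x \<noteq> hole x'" using False V by (auto simp: V_def P_def)
      then show ?thesis
        using cross_count[OF x V _ yz ne(2)] cross_count[OF x(2,1) V(2,1) _ yz(2,1) ne(2)[symmetric]]
        by (simp add: insert_commute)
    qed
  qed
  then show ?thesis unfolding ARC_def V_def by blast
qed

text \<open>The direct product of the frame with the commutative quasigroup on the residues modulo
  \<open>h\<close> in which \<open>i\<close> pairs \<open>x\<close> with \<open>i - x\<close>. That
  pairing may have fixed points, but the first coordinate changes anyway, which is also why
  comparing first coordinates serves as \<open>fore\<close>.\<close>

lemma frame_inflate:
  fixes Q :: "nat set" and hole :: "nat \<Rightarrow> 'b" and \<mu> :: "nat \<Rightarrow> nat \<Rightarrow> nat"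
  assumes fin: "finite Q" and finS: "finite S" and a: "0 < a" and k: "k = 2 * a * c" and h: "0 < h"
    and kit: "even_kit S G c l l'"
    and mu: "\<And>i x. i \<in> Q \<Longrightarrow> x \<in> Q \<Longrightarrow> hole x \<noteq> hole i \<Longrightarrow>
      \<mu> i x \<in> Q \<and> hole (\<mu> i x) \<noteq> hole i \<and> hole (\<mu> i x) \<noteq> hole x \<and> \<mu> i (\<mu> i x) = x"
    and ex1: "\<And>x x'. x \<in> Q \<Longrightarrow> x' \<in> Q \<Longrightarrow> hole x \<noteq> hole x' \<Longrightarrow>
      \<exists>!i. i \<in> Q \<and> hole i \<noteq> hole x \<and> \<mu> i x = x'"
    and size: "\<And>b. b \<in> hole ` Q \<Longrightarrow> card {x \<in> Q. hole x = b} = n"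
    and fill: "good S G k (a * (n * h) + 1)"
  shows "good S G k (a * (card Q * h) + 1)"
proof (rule goodI)
  let ?Q = "Q \<times> {..<h}"
  show "finite (points a ?Q)" using fin by (intro finite_points) simp
  show "card (points a ?Q) = a * (card Q * h) + 1" using fin by (subst card_points) (auto simp: card_cartesian_product)
  define m where "m = (\<lambda>i x. (\<mu> (fst i) (fst x), (snd i + h - snd x) mod h))"
  show "ARC S G k (points a ?Q)"
  proof (rule frame[where hole = "\<lambda>x. hole (fst x)" and \<mu> = m and fore = "\<lambda>i x. fst x < \<mu> (fst i) (fst x)"])
    fix i x assume i: "i \<in> ?Q" and x: "x \<in> ?Q" and hh: "hole (fst x) \<noteq> hole (fst i)"
    have i': "fst i \<in> Q" "snd i < h" and x': "fst x \<in> Q" "snd x < h" using i x by auto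
    note M = mu[OF i'(1) x'(1) hh]
    have "(snd i + h - (snd i + h - snd x) mod h) mod h = snd x"
      by (rule reflect_reflect) (use x' in auto)
    moreover have "\<mu> (fst i) (fst x) \<noteq> fst x" using M by metis
    ultimately show "m i x \<in> ?Q \<and> hole (fst (m i x)) \<noteq> hole (fst i) \<and> hole (fst (m i x)) \<noteq> hole (fst x) \<and>
        m i (m i x) = x \<and> (fst x < \<mu> (fst i) (fst x) \<longleftrightarrow> \<not> fst (m i x) < \<mu> (fst i) (fst (m i x)))"
      using M h by (auto simp: m_def prod_eq_iff)
  next
    fix x x' assume x: "x \<in> ?Q" and x': "x' \<in> ?Q" and hh: "hole (fst x) \<noteq> hole (fst x')"
    then have xx: "fst x \<in> Q" "fst x' \<in> Q" "snd x < h" "snd x' < h" by auto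
    obtain i where i: "i \<in> Q" "hole i \<noteq> hole (fst x)" "\<mu> i (fst x) = fst x'"
      and uni: "\<And>i'. i' \<in> Q \<Longrightarrow> hole i' \<noteq> hole (fst x) \<Longrightarrow> \<mu> i' (fst x) = fst x' \<Longrightarrow> i' = i"
      using ex1[OF xx(1,2) hh] by blast
    have "\<exists>!z. z < h \<and> (z + (h - snd x)) mod h = snd x'" using h xx by (intro ex1_residue)
    then obtain z where z: "z < h" "(z + (h - snd x)) mod h = snd x'"
      and unz: "\<And>z'. z' < h \<Longrightarrow> (z' + (h - snd x)) mod h = snd x' \<Longrightarrow> z' = z" by blast
    have eq: "z' + h - snd x = z' + (h - snd x)" for z' using xx by simp
    show "\<exists>!i. i \<in> ?Q \<and> hole (fst i) \<noteq> hole (fst x) \<and> m i x = x'"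
    proof (rule ex1I[of _ "(i, z)"])
      show "(i, z) \<in> ?Q \<and> hole (fst (i, z)) \<noteq> hole (fst x) \<and> m (i, z) x = x'"
        using i z eq by (simp add: m_def prod_eq_iff)
      fix i' assume i': "i' \<in> ?Q \<and> hole (fst i') \<noteq> hole (fst x) \<and> m i' x = x'"
      then have "fst i' = i" using uni[of "fst i'"] by (auto simp: m_def)
      moreover have "snd i' = z" using unz[of "snd i'"] i' eq by (auto simp: m_def)
      ultimately show "i' = (i, z)" by (simp add: prod_eq_iff)
    qed
  next
    fix b assume "b \<in> (\<lambda>x. hole (fst x)) ` ?Q"
    then have b: "b \<in> hole ` Q" by auto
    have e: "{x \<in> ?Q. hole (fst x) = b} = {x \<in> Q. hole x = b} \<times> {..<h}" by auto
    show "ARC S G k (points a {x \<in> ?Q. hole (fst x) = b})"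
      unfolding e
    proof (rule goodD[OF fill])
      show "finite (points a ({x \<in> Q. hole x = b} \<times> {..<h}))" using fin by (intro finite_points) simp
      show "card (points a ({x \<in> Q. hole x = b} \<times> {..<h})) = a * (n * h) + 1"
        using fin size[OF b] by (subst card_points) (auto simp: card_cartesian_product)
    qed
  qed (use fin finS a k kit in auto)
qed

text \<open>For odd \<open>q\<close> the reflection at \<open>i\<close> fixes only \<open>i\<close>:
  in \<open>gk q\<close> the point \<open>i\<close> is exchanged with the additional point, and all
  other residues are paired. This is the idempotent commutative quasigroup of midpoints.\<close>

lemma good_odd_multiple:
  assumes "finite S" "0 < a" "k = 2 * a * c" "0 < h" "even_kit S G c l l'"
    and q: "odd q" and fill: "good S G k (a * h + 1)"
  shows "good S G k (a * (q * h) + 1)"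
proof -
  have "good S G k (a * (card {..<q} * h) + 1)"
  proof (rule frame_inflate[where hole = id and \<mu> = "gk q" and n = 1])
    fix i x assume "i \<in> {..<q}" "x \<in> {..<q}" "id x \<noteq> id i"
    then have ix: "i < q" "x < q" "x \<noteq> i" by auto
    have le: "x \<le> q" using ix by simp
    note g = gk_mod(1)[OF ix] gk_neq[OF q ix(1) le] gk_invol[OF ix(1) le]
    moreover have "gk q i x \<noteq> i"
      using g ix by (metis gk_def less_irrefl)
    ultimately show "gk q i x \<in> {..<q} \<and> id (gk q i x) \<noteq> id i \<and> id (gk q i x) \<noteq> id x \<and> gk q i (gk q i x) = x"
      by simp
  next
    fix x x' assume "x \<in> {..<q}" "x' \<in> {..<q}" "id x \<noteq> id x'"
    then have xx: "x < q" "x' < q" "x \<noteq> x'" by auto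
    then have "\<exists>!i. i < q \<and> gk q i x = x'" using q by (intro gk_unique) auto
    moreover have "gk q x x = q" using xx by (simp add: gk_def)
    then have "gk q i x = x' \<Longrightarrow> i \<noteq> x" for i using xx by auto
    ultimately show "\<exists>!i. i \<in> {..<q} \<and> id i \<noteq> id x \<and> gk q i x = x'" by (metis id_apply lessThan_iff)
  next
    fix b assume "b \<in> id ` {..<q}"
    then have "{x \<in> {..<q}. id x = b} = {b}" by auto
    then show "card {x \<in> {..<q}. id x = b} = 1" by simp
  qed (use assms in auto)
  then show ?thesis by simp
qed

text \<open>The pairs {1, 2}, {3, 6}, {5, 7} partition the residues modulo 8 outside the subgroup
  {0, 4}, and so do their differences 1, 3, 2 taken with both signs. They form a frame starter of
  type \<open>2^4\<close>, developed in \<open>pair8\<close>.\<close>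

definition swap8 :: "nat \<Rightarrow> nat" where
  "swap8 d = (if d = 1 then 2 else if d = 2 then 1 else if d = 3 then 6 else if d = 6 then 3
     else if d = 5 then 7 else if d = 7 then 5 else d)"

definition pair8 :: "nat \<Rightarrow> nat \<Rightarrow> nat" where
  "pair8 i x = (i + swap8 ((x + 8 - i) mod 8)) mod 8"

lemma pair8:
  "\<forall>i\<in>set [0..<8]. \<forall>x\<in>set [0..<8]. x mod 4 \<noteq> i mod 4 \<longrightarrow> pair8 i x < 8 \<and>
     pair8 i x mod 4 \<noteq> i mod 4 \<and> pair8 i x mod 4 \<noteq> x mod 4 \<and> pair8 i (pair8 i x) = x"
  by code_simp

lemma pair8_ex1:
  "\<forall>x\<in>set [0..<8]. \<forall>x'\<in>set [0..<8]. x mod 4 \<noteq> x' mod 4 \<longrightarrow>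
     length (filter (\<lambda>i. i mod 4 \<noteq> x mod 4 \<and> pair8 i x = x') [0..<8]) = 1"
  by code_simp

lemma pair8_card:
  "\<forall>b\<in>set [0..<4]. length (filter (\<lambda>x. x mod 4 = b) [0..<8]) = 2"
  by code_simp

lemma set_upt_8: "set [0..<8] = {..<8}"
  by auto

text \<open>The holes are the cosets of {0, 4} modulo 8, each inflated to size
  \<open>2 * h\<close>.\<close>

lemma good_eight:
  assumes "finite S" "0 < a" "k = 2 * a * c" "0 < h" "even_kit S G c l l'"
    and fill: "good S G k (a * (2 * h) + 1)"
  shows "good S G k (a * (8 * h) + 1)"
proof -
  have "good S G k (a * (card {..<8 :: nat} * h) + 1)"
  proof (rule frame_inflate[where hole = "\<lambda>x. x mod 4" and \<mu> = pair8 and n = 2])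
    fix i x :: nat assume "i \<in> {..<8}" "x \<in> {..<8}" "x mod 4 \<noteq> i mod 4"
    then show "pair8 i x \<in> {..<8} \<and> pair8 i x mod 4 \<noteq> i mod 4 \<and> pair8 i x mod 4 \<noteq> x mod 4 \<and> pair8 i (pair8 i x) = x"
      using pair8 unfolding set_upt_8 by blast
  next
    fix x x' :: nat assume "x \<in> {..<8}" "x' \<in> {..<8}" "x mod 4 \<noteq> x' mod 4"
    then have "length (filter (\<lambda>i. i mod 4 \<noteq> x mod 4 \<and> pair8 i x = x') [0..<8]) = 1"
      using pair8_ex1 unfolding set_upt_8 by blast
    then obtain i where "filter (\<lambda>i. i mod 4 \<noteq> x mod 4 \<and> pair8 i x = x') [0..<8] = [i]"
      by (auto simp: length_Suc_conv)
    then have "{i \<in> set [0..<8]. i mod 4 \<noteq> x mod 4 \<and> pair8 i x = x'} = {i}"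
      by (metis empty_set list.simps(15) set_filter)
    then have "j \<in> {i \<in> set [0..<8]. i mod 4 \<noteq> x mod 4 \<and> pair8 i x = x'} \<longleftrightarrow> j \<in> {i}" for j
      by (simp only:)
    then have iff: "j < 8 \<and> j mod 4 \<noteq> x mod 4 \<and> pair8 j x = x' \<longleftrightarrow> j = i" for j
      by (simp only: mem_Collect_eq set_upt_8 lessThan_iff singleton_iff)
    show "\<exists>!i. i \<in> {..<8} \<and> i mod 4 \<noteq> x mod 4 \<and> pair8 i x = x'"
      by (simp only: lessThan_iff iff) simp
  next
    fix b :: nat assume "b \<in> (\<lambda>x. x mod 4) ` {..<8 :: nat}"
    then have "b \<in> set [0..<4]" by auto
    then have "length (filter (\<lambda>x. x mod 4 = b) [0..<8]) = 2" using pair8_card by blast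
    moreover have "{x \<in> {..<8}. x mod 4 = b} = set (filter (\<lambda>x. x mod 4 = b) [0..<8])" by auto
    ultimately show "card {x \<in> {..<8}. x mod 4 = b} = 2" by (metis distinct_card distinct_filter distinct_upt)
  qed (use assms in auto)
  then show ?thesis by simp
qed

section \<open>Cyclic constructions for even cycles\<close>

text \<open>A base factor missing the residue 0 is developed modulo \<open>u\<close>. Since its
  directed differences cover each nonzero residue once, every ordered pair is an arc of exactly one
  translate, and every edge is used once in each direction. \<open>start\<close> marks one vertex of
  each cycle for the exceptional layer \<open>l'\<close>.\<close>

lemma cyclic_base:
  fixes K :: "'k set" and H :: "'k \<Rightarrow> int"
  assumes u: "0 < u" and finS: "finite S" and L: "even L" "2 \<le> L" and k: "k = L * c"
    and kit: "even_kit S G c l l'"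
    and res: "\<And>x. x mod u \<noteq> 0 \<Longrightarrow> \<exists>!v. v \<in> K \<and> H v mod u = x mod u"
    and nz: "\<And>v. v \<in> K \<Longrightarrow> H v mod u \<noteq> 0"
    and diff: "\<And>d. d mod u \<noteq> 0 \<Longrightarrow> \<exists>!v. v \<in> K \<and> (H (nxt v) - H v) mod u = d mod u"
    and cyc: "\<And>v. v \<in> K \<Longrightarrow> \<exists>h p. p < L \<and> h p = v \<and> inj_on h {..<L} \<and>
      (\<forall>p<L. h p \<in> K \<and> nxt (h p) = h (Suc p mod L) \<and> (start (h p) \<longleftrightarrow> p = 0))"
  shows "ARC S G k {0..<u}"
proof -
  define pos where "pos = (\<lambda>x. THE v. v \<in> K \<and> H v mod u = x mod u)"
  define \<phi> where "\<phi> = (\<lambda>j s (x, y). ((j + H (nxt (pos (x - j)))) mod u,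
     if start (pos (x - j)) then l' s y else l s y))"
  have inj: "v = v'" if "v \<in> K" "v' \<in> K" "H v mod u = H v' mod u" for v v'
    using res[of "H v"] nz that by metis
  have pos: "pos x \<in> K" "H (pos x) mod u = x mod u" if "x mod u \<noteq> 0" for x
    using theI'[OF res[OF that]] by (simp_all add: pos_def)
  have posH: "pos x = v" if "v \<in> K" "H v mod u = x mod u" for x v
    using inj[of "pos x" v] pos[of x] nz[OF that(1)] that by auto
  have nxtK: "nxt v \<in> K" "nxt v \<noteq> v" if "v \<in> K" for v
  proof -
    obtain h p where h: "p < L" "h p = v" "inj_on h {..<L}"
      "\<And>p. p < L \<Longrightarrow> h p \<in> K" "\<And>p. p < L \<Longrightarrow> nxt (h p) = h (Suc p mod L)"
      using cyc[OF \<open>v \<in> K\<close>] by blast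
    have "Suc p mod L < L" "Suc p mod L \<noteq> p" using h(1) L(2) by (auto simp: mod_Suc)
    then show "nxt v \<in> K" "nxt v \<noteq> v" using h by (metis, metis inj_on_eq_iff lessThan_iff)
  qed
  have lG: "l s y \<in> G" "l' s y \<in> G" "l s y \<noteq> y" "l' s y \<noteq> y" if "s \<in> S" "y \<in> G" for s y
    using kit that by (auto simp: even_kit_def derangements_def)
  have sub_nz: "(x - j) mod u \<noteq> 0" if "x \<in> {0..<u}" "j \<in> {0..<u}" "x \<noteq> j" for x j
  proof
    assume "(x - j) mod u = 0"
    then have "x mod u = j mod u" by (simp add: mod_eq_dvd_iff mod_0_imp_dvd)
    then show False using that by simp
  qed
  have count: "(\<Sum>j\<in>{0..<u} - {x, x'}. card {s \<in> S. \<phi> j s (x, y) = (x', z)}) = 1"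
    if x: "x \<in> {0..<u}" "x' \<in> {0..<u}" and yz: "y \<in> G" "z \<in> G" and ne: "x \<noteq> x'" "y \<noteq> z" for x x' y z
  proof -
    have "(x' - x) mod u \<noteq> 0" using sub_nz[OF x(2,1)] ne by auto
    then obtain v where v: "v \<in> K" "(H (nxt v) - H v) mod u = (x' - x) mod u"
      and un: "\<And>v'. v' \<in> K \<Longrightarrow> (H (nxt v') - H v') mod u = (x' - x) mod u \<Longrightarrow> v' = v"
      using diff[of "x' - x"] by blast
    \<comment> \<open>The translate in which the arc from \<open>v\<close> to \<open>nxt v\<close>
      becomes the arc from \<open>x\<close> to \<open>x'\<close>.\<close>
    define i where "i = (x - H v) mod u"
    have iu: "i \<in> {0..<u}" using u by (simp add: i_def)
    have xi: "H v mod u = (x - i) mod u" by (simp add: i_def mod_simps)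
    have x'i: "(i + H (nxt v)) mod u = x'"
    proof -
      have "(i + H (nxt v)) mod u = (x + (H (nxt v) - H v)) mod u" by (simp add: i_def mod_simps algebra_simps)
      also have "\<dots> = (x + (x' - x)) mod u" using v(2) by (metis mod_add_right_eq)
      finally show ?thesis using x by simp
    qed
    have "i \<noteq> x" using nz[OF v(1)] xi by auto
    moreover have "i \<noteq> x'"
    proof
      assume "i = x'"
      then have "(i + H (nxt v)) mod u = i mod u" using x'i x by simp
      then have "(i + H (nxt v) - i) mod u = 0" by (metis mod_diff_left_eq cancel_comm_monoid_add_class.diff_cancel mod_0 mod_diff_eq)
      then show False using nz[OF nxtK(1)[OF v(1)]] by simp
    qed
    ultimately have i: "i \<in> {0..<u} - {x, x'}" using iu by simp
    show ?thesis
    proof (rule sum_card_eq_1[where ?j0.0 = i])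
      have "\<exists>!s. s \<in> S \<and> (if start v then l' s y else l s y) = z"
      proof -
        have "\<exists>!s. s \<in> S \<and> l s y = z" "\<exists>!s. s \<in> S \<and> l' s y = z"
          using kit yz ne(2) unfolding even_kit_def sharp_def by blast+
        then show ?thesis by (cases "start v") (simp_all only: if_True if_False)
      qed
      then show "\<exists>!s. s \<in> S \<and> \<phi> i s (x, y) = (x', z)"
        using posH[OF v(1) xi] x'i by (simp add: \<phi>_def)
    next
      fix j s assume j: "j \<in> {0..<u} - {x, x'}" and s: "s \<in> S" and e: "\<phi> j s (x, y) = (x', z)"
      have p: "pos (x - j) \<in> K" "H (pos (x - j)) mod u = (x - j) mod u"
        using pos sub_nz[of x j] x j by auto
      have x'j: "(j + H (nxt (pos (x - j)))) mod u = x'" using e by (simp add: \<phi>_def)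
      have "(H (nxt (pos (x - j))) - H (pos (x - j))) mod u = (H (nxt (pos (x - j))) - (x - j)) mod u"
        using p(2) by (metis mod_diff_right_eq)
      also have "\<dots> = ((j + H (nxt (pos (x - j)))) mod u - x) mod u" by (simp add: mod_simps algebra_simps)
      finally have "pos (x - j) = v" using un[OF p(1)] x'j by simp
      then have "(x - j) mod u = (x - i) mod u" using p(2) xi by simp
      then have "(x - (x - j)) mod u = (x - (x - i)) mod u" by (metis mod_diff_right_eq)
      then show "j = i" using j iu by simp
    qed (use i in auto)
  qed
  have "arc_system S G k {0..<u} \<phi>"
  proof (rule arc_systemI, goal_cases)
    case (1 j s x y)
    note j = 1(1) and s = 1(2) and x = 1(3,4) and y = 1(5)
    define v where "v = pos (x - j)"
    have v: "v \<in> K" "H v mod u = (x - j) mod u" using pos[OF sub_nz[OF x(1) j x(2)]] by (simp_all add: v_def)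
    have sh: "(j + H v') mod u = (j + H v'') mod u \<longleftrightarrow> v' = v''" if "v' \<in> K" "v'' \<in> K" for v' v''
      using inj[OF that] by (metis add_diff_cancel_left' mod_diff_left_eq)
    have xj: "(j + H v) mod u = x"
    proof -
      have "(j + H v) mod u = (j + (x - j)) mod u" using v(2) by (metis mod_add_right_eq)
      then show ?thesis using x by simp
    qed
    have "(j + H (nxt v)) mod u \<noteq> x" using sh[OF nxtK(1)[OF v(1)] v(1)] nxtK(2)[OF v(1)] xj by simp
    moreover have "(j + H (nxt v)) mod u \<noteq> j"
    proof
      assume "(j + H (nxt v)) mod u = j"
      then have "(j + H (nxt v) - j) mod u = (j - j) mod u" by (metis mod_diff_left_eq)
      then show False using nz[OF nxtK(1)[OF v(1)]] by simp
    qed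
    moreover have "exper (\<phi> j s) k (x, y)"
    proof -
      obtain h p where h: "p < L" "h p = v" "inj_on h {..<L}"
        "\<And>p. p < L \<Longrightarrow> h p \<in> K" "\<And>p. p < L \<Longrightarrow> nxt (h p) = h (Suc p mod L)"
        "\<And>p. p < L \<Longrightarrow> start (h p) \<longleftrightarrow> p = 0"
        using cyc[OF v(1)] by blast
      have "exper (\<phi> j s) (L * c) ((j + H (h p)) mod u, y)"
      proof (rule exper_even_cycle[where h = "\<lambda>p. (j + H (h p)) mod u", OF kit s L h(1) y])
        show "inj_on (\<lambda>p. (j + H (h p)) mod u) {..<L}"
          using sh h(3,4) by (auto simp: inj_on_def)
        fix p y assume p: "p < L"
        have "pos ((j + H (h p)) mod u - j) = h p"
          by (rule posH) (use h(4) p in \<open>auto simp: mod_simps\<close>)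
        then show "\<phi> j s ((j + H (h p)) mod u, y) = ((j + H (h (Suc p mod L))) mod u, if p = 0 then l' s y else l s y)"
          using h(5,6)[OF p] by (simp add: \<phi>_def)
      qed
      then show ?thesis using h(2) xj k by simp
    qed
    ultimately show ?case
      using lG[OF s y] u by (simp add: \<phi>_def v_def)
  next
    case (2 x x' y z)
    then show ?case
      using count[of x x' y z] count[of x' x z y] by (simp add: insert_commute)
  qed
  then show ?thesis unfolding ARC_def by blast
qed

text \<open>The zigzag \<open>1, -2, 3, \<dots>\<close> with a change of phase after the term \<open>p\<close>.\<close>

definition signed :: "nat \<Rightarrow> nat \<Rightarrow> int" where
  "signed p t = (if odd t \<longleftrightarrow> t \<le> p then int t else - int t)"

lemma abs_signed [simp]: "\<bar>signed p t\<bar> = int t"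
  by (simp add: signed_def)

lemma mod_eq_small:
  fixes a b u :: int
  assumes "a mod u = b mod u" "\<bar>a - b\<bar> < u"
  shows "a = b"
  using assms by (metis abs_of_nonneg diff_ge_0_iff_ge dvd_abs_iff eq_iff_diff_eq_0 mod_eq_dvd_iff zdvd_not_zless abs_ge_zero linorder_not_le order_le_less abs_eq_0)

section \<open>Nonzero residues modulo an odd number as signed integers\<close>

definition signs :: "int set" where "signs = {1, -1}"

lemma signs:
  "g \<in> signs \<Longrightarrow> \<bar>g\<bar> = 1 \<and> g * g = 1"
  "g \<in> signs \<Longrightarrow> h \<in> signs \<Longrightarrow> g * h \<in> signs"
  by (auto simp: signs_def)

lemma signed_residue:
  assumes u: "u = 2 * int M + 1" and x: "x mod u \<noteq> 0"
  shows "\<exists>!v. v \<in> signs \<times> {1..M} \<and> (fst v * signed p (snd v)) mod u = x mod u"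
proof (rule ex_ex1I)
  define r where "r = (if x mod u \<le> int M then x mod u else x mod u - u)"
  have xm: "0 < x mod u" "x mod u < u" using x u pos_mod_sign[of u x] pos_mod_bound[of u x] by linarith+
  have r: "r mod u = x mod u" "r \<noteq> 0" "\<bar>r\<bar> \<le> int M" using xm u by (auto simp: r_def)
  define t where "t = nat \<bar>r\<bar>"
  have t: "int t = \<bar>r\<bar>" "t \<in> {1..M}" using r by (auto simp: t_def)
  define g :: int where "g = (if signed p t = r then 1 else -1)"
  have "signed p t = r \<or> signed p t = - r" using t(1) abs_signed[of p t] by linarith
  then have "g * signed p t = r" by (auto simp: g_def)
  moreover have "g \<in> signs" by (simp add: g_def signs_def)
  ultimately show "\<exists>v. v \<in> signs \<times> {1..M} \<and> (fst v * signed p (snd v)) mod u = x mod u"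
    using t r by (intro exI[of _ "(g, t)"]) auto
  fix v v'
  assume v: "v \<in> signs \<times> {1..M} \<and> (fst v * signed p (snd v)) mod u = x mod u"
    and v': "v' \<in> signs \<times> {1..M} \<and> (fst v' * signed p (snd v')) mod u = x mod u"
  obtain g t g' t' where e: "v = (g, t)" "v' = (g', t')" by fastforce
  have s: "g \<in> signs" "g' \<in> signs" "1 \<le> t" "1 \<le> t'" "t \<le> M" "t' \<le> M" using v v' e by auto
  have abs: "\<bar>g * signed p t\<bar> = int t" "\<bar>g' * signed p t'\<bar> = int t'" using s signs by (simp_all add: abs_mult)
  have eq: "g * signed p t = g' * signed p t'"
    by (rule mod_eq_small[of _ u]) (use v v' e abs s u in auto)
  then have "t = t'" using abs by simp
  moreover have "signed p t \<noteq> 0" using abs s by auto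
  ultimately show "v = v'" using eq e by simp
qed

text \<open>As \<open>u\<close> is odd, a nonzero even residue minus \<open>u\<close> is the
  negative of an odd number.\<close>

lemma odd_residue:
  assumes u: "u = 2 * int M + 1" and x: "x mod u \<noteq> 0"
  shows "\<exists>g\<in>signs. \<exists>q<M. (g * (2 * int q + 1)) mod u = x mod u"
proof -
  have xm: "0 < x mod u" "x mod u < u" using x u pos_mod_sign[of u x] pos_mod_bound[of u x] by linarith+
  show ?thesis
  proof (cases "odd (x mod u)")
    case True
    then obtain q where "x mod u = 2 * q + 1" by (elim oddE)
    then have "0 \<le> q" "q < int M" "(1 * (2 * int (nat q) + 1)) mod u = x mod u" using xm u by auto
    then show ?thesis by (intro bexI[of _ 1] exI[of _ "nat q"]) (auto simp: signs_def)
  next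
    case False
    then obtain h where h: "x mod u = 2 * h" by blast
    \<comment> \<open>From \<open>2 * h - u = - (2 * (M - h) + 1)\<close>.\<close>
    define q where "q = nat (int M - h)"
    have q: "int q = int M - h" "q < M" using h xm u by (auto simp: q_def)
    have "-1 * (2 * int q + 1) = x mod u - u" using q h u by simp
    then have "(-1 * (2 * int q + 1)) mod u = x mod u" by (metis minus_mod_self2 mod_mod_trivial)
    then show ?thesis using q(2) by (intro bexI[of _ "-1"] exI[of _ q]) (auto simp: signs_def)
  qed
qed

text \<open>The difference of two odd numbers is even, so as a multiple of the odd \<open>u\<close>
  it is a multiple of \<open>2 * u\<close>; its absolute value is too small for that unless it
  vanishes.\<close>

lemma odd_residue_unique:
  assumes u: "u = 2 * int M + 1" and s: "g \<in> signs" "g' \<in> signs" and q: "q < M" "q' < M"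
    and eq: "(g * (2 * int q + 1)) mod u = (g' * (2 * int q' + 1)) mod u"
  shows "g = g'" "q = q'"
proof -
  define d where "d = g * (2 * int q + 1) - g' * (2 * int q' + 1)"
  have "u dvd d" using eq by (simp add: mod_eq_dvd_iff d_def)
  then obtain k where k: "d = u * k" by blast
  have "even d" using s by (auto simp: d_def signs_def)
  then have "even k" using k u by simp
  have "\<bar>d\<bar> < 2 * u" using s q u by (auto simp: d_def signs_def)
  then have "\<bar>u * k\<bar> < 2 * u" using k by simp
  then have "u * \<bar>k\<bar> < u * 2" using u by (simp add: abs_mult)
  moreover have "0 < u" using u by simp
  ultimately have "\<bar>k\<bar> < 2" using mult_less_cancel_left_pos by blast
  then have "k = 0" using \<open>even k\<close> by (auto elim!: evenE)
  then have "g * (2 * int q + 1) = g' * (2 * int q' + 1)" using k d_def by simp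
  then show "g = g'" "q = q'" using s by (auto simp: signs_def)
qed

text \<open>Up to sign and modulo \<open>u\<close>, the step after the term \<open>t\<close> has
  size \<open>2 * q + 1\<close>, where \<open>q\<close> is this index: the change of phase at
  \<open>p\<close> produces the size 1, and the closing step at \<open>M\<close> supplies the size
  \<open>2 * p + 1\<close> lost there.\<close>

definition swap_last :: "nat \<Rightarrow> nat \<Rightarrow> nat \<Rightarrow> nat" where
  "swap_last M p t = (if t = M then p else if t = p then 0 else t)"

lemma swap_last:
  assumes "0 < p" "p < M"
  shows "t \<in> {1..M} \<Longrightarrow> swap_last M p t < M"
    and "t \<in> {1..M} \<Longrightarrow> t' \<in> {1..M} \<Longrightarrow> swap_last M p t = swap_last M p t' \<Longrightarrow> t = t'"
    and "q < M \<Longrightarrow> \<exists>t\<in>{1..M}. swap_last M p t = q"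
proof -
  show "t \<in> {1..M} \<Longrightarrow> swap_last M p t < M" using assms by (auto simp: swap_last_def)
  show "t \<in> {1..M} \<Longrightarrow> t' \<in> {1..M} \<Longrightarrow> swap_last M p t = swap_last M p t' \<Longrightarrow> t = t'"
    using assms by (auto simp: swap_last_def split: if_splits)
  show "q < M \<Longrightarrow> \<exists>t\<in>{1..M}. swap_last M p t = q"
    using assms by (intro bexI[of _ "if q = 0 then p else if q = p then M else q"]) (auto simp: swap_last_def)
qed

lemma signed_diff:
  assumes "0 < t"
  shows "signed p (Suc t) - signed p t =
     (if 0 < signed p (Suc t) then 1 else -1) * (if t = p then 1 else 2 * int t + 1)"
  using assms by (auto simp: signed_def)

text \<open>The zigzag and its negative use the steps 1, 3, 5, ... up to sign, each once, if the
  closing step has size \<open>2 * p + 1\<close>; with both signs these are all nonzero residues.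
  For \<open>\<epsilon> = 1\<close> the zigzag and its negative close separately, for
  \<open>\<epsilon> = -1\<close> they are joined into one cycle.\<close>

lemma signed_base:
  fixes M p c :: nat and \<epsilon> :: int
  assumes u: "u = 2 * int M + 1" and finS: "finite S" and p: "0 < p" "p < M"
    and \<epsilon>: "\<epsilon> = 1 \<and> even M \<and> L = M \<or> \<epsilon> = -1 \<and> L = 2 * M" and k: "k = L * c"
    and kit: "even_kit S G c l l'"
    and close: "(\<epsilon> - signed p M) mod u = (- (2 * int p + 1)) mod u"
  shows "ARC S G k {0..<u}"
proof (rule cyclic_base[where K = "signs \<times> {1..M}" and H = "\<lambda>v. fst v * signed p (snd v)"
      and nxt = "\<lambda>v. if snd v = M then (\<epsilon> * fst v, 1) else (fst v, Suc (snd v))"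
      and start = "\<lambda>v. snd v = 1 \<and> (\<epsilon> = 1 \<or> fst v = 1)"])
  let ?K = "signs \<times> {1..M}"
  let ?H = "\<lambda>v. fst v * signed p (snd v)"
  let ?nxt = "\<lambda>v. if snd v = M then (\<epsilon> * fst v, 1) else (fst v, Suc (snd v))"
  show "0 < u" using u by simp
  show "even L" "2 \<le> L" using \<epsilon> p by (auto elim!: evenE)
  fix x assume "x mod u \<noteq> 0"
  then show "\<exists>!v. v \<in> ?K \<and> ?H v mod u = x mod u" by (rule signed_residue[OF u])
next
  fix v assume v: "v \<in> signs \<times> {1..M}"
  have "\<bar>fst v * signed p (snd v)\<bar> = int (snd v)" using v signs(1) by (auto simp: abs_mult)
  then show "(fst v * signed p (snd v)) mod u \<noteq> 0"
    using mod_eq_small[of "fst v * signed p (snd v)" u 0] v u by auto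
next
  let ?K = "signs \<times> {1..M}"
  let ?H = "\<lambda>v. fst v * signed p (snd v)"
  let ?nxt = "\<lambda>v. if snd v = M then (\<epsilon> * fst v, 1) else (fst v, Suc (snd v))"
  \<comment> \<open>The sign of the step after \<open>t\<close> in the positive zigzag; at
    \<open>M\<close> it is prescribed by the closing condition.\<close>
  define e :: "nat \<Rightarrow> int" where "e = (\<lambda>t. if t = M then -1 else if 0 < signed p (Suc t) then 1 else -1)"
  have e: "e t \<in> signs" for t by (simp add: e_def signs_def)
  have D: "(?H (?nxt (g, t)) - ?H (g, t)) mod u = (g * e t * (2 * int (swap_last M p t) + 1)) mod u"
    if "g \<in> signs" "t \<in> {1..M}" for g t
  proof (cases "t = M")
    case True
    have "?H (?nxt (g, t)) - ?H (g, t) = g * (\<epsilon> - signed p M)" using True p by (simp add: signed_def algebra_simps)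
    also have "\<dots> mod u = (g * (- (2 * int p + 1))) mod u" using close by (metis mod_mult_right_eq)
    also have "g * (- (2 * int p + 1)) = g * e t * (2 * int (swap_last M p t) + 1)"
      using True by (simp add: e_def swap_last_def algebra_simps)
    finally show ?thesis .
  next
    case False
    have "?H (?nxt (g, t)) - ?H (g, t) = g * (signed p (Suc t) - signed p t)" using False by (simp add: algebra_simps)
    also have "\<dots> = g * e t * (2 * int (swap_last M p t) + 1)"
      using False that signed_diff[of t p] by (simp add: e_def swap_last_def)
    finally show ?thesis by simp
  qed
  fix d assume "d mod u \<noteq> 0"
  then obtain g q where sq: "g \<in> signs" "q < M" "(g * (2 * int q + 1)) mod u = d mod u"
    using odd_residue[OF u] by blast
  obtain t where t: "t \<in> {1..M}" "swap_last M p t = q" using swap_last(3)[OF p sq(2)] by blast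
  show "\<exists>!v. v \<in> ?K \<and> (?H (?nxt v) - ?H v) mod u = d mod u"
  proof (rule ex1I[of _ "(g * e t, t)"])
    have "g * e t \<in> signs" using signs(2) sq e by simp
    moreover have "g * e t * e t = g" using signs(1)[OF e, of t] by (simp add: mult.assoc)
    ultimately show "(g * e t, t) \<in> ?K \<and> (?H (?nxt (g * e t, t)) - ?H (g * e t, t)) mod u = d mod u"
      using D[of "g * e t" t] t sq by (simp only: mem_Sigma_iff)
    fix v assume v: "v \<in> ?K \<and> (?H (?nxt v) - ?H v) mod u = d mod u"
    obtain g' t' where k: "v = (g', t')" by fastforce
    then have st: "g' \<in> signs" "t' \<in> {1..M}" using v by auto
    have "(g' * e t' * (2 * int (swap_last M p t') + 1)) mod u = (g * (2 * int q + 1)) mod u"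
      using D[OF st] v k sq(3) by (simp only:)
    from odd_residue_unique[OF u signs(2)[OF st(1) e] sq(1) swap_last(1)[OF p st(2)] sq(2) this]
    have "g' * e t' = g" "swap_last M p t' = q" by auto
    moreover from this have "t' = t" using swap_last(2)[OF p st(2) t(1)] t(2) by simp
    moreover have "g' * e t' * e t' = g'" using signs(1)[OF e, of t'] by (simp add: mult.assoc)
    ultimately show "v = (g * e t, t)" using k by metis
  qed
next
  let ?nxt = "\<lambda>v. if snd v = M then (\<epsilon> * fst v, 1) else (fst v, Suc (snd v))"
  fix v assume v: "v \<in> signs \<times> {1..M}"
  obtain g t where e: "v = (g, t)" by fastforce
  have st: "g \<in> signs" "1 \<le> t" "t \<le> M" using v e by auto
  show "\<exists>h p. p < L \<and> h p = v \<and> inj_on h {..<L} \<and>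
      (\<forall>p<L. h p \<in> signs \<times> {1..M} \<and> ?nxt (h p) = h (Suc p mod L) \<and>
        (snd (h p) = 1 \<and> (\<epsilon> = 1 \<or> fst (h p) = 1) \<longleftrightarrow> p = 0))"
  proof (cases "\<epsilon> = 1")
    case True
    then have "L = M" using \<epsilon> by auto
    then show ?thesis using True st e
      by (intro exI[of _ "\<lambda>p. (g, Suc p)"] exI[of _ "t - 1"]) (auto simp: inj_on_def mod_Suc)
  next
    case False
    then have L: "\<epsilon> = -1" "L = 2 * M" using \<epsilon> by auto
    define h where "h = (\<lambda>p. if p < M then (1 :: int, Suc p) else (-1, Suc (p - M)))"
    have "(if g = 1 then t - 1 else M + t - 1) < L" "h (if g = 1 then t - 1 else M + t - 1) = v"
      using st e L by (auto simp: h_def signs_def)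
    moreover have "inj_on h {..<L}" by (auto simp: inj_on_def h_def split: if_splits)
    moreover have "h q \<in> signs \<times> {1..M} \<and> ?nxt (h q) = h (Suc q mod L) \<and>
        (snd (h q) = 1 \<and> (\<epsilon> = 1 \<or> fst (h q) = 1) \<longleftrightarrow> q = 0)" if qL: "q < L" for q
    proof -
      consider "q < M - 1" | "q = M - 1" | "M \<le> q" "q < L - 1" | "q = L - 1" using qL by linarith
      then show ?thesis
        by cases (use L p in \<open>auto simp: h_def signs_def\<close>)
    qed
    ultimately show ?thesis by blast
  qed
qed (use finS k kit in auto)

lemma good_2:
  assumes "finite S" "odd a" "3 \<le> a" "k = 2 * a * c" "even_kit S G c l l'"
  shows "good S G k (a * 2 + 1)"
proof (rule goodI)
  \<comment> \<open>As \<open>a\<close> is odd and greater than \<open>p\<close>, the last term is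
    \<open>-a\<close>. Closing requires \<open>a - 1\<close> to be congruent to
    \<open>- (2 * p + 1)\<close> modulo \<open>2 * a + 1\<close>, which \<open>2 * p = a + 1\<close>
    solves.\<close>
  define p where "p = (a + 1) div 2"
  have p: "2 * p = a + 1" using assms(2) by (simp add: p_def)
  show "ARC S G k {0..<2 * int a + 1}"
  proof (rule signed_base[where M = a and p = p and \<epsilon> = "-1" and L = "2 * a"])
    have "signed p a = - int a" using p assms(2,3) by (simp add: signed_def)
    then have "-1 - signed p a = - (2 * int p + 1) + (2 * int a + 1)" using p by simp
    then show "(-1 - signed p a) mod (2 * int a + 1) = (- (2 * int p + 1)) mod (2 * int a + 1)"
      by (metis mod_add_self2)
  qed (use assms p in auto)
qed (simp_all add: mult.commute)

lemma good_4:
  assumes "finite S" "odd a" "3 \<le> a" "k = 2 * a * c" "even_kit S G c l l'"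
  shows "good S G k (a * 4 + 1)"
proof (rule goodI)
  show "ARC S G k {0..<2 * int (2 * a) + 1}"
  \<comment> \<open>Here the last term is \<open>2 * a\<close>, and
    \<open>1 - 2 * a = - (2 * p + 1)\<close> gives \<open>p = a - 1\<close>. Both closed zigzags
    already have the length \<open>2 * a\<close>.\<close>
  proof (rule signed_base[where M = "2 * a" and p = "a - 1" and \<epsilon> = 1 and L = "2 * a"])
    have "signed (a - 1) (2 * a) = 2 * int a" using assms(2,3) by (simp add: signed_def)
    then have "1 - signed (a - 1) (2 * a) = - (2 * int (a - 1) + 1)" using assms(3) by simp
    then show "(1 - signed (a - 1) (2 * a)) mod (2 * int (2 * a) + 1) = (- (2 * int (a - 1) + 1)) mod (2 * int (2 * a) + 1)"
      by (simp only:)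
  qed (use assms in auto)
qed (simp_all add: nat_add_distrib nat_mult_distrib)

text \<open>An odd factor greater than 1 is split off by a frame with an odd number of holes. A
  power of two is divided by 4 through the frame with four holes as long as it is at least 8, so the
  descent ends in 2 or 4, or in 1 after splitting off an odd number.\<close>

lemma good_even_cases:
  assumes "finite S" "odd a" "3 \<le> a" "k = 2 * a * c" "even_kit S G c l l'" "good S G k (a + 1)"
  shows "0 < m \<Longrightarrow> good S G k (a * m + 1)"
proof (induction m rule: less_induct)
  case (less m)
  consider "m = 1" | "m = 2" | "m = 4" | h where "m = 8 * h" "0 < h" | q h where "m = q * h" "odd q" "1 < q" "0 < h"
  proof -
    have "\<exists>e q. odd q \<and> m = 2 ^ e * q"
    proof -
      have "m \<noteq> 0" using less.prems by simp
      then show ?thesis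
      proof (induction m rule: less_induct)
        case (less m)
        show ?case
        proof (cases "even m")
          case True
          then obtain n where "m = 2 * n" by blast
          then obtain e q where "odd q" "n = 2 ^ e * q" using less by (metis One_nat_def mult_0_right n_less_m_mult_n not_gr_zero numeral_2_eq_2 lessI)
          then show ?thesis using \<open>m = 2 * n\<close> by (intro exI[of _ "Suc e"] exI[of _ q]) simp
        next
          case False
          then show ?thesis by (intro exI[of _ 0] exI[of _ m]) simp
        qed
      qed
    qed
    then obtain e q where eq: "odd q" "m = 2 ^ e * q" by blast
    show ?thesis
    proof (cases "q = 1")
      case False
      then have "1 < q" using eq(1) by (cases q) auto
      then show ?thesis using that(5)[of q "2 ^ e"] eq by simp
    next
      case True
      consider "e = 0" | "e = 1" | "e = 2" | "3 \<le> e" by linarith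
      then show ?thesis
      proof cases
        case 4
        then have "e = 3 + (e - 3)" by simp
        then have "(2::nat) ^ e = 8 * 2 ^ (e - 3)" using power_add[of "2::nat" 3 "e - 3"] by simp
        then show ?thesis using that(4)[of "2 ^ (e - 3)"] True eq by simp
      qed (use True eq that(1,2,3) in auto)
    qed
  qed
  then show ?case
  proof cases
    case 1
    then show ?thesis using assms by simp
  next
    case 2
    then show ?thesis using good_2[OF assms(1-5)] by simp
  next
    case 3
    then show ?thesis using good_4[OF assms(1-5)] by simp
  next
    case 4
    then have "good S G k (a * (2 * h) + 1)" using less.IH[of "2 * h"] by simp
    then show ?thesis using good_eight[of S a k c h G l l'] assms 4 by simp
  next
    case 5
    then have "good S G k (a * h + 1)" using less.IH[of h] by simp
    then show ?thesis using good_odd_multiple[of S a k c h G l l' q] assms 5 by simp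
  qed
qed

section \<open>Near-Hamiltonian cycles of odd length\<close>

text \<open>The cycle through \<open>\<infinity>\<close> (encoded as \<open>None\<close>) and the nonzero residues modulo \<open>a = 2 * t + 1\<close>:
  \<open>t, -t, \<infinity>, 1, -1, 2, -2, \<dots>\<close>\<close>

definition spoke :: "nat \<Rightarrow> nat \<Rightarrow> nat option" where
  "spoke t p = (if p = 0 then Some t else if p = 1 then Some (t + 1) else if p = 2 then None
     else if odd p then Some (p div 2) else Some (2 * t + 2 - p div 2))"

fun spoke_pos :: "nat \<Rightarrow> nat option \<Rightarrow> nat" where
  "spoke_pos t None = 2"
| "spoke_pos t (Some d) = (if d = t then 0 else if d = t + 1 then 1 else if d < t then 2 * d + 1
     else 2 * (2 * t + 2 - d))"

fun rotate_by :: "nat \<Rightarrow> nat \<Rightarrow> nat option \<Rightarrow> nat option" where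
  "rotate_by a i None = None"
| "rotate_by a i (Some x) = Some ((x + i) mod a)"

text \<open>The difference of consecutive residues on the cycle, modulo \<open>2 * t + 1\<close>.
  The value 0, which is no difference of distinct residues, marks the two steps into and out of
  infinity.\<close>

definition spoke_step :: "nat \<Rightarrow> nat \<Rightarrow> nat" where
  "spoke_step t p = (if p = 0 then 1 else if p \<le> 2 then 0 else if odd p then 2 * t + 2 - p else p - 1)"

lemma spoke_spoke_pos:
  assumes "1 \<le> t" "1 \<le> d" "d \<le> 2 * t"
  shows "spoke t (spoke_pos t (Some d)) = Some d" "spoke_pos t (Some d) < 2 * t + 1" "spoke_pos t (Some d) \<noteq> 2"
  using assms by (auto simp: spoke_def)

lemma spoke_pos_spoke:
  assumes "1 \<le> t" "p < 2 * t + 1"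
  shows "spoke_pos t (spoke t p) = p" 
    and "p \<noteq> 2 \<Longrightarrow> \<exists>d. spoke t p = Some d \<and> 1 \<le> d \<and> d \<le> 2 * t"
proof -
  consider "p = 0" | "p = 1" | "p = 2" | r where "p = 2 * r + 1" "1 \<le> r" "r < t"
    | r where "p = 2 * r" "2 \<le> r" "r \<le> t"
  proof (cases "even p")
    case True
    then obtain r where "p = 2 * r" by blast
    then show ?thesis using that(1,3) that(5)[of r] assms by (cases "r = 0 \<or> r = 1") auto
  next
    case False
    then obtain r where "p = 2 * r + 1" by (elim oddE)
    then show ?thesis using that(2) that(4)[of r] assms by (cases "r = 0") auto
  qed
  then have "spoke_pos t (spoke t p) = p \<and> (p \<noteq> 2 \<longrightarrow> (\<exists>d. spoke t p = Some d \<and> 1 \<le> d \<and> d \<le> 2 * t))"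
    using assms by cases (auto simp: spoke_def)
  then show "spoke_pos t (spoke t p) = p"
    and "p \<noteq> 2 \<Longrightarrow> \<exists>d. spoke t p = Some d \<and> 1 \<le> d \<and> d \<le> 2 * t" by auto
qed

lemma spoke_next:
  assumes "1 \<le> t" "p < 2 * t + 1" "p \<noteq> 1" "p \<noteq> 2"
  obtains d d' where "spoke t p = Some d" "spoke t (Suc p mod (2 * t + 1)) = Some d'"
    "d' mod (2 * t + 1) = (d + spoke_step t p) mod (2 * t + 1)"
proof -
  consider "p = 0" | r where "p = 2 * r + 1" "1 \<le> r" "r < t" | r where "p = 2 * r" "2 \<le> r" "r < t" | "p = 2 * t" "2 \<le> t"
  proof (cases "even p")
    case True
    then obtain r where "p = 2 * r" by blast
    then show ?thesis using that(1,4) that(3)[of r] assms by (cases "r = 0 \<or> r = t") auto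
  next
    case False
    then obtain r where "p = 2 * r + 1" by (elim oddE)
    then show ?thesis using that(2)[of r] assms by (cases "r = 0") auto
  qed
  then show ?thesis
  proof cases
    case 1
    then show ?thesis using that[of t "t + 1"] assms by (simp add: spoke_def spoke_step_def)
  next
    case (2 r)
    then have "Suc p mod (2 * t + 1) = 2 * (r + 1)" by simp
    moreover have "spoke t p = Some r" "spoke t (2 * (r + 1)) = Some (2 * t + 1 - r)" "spoke_step t p = 2 * t + 1 - 2 * r"
      using 2 by (auto simp: spoke_def spoke_step_def)
    moreover have "r + (2 * t + 1 - 2 * r) = 2 * t + 1 - r" using 2 by simp
    ultimately show ?thesis using that by metis
  next
    case (3 r)
    then have "Suc p mod (2 * t + 1) = 2 * r + 1" by simp
    moreover have "spoke t p = Some (2 * t + 2 - r)" "spoke t (2 * r + 1) = Some r" "spoke_step t p = 2 * r - 1"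
      using 3 by (auto simp: spoke_def spoke_step_def)
    moreover have "(2 * t + 2 - r + (2 * r - 1)) mod (2 * t + 1) = r mod (2 * t + 1)"
    proof -
      have "2 * t + 2 - r + (2 * r - 1) = r + (2 * t + 1)" using 3 by simp
      then show ?thesis by (metis mod_add_self2)
    qed
    ultimately show ?thesis using that by metis
  next
    case 4
    then have "Suc p mod (2 * t + 1) = 0" by simp
    moreover have "spoke t p = Some (t + 2)" "spoke t 0 = Some t" "spoke_step t p = 2 * t - 1"
      using 4 by (auto simp: spoke_def spoke_step_def)
    moreover have "(t + 2 + (2 * t - 1)) mod (2 * t + 1) = t mod (2 * t + 1)"
    proof -
      have "t + 2 + (2 * t - 1) = t + (2 * t + 1)" using 4 by simp
      then show ?thesis by (metis mod_add_self2)
    qed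
    ultimately show ?thesis using that by metis
  qed
qed

text \<open>All differences are odd. Every odd difference from 3 on occurs at two positions, but 1
  only at position 0; its second occurrence is provided by the cycle \<open>x -> x + 1\<close>
  missing infinity. This is the origin of the shared edges.\<close>

lemma spoke_step_eq:
  assumes "1 \<le> t" "p < 2 * t + 1" "1 \<le> d" "d \<le> 2 * t"
  shows "spoke_step t p = d \<longleftrightarrow> odd d \<and> (if d = 1 then p = 0 else p = d + 1 \<or> p = 2 * t + 2 - d)"
proof (cases "odd p")
  case True
  then obtain r where "p = 2 * r + 1" by (elim oddE)
  then show ?thesis using assms by (auto simp: spoke_step_def; presburger)
next
  case False
  then obtain r where "p = 2 * r" by auto
  then show ?thesis using assms by (auto simp: spoke_step_def; presburger)
qed

lemma card_ex1:
  assumes "\<exists>!s. s \<in> S \<and> P s"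
  shows "card {s \<in> S. P s} = 1"
proof -
  obtain s where "{s \<in> S. P s} = {s}" using assms by blast
  then show ?thesis by simp
qed

lemma add_mod_eq_iff:
  assumes "(x + d) mod a = x'" "d < a" "s < (a::nat)"
  shows "(x + s) mod a = x' \<longleftrightarrow> s = d"
  using assms mod_add_left_cancel_less[of x s a d] by metis

lemma sum_eq_pair:
  assumes "finite J" "i \<in> J" "j \<in> J" "i \<noteq> j" "\<And>x. x \<in> J \<Longrightarrow> x \<noteq> i \<Longrightarrow> x \<noteq> j \<Longrightarrow> f x = (0 :: nat)"
  shows "sum f J = f i + f j"
proof -
  have "sum f J = sum f {i, j}" using assms by (intro sum.mono_neutral_right) auto
  then show ?thesis using assms(4) by simp
qed

section \<open>The base case of \<open>a + 1\<close> parts\<close>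

definition wheel :: "nat \<Rightarrow> nat option set" where
  "wheel a = insert None (Some ` {..<a})"

lemma wheel_iff [simp]: "None \<in> wheel a" "Some x \<in> wheel a \<longleftrightarrow> x < a"
  by (auto simp: wheel_def)

text \<open>\<open>A p\<close> is the layer at the vertex \<open>p\<close> of the cycle missing
  infinity, \<open>B i p\<close> the layer at position \<open>p\<close> of the cycle missing
  \<open>i\<close>. Position 0 of the latter is the arc from \<open>i + t\<close> to
  \<open>i + t + 1\<close>, shared with the former. Only there may the families fail to be sharp,
  provided that together they cover every arc twice, which is \<open>AB\<close>.\<close>

lemma odd_base:
  fixes A :: "nat \<Rightarrow> 's \<Rightarrow> 'g \<Rightarrow> 'g" and B :: "nat \<Rightarrow> nat \<Rightarrow> 's \<Rightarrow> 'g \<Rightarrow> 'g"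
  assumes a: "a = 2 * t + 1" "1 \<le> t" and k: "k = a * b" and finS: "finite S"
    and A: "\<And>p s. p < a \<Longrightarrow> s \<in> S \<Longrightarrow> bij_betw (A p s) G G \<and> (\<forall>y\<in>G. A p s y \<noteq> y)"
    and A_per: "\<And>s y. s \<in> S \<Longrightarrow> y \<in> G \<Longrightarrow> exper (layers (\<lambda>p. A p s) a) b y"
    and B: "\<And>i p s. i < a \<Longrightarrow> p < a \<Longrightarrow> s \<in> S \<Longrightarrow> bij_betw (B i p s) G G \<and> (\<forall>y\<in>G. B i p s y \<noteq> y)"
    and B_per: "\<And>i s y. i < a \<Longrightarrow> s \<in> S \<Longrightarrow> y \<in> G \<Longrightarrow> exper (layers (\<lambda>p. B i p s) a) b y"
    and B_sharp: "\<And>i p. i < a \<Longrightarrow> 1 \<le> p \<Longrightarrow> p < a \<Longrightarrow> sharp S G (B i p)"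
    and AB: "\<And>i y z. i < a \<Longrightarrow> y \<in> G \<Longrightarrow> z \<in> G \<Longrightarrow> y \<noteq> z \<Longrightarrow>
      card {s \<in> S. A ((i + t) mod a) s y = z} + card {s \<in> S. B i 0 s y = z} = 2"
  shows "ARC S G k (wheel a)"
proof -
  have a3: "3 \<le> a" using a by simp
  define V where "V = wheel a"
  have finV: "finite V" by (simp add: V_def wheel_def)
  define ring where "ring = (\<lambda>i p. rotate_by a i (spoke t p))"
  define pos where "pos = (\<lambda>i v. spoke_pos t (rotate_by a (a - i) v))"
  define \<phi> where "\<phi> = (\<lambda>j s (v, y). case j of
     None \<Rightarrow> (Some (Suc (the v) mod a), A (the v) s y)
   | Some i \<Rightarrow> (ring i (Suc (pos i v) mod a), B i (pos i v) s y))"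
  have pos_ring: "pos i (ring i p) = p" if "i < a" "p < a" for i p
  proof (cases "p = 2")
    case True
    then show ?thesis by (simp add: ring_def pos_def spoke_def)
  next
    case False
    have pt: "p < 2 * t + 1" using that a by simp
    obtain d where d: "spoke t p = Some d" "1 \<le> d" "d \<le> 2 * t" using spoke_pos_spoke(2)[OF a(2) pt False] by blast
    have "((d + i) mod a + (a - i)) mod a = (d + i + (a - i)) mod a" by (simp add: mod_simps)
    also have "d + i + (a - i) = d + a" using that by simp
    also have "(d + a) mod a = d"
    proof -
      have "d < a" using d a by simp
      then show ?thesis by simp
    qed
    finally show ?thesis using d spoke_pos_spoke(1)[OF a(2) pt] by (simp add: ring_def pos_def)
  qed
  have ring_pos: "ring i (pos i v) = v" "pos i v < a" "pos i v = 2 \<longleftrightarrow> v = None"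
    if "i < a" "v \<in> V" "v \<noteq> Some i" for i v
  proof -
    have "ring i (pos i v) = v \<and> pos i v < a \<and> (pos i v = 2 \<longleftrightarrow> v = None)"
    proof (cases v)
      case None
      then show ?thesis using a3 by (simp add: ring_def pos_def spoke_def)
    next
      case (Some x)
      then have x: "x < a" "x \<noteq> i" using that by (auto simp: V_def)
      define d where "d = (x + (a - i)) mod a"
      have "d \<noteq> 0"
      proof
        assume "d = 0"
        then have "(i + (x + (a - i))) mod a = i mod a" using mod_add_right_eq[of i "x + (a - i)" a] by (simp add: d_def)
        moreover have "i + (x + (a - i)) = x + a" using that by simp
        ultimately show False using x that by simp
      qed
      moreover have "d < a" using a by (simp add: d_def)
      ultimately have d: "1 \<le> d" "d \<le> 2 * t" using a by auto
      have "(d + i) mod a = (x + (a - i) + i) mod a" by (simp add: d_def mod_simps)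
      also have "x + (a - i) + i = x + a" using that by simp
      finally have "(d + i) mod a = x" using x by simp
      moreover have "pos i v = spoke_pos t (Some d)" using Some by (simp add: pos_def d_def)
      ultimately show ?thesis using spoke_spoke_pos[OF a(2) d] Some a(1) by (simp add: ring_def)
    qed
    then show "ring i (pos i v) = v" "pos i v < a" "pos i v = 2 \<longleftrightarrow> v = None" by auto
  qed
  have ring_V: "ring i p \<in> V" "ring i p \<noteq> Some i" if "i < a" "p < a" for i p
  proof -
    have "ring i p \<in> V \<and> ring i p \<noteq> Some i"
    proof (cases "p = 2")
      case True
      then show ?thesis by (simp add: ring_def spoke_def V_def)
    next
      case False
      have pt: "p < 2 * t + 1" using that a by simp
      obtain d where d: "spoke t p = Some d" "1 \<le> d" "d \<le> 2 * t" using spoke_pos_spoke(2)[OF a(2) pt False] by blast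
      have "(d + i) mod a \<noteq> i"
        using mod_add_left_cancel_less[of i d a 0] d that a by (auto simp: add.commute)
      then show ?thesis using d a by (simp add: ring_def V_def)
    qed
    then show "ring i p \<in> V" "ring i p \<noteq> Some i" by auto
  qed
  have ring_inj: "ring i p = ring i q \<longleftrightarrow> p = q" if "i < a" "p < a" "q < a" for i p q
    using pos_ring that by metis
  \<comment> \<open>Rotation makes every residue occupy each position other than that of infinity in
    exactly one of the cycles.\<close>
  have hub: "\<exists>!i. i < a \<and> i \<noteq> x \<and> pos i (Some x) = p" if x: "x < a" and p: "p < a" "p \<noteq> 2" for x p
  proof -
    have pt: "p < 2 * t + 1" using p a by simp
    obtain d where d: "spoke t p = Some d" "1 \<le> d" "d \<le> 2 * t" using spoke_pos_spoke(2)[OF a(2) pt p(2)] by blast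
    have "\<exists>!i. i < a \<and> (i + d) mod a = x" using x by (intro ex1_residue) auto
    then obtain i where i: "i < a" "(i + d) mod a = x" and un: "\<And>i'. i' < a \<Longrightarrow> (i' + d) mod a = x \<Longrightarrow> i' = i" by blast
    have r: "ring i p = Some x" if "(i + d) mod a = x" for i using that d by (simp add: ring_def add.commute)
    show ?thesis
    proof (rule ex1I[of _ i])
      show "i < a \<and> i \<noteq> x \<and> pos i (Some x) = p"
        using i r[OF i(2)] ring_V(2)[OF i(1) p(1)] pos_ring[OF i(1) p(1)] by auto
      fix i' assume i': "i' < a \<and> i' \<noteq> x \<and> pos i' (Some x) = p"
      then have "ring i' p = Some x" using ring_pos(1)[of i' "Some x"] x by (auto simp: V_def)
      then show "i' = i" using un i' d by (simp add: ring_def add.commute)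
    qed
  qed
  have arc: "ring i (Suc (pos i (Some x)) mod a) = Some x' \<longleftrightarrow> spoke_step t (pos i (Some x)) = (x' + (a - x)) mod a"
    if i: "i < a" "i \<noteq> x" and x: "x < a" "x' < a" "x \<noteq> x'" for i x x'
  proof -
    define p where "p = pos i (Some x)"
    have p: "p < a" "p \<noteq> 2" "ring i p = Some x" using ring_pos[of i "Some x"] i x by (auto simp: p_def V_def)
    have d: "(x + (x' + (a - x)) mod a) mod a = x'"
    proof -
      have "(x + (x' + (a - x)) mod a) mod a = (x + (x' + (a - x))) mod a" by (simp add: mod_simps)
      also have "x + (x' + (a - x)) = x' + a" using x by simp
      finally show ?thesis using x by simp
    qed
    show ?thesis
    proof (cases "p = 1")
      case True
      \<comment> \<open>At position 1 the successor is infinity and the default step 0 differs from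
        the nonzero difference of \<open>x\<close> and \<open>x'\<close>, so both sides are
        false.\<close>
      have "(x' + (a - x)) mod a \<noteq> 0" using d x by (metis add.right_neutral mod_less)
      then show ?thesis using True a3 unfolding p_def[symmetric] by (simp add: ring_def spoke_def spoke_step_def)
    next
      case False
      have pt: "p < 2 * t + 1" using p a by simp
      obtain e e' where e: "spoke t p = Some e" "spoke t (Suc p mod a) = Some e'" "e' mod a = (e + spoke_step t p) mod a"
        using spoke_next[OF a(2) pt False p(2)] a(1) by metis
      have "(e + i) mod a = x" using p(3) e(1) by (simp add: ring_def)
      have "(e' + i) mod a = (e' mod a + i) mod a" by (simp add: mod_simps)
      also have "\<dots> = ((e + i) mod a + spoke_step t p) mod a" using e(3) by (simp add: mod_simps ac_simps)
      finally have ri: "ring i (Suc p mod a) = Some ((x + spoke_step t p) mod a)"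
        using \<open>(e + i) mod a = x\<close> e(2) by (simp add: ring_def)
      have st: "spoke_step t p < a" using pt a False p(2) by (auto simp: spoke_step_def)
      have Da: "(x' + (a - x)) mod a < a" using a by simp
      have "(x + spoke_step t p) mod a = x' \<longleftrightarrow> spoke_step t p = (x' + (a - x)) mod a"
        by (rule add_mod_eq_iff[OF d Da st])
      then show ?thesis unfolding p_def[symmetric] ri option.inject .
    qed
  qed
  have B1: "\<exists>!s. s \<in> S \<and> B i p s y = z" if "i < a" "1 \<le> p" "p < a" "y \<in> G" "z \<in> G" "y \<noteq> z" for i p y z
    using B_sharp[OF that(1-3)] that(4-6) unfolding sharp_def by blast
  \<comment> \<open>Both arcs over an edge of the rim run in the direction whose difference is odd:
    the cycles missing a residue provide them for differences from 3 on, and one of them for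
    difference 1.\<close>
  have rim: "(\<Sum>j\<in>V - {Some x, Some x'}. card {s \<in> S. \<phi> j s (Some x, y) = (Some x', z)}) =
      (if odd ((x' + (a - x)) mod a) then 2 else 0)"
    if x: "x < a" "x' < a" "x \<noteq> x'" and yz: "y \<in> G" "z \<in> G" "y \<noteq> z" for x x' y z
  proof -
    define d where "d = (x' + (a - x)) mod a"
    define f where "f = (\<lambda>j. card {s \<in> S. \<phi> j s (Some x, y) = (Some x', z)})"
    have d: "1 \<le> d" "d \<le> 2 * t"
    proof -
      have "(x + d) mod a = (x' + a) mod a"
        using x mod_add_right_eq[of x "x' + (a - x)" a] by (simp add: d_def)
      then have "d \<noteq> 0" using x by (intro notI) simp
      moreover have "d < a" using a by (simp add: d_def)
      ultimately show "1 \<le> d" "d \<le> 2 * t" using a by auto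
    qed
    have f_Some: "f (Some i) = (if spoke_step t (pos i (Some x)) = d then card {s \<in> S. B i (pos i (Some x)) s y = z} else 0)"
      if "i < a" "i \<noteq> x" for i
      using arc[OF that x] by (auto simp: f_def \<phi>_def d_def)
    have f_None: "f None = (if d = 1 then card {s \<in> S. A x s y = z} else 0)"
    proof -
      have "Suc x mod a = x' \<longleftrightarrow> d = 1"
      proof -
        have "(x + d) mod a = x'" using x mod_add_right_eq[of x "x' + (a - x)" a] by (simp add: d_def)
        moreover have "d < a" "1 < a" using d a by simp_all
        ultimately show ?thesis using add_mod_eq_iff[of x d a x' 1] by simp blast
      qed
      then show ?thesis by (auto simp: f_def \<phi>_def)
    qed
    have zero: "f j = 0" if "j \<in> V - {Some x, Some x'}" "\<not> odd d" for j
    proof (cases j)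
      case None
      then show ?thesis using f_None that by auto
    next
      case (Some i)
      then have i: "i < a" "i \<noteq> x" using that by (auto simp: V_def)
      have "pos i (Some x) < 2 * t + 1" using ring_pos(2)[of i "Some x"] i x a by (auto simp: V_def)
      then show ?thesis using f_Some[OF i] spoke_step_eq[OF a(2) _ d] that Some by auto
    qed
    have x'_out: "spoke_step t (pos x' (Some x)) \<noteq> d"
      using arc[of x' x x'] ring_V(2)[of x' "Suc (pos x' (Some x)) mod a"] x a by (auto simp: d_def)
    show ?thesis
    proof (cases "odd d")
      case False
      then show ?thesis using zero by (simp add: f_def d_def)
    next
      case True
      have pos_a: "pos i (Some x) < 2 * t + 1" "pos i (Some x) < a" if "i < a" "i \<noteq> x" for i
        using ring_pos(2)[of i "Some x"] that x a by (auto simp: V_def)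
      have "sum f (V - {Some x, Some x'}) = 2"
      proof (cases "d = 1")
        case True
        have "0 < a" "(0 :: nat) \<noteq> 2" using a3 by simp_all
        then obtain i where i: "i < a" "i \<noteq> x" "pos i (Some x) = 0"
          and un: "\<And>i'. i' < a \<Longrightarrow> i' \<noteq> x \<Longrightarrow> pos i' (Some x) = 0 \<Longrightarrow> i' = i"
          using hub[OF x(1), of 0] by blast
        have ix': "i \<noteq> x'" using x'_out i(3) True by (auto simp: spoke_step_def)
        have "sum f (V - {Some x, Some x'}) = f None + f (Some i)"
        proof (rule sum_eq_pair)
          show "Some i \<in> V - {Some x, Some x'}" using i ix' by (simp add: V_def)
          fix j assume j: "j \<in> V - {Some x, Some x'}" "j \<noteq> None" "j \<noteq> Some i"
          then obtain i' where i': "j = Some i'" "i' < a" "i' \<noteq> x" by (cases j) (auto simp: V_def)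
          then have "pos i' (Some x) \<noteq> 0" using un j by auto
          then show "f j = 0" using f_Some[OF i'(2,3)] spoke_step_eq[OF a(2) pos_a(1)[OF i'(2,3)] d] True i' by auto
        qed (use finV in \<open>auto simp: V_def\<close>)
        moreover have "f (Some i) = card {s \<in> S. B i 0 s y = z}"
          using f_Some[OF i(1,2)] i(3) True by (simp add: spoke_step_def)
        moreover have "(i + t) mod a = x"
          using ring_pos(1)[of i "Some x"] i x by (auto simp: V_def ring_def spoke_def add.commute)
        ultimately show ?thesis using f_None True AB[OF i(1) yz] by simp
      next
        case False
        then have d3: "3 \<le> d" "d + 1 < a" using d True a by (presburger, presburger)
        have pp: "d + 1 \<noteq> 2 * t + 2 - d" "d + 1 \<noteq> 2" "2 * t + 2 - d \<noteq> 2" "2 * t + 2 - d < a" "1 \<le> 2 * t + 2 - d"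
          using True d d3 a by presburger+
        obtain i where i: "i < a" "i \<noteq> x" "pos i (Some x) = d + 1"
          and un: "\<And>i'. i' < a \<Longrightarrow> i' \<noteq> x \<Longrightarrow> pos i' (Some x) = d + 1 \<Longrightarrow> i' = i"
          using hub[OF x(1) d3(2) pp(2)] by blast
        obtain h where h: "h < a" "h \<noteq> x" "pos h (Some x) = 2 * t + 2 - d"
          and unh: "\<And>i'. i' < a \<Longrightarrow> i' \<noteq> x \<Longrightarrow> pos i' (Some x) = 2 * t + 2 - d \<Longrightarrow> i' = h"
          using hub[OF x(1) pp(4,3)] by blast
        have step: "spoke_step t (pos i (Some x)) = d" "spoke_step t (pos h (Some x)) = d"
          using spoke_step_eq[OF a(2) pos_a(1)[OF i(1,2)] d] spoke_step_eq[OF a(2) pos_a(1)[OF h(1,2)] d]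
            True False i(3) h(3) by simp_all
        have ne: "i \<noteq> x'" "h \<noteq> x'" using x'_out step by auto
        have "sum f (V - {Some x, Some x'}) = f (Some i) + f (Some h)"
        proof (rule sum_eq_pair)
          show "Some i \<in> V - {Some x, Some x'}" "Some h \<in> V - {Some x, Some x'}" using i h ne by (simp_all add: V_def)
          show "Some i \<noteq> Some h" using i(3) h(3) pp(1) by auto
          fix j assume j: "j \<in> V - {Some x, Some x'}" "j \<noteq> Some i" "j \<noteq> Some h"
          show "f j = 0"
          proof (cases j)
            case None
            then show ?thesis using f_None False by simp
          next
            case (Some i')
            then have i': "i' < a" "i' \<noteq> x" using j by (auto simp: V_def)
            then have "pos i' (Some x) \<noteq> d + 1" "pos i' (Some x) \<noteq> 2 * t + 2 - d" using un unh j Some by auto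
            then show ?thesis using f_Some[OF i'] spoke_step_eq[OF a(2) pos_a(1)[OF i'] d] False Some by auto
          qed
        qed (use finV in auto)
        moreover have "card {s \<in> S. B i (d + 1) s y = z} = 1"
          by (intro card_ex1 B1[OF i(1) _ d3(2) yz]) simp
        moreover have "card {s \<in> S. B h (2 * t + 2 - d) s y = z} = 1"
          by (intro card_ex1 B1[OF h(1) pp(5,4) yz])
        ultimately show ?thesis using f_Some[OF i(1,2)] f_Some[OF h(1,2)] step i(3) h(3) by simp
      qed
      then show ?thesis using True by (simp add: f_def d_def)
    qed
  qed
  \<comment> \<open>Each cycle missing \<open>i\<close> leaves infinity towards
    \<open>i + 1\<close>, also for \<open>t = 1\<close>, where position 3 wraps around to position
    0. With the single arc into infinity this gives two arcs per pair.\<close>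
  have out_hub: "(\<Sum>j\<in>V - {None, Some x}. card {s \<in> S. \<phi> j s (None, y) = (Some x, z)}) = 1"
    if x: "x < a" and yz: "y \<in> G" "z \<in> G" "y \<noteq> z" for x y z
  proof -
    have pN: "pos i None = 2" for i by (simp add: pos_def)
    have r3: "ring i (Suc 2 mod a) = Some ((i + 1) mod a)" for i
    proof (cases "t = 1")
      case True
      then show ?thesis using a by (simp add: ring_def spoke_def)
    next
      case False
      then have "Suc 2 mod a = 3" using a by simp
      then show ?thesis by (simp add: ring_def spoke_def)
    qed
    have "\<exists>!i. i < a \<and> (i + 1) mod a = x" using x by (intro ex1_residue) auto
    then obtain i where i: "i < a" "(i + 1) mod a = x" and un: "\<And>i'. i' < a \<Longrightarrow> (i' + 1) mod a = x \<Longrightarrow> i' = i" by blast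
    have "i \<noteq> x" using i a3 mod_add_left_cancel_less[of i 1 a 0] by auto
    show ?thesis
    proof (rule sum_card_eq_1[where ?j0.0 = "Some i"])
      show "Some i \<in> V - {None, Some x}" using i \<open>i \<noteq> x\<close> by (simp add: V_def)
      show "\<exists>!s. s \<in> S \<and> \<phi> (Some i) s (None, y) = (Some x, z)"
        using B1[OF i(1) _ _ yz, of 2] a3 pN r3 i(2) by (simp add: \<phi>_def)
      fix j s assume "j \<in> V - {None, Some x}" "s \<in> S" "\<phi> j s (None, y) = (Some x, z)"
      then show "j = Some i" using un pN r3 by (cases j) (auto simp: \<phi>_def V_def)
    qed (use finV in auto)
  qed
  have in_hub: "(\<Sum>j\<in>V - {None, Some x}. card {s \<in> S. \<phi> j s (Some x, z) = (None, y)}) = 1"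
    if x: "x < a" and yz: "y \<in> G" "z \<in> G" "y \<noteq> z" for x y z
  proof -
    have "1 < a" "(1 :: nat) \<noteq> 2" using a3 by simp_all
    then obtain i where i: "i < a" "i \<noteq> x" "pos i (Some x) = 1"
      and un: "\<And>i'. i' < a \<Longrightarrow> i' \<noteq> x \<Longrightarrow> pos i' (Some x) = 1 \<Longrightarrow> i' = i"
      using hub[OF x, of 1] by blast
    have r2: "ring i 2 = None" for i by (simp add: ring_def spoke_def)
    show ?thesis
    proof (rule sum_card_eq_1[where ?j0.0 = "Some i"])
      show "Some i \<in> V - {None, Some x}" using i by (simp add: V_def)
      have "Suc 1 mod a = 2" using a3 by simp
      then have "ring i (Suc (pos i (Some x)) mod a) = None" by (simp only: i(3) r2)
      then show "\<exists>!s. s \<in> S \<and> \<phi> (Some i) s (Some x, z) = (None, y)"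
        using B1[OF i(1) _ _ yz(2,1) yz(3)[symmetric], of 1] a3 i(3) by (simp add: \<phi>_def)
      fix j s assume j: "j \<in> V - {None, Some x}" and "s \<in> S" and e: "\<phi> j s (Some x, z) = (None, y)"
      then obtain i' where i': "j = Some i'" "i' < a" "i' \<noteq> x" by (cases j) (auto simp: V_def)
      then have "ring i' (Suc (pos i' (Some x)) mod a) = ring i' 2" using e r2 by (auto simp: \<phi>_def)
      then have "Suc (pos i' (Some x)) mod a = 2" using ring_inj[OF i'(2)] a3 by simp
      moreover have "pos i' (Some x) < a" using ring_pos(2)[of i' "Some x"] i' x by (auto simp: V_def)
      ultimately have "pos i' (Some x) = 1" by (auto simp: mod_Suc split: if_splits)
      then show "j = Some i" using un i' by simp
    qed (use finV in auto)
  qed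
  have "arc_system S G k V \<phi>"
  proof (rule arc_systemI, goal_cases)
    case (1 j s v y)
    note j = 1(1) and s = 1(2) and v = 1(3,4) and y = 1(5)
    show ?case
    proof (cases j)
      case None
      then obtain x where x: "v = Some x" "x < a" using v by (cases v) (auto simp: V_def)
      have "exper (\<phi> None s) (a * b) (Some x, y)"
        by (rule exper_lift_cycle[where h = Some and f = "\<lambda>p. A p s", OF _ _ _ A_per[OF s] x(2) y])
          (use A s in \<open>auto simp: \<phi>_def\<close>)
      moreover have "Suc x mod a \<noteq> x" using x a3 by (auto simp: mod_Suc)
      moreover have "A x s y \<in> G" "A x s y \<noteq> y" using A[OF x(2) s] y bij_betwE by blast+
      ultimately show ?thesis using None x a k by (simp add: \<phi>_def V_def)
    next
      case (Some i)
      then have i: "i < a" using j by (simp add: V_def)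
      define p where "p = pos i v"
      have p: "ring i p = v" "p < a" using ring_pos[OF i v(1)] v(2) Some by (auto simp: p_def)
      have q: "Suc p mod a < a" "Suc p mod a \<noteq> p" using p(2) a3 by (auto simp: mod_Suc)
      have "exper (\<phi> (Some i) s) (a * b) (ring i p, y)"
        by (rule exper_lift_cycle[where h = "ring i" and f = "\<lambda>p. B i p s", OF _ _ _ B_per[OF i s] p(2) y])
          (use B i s pos_ring ring_inj in \<open>auto simp: \<phi>_def inj_on_def\<close>)
      moreover have "ring i (Suc p mod a) \<in> V" "ring i (Suc p mod a) \<noteq> Some i" "ring i (Suc p mod a) \<noteq> v"
        using ring_V[OF i q(1)] ring_inj[OF i q(1) p(2)] q(2) p(1) by auto
      moreover have "B i p s y \<in> G" "B i p s y \<noteq> y" using B[OF i p(2) s] y bij_betwE by blast+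
      ultimately show ?thesis using Some p(1) k by (simp add: \<phi>_def p_def)
    qed
  next
    case (2 v v' y z)
    note V = 2(1,2) and yz = 2(3,4) and ne = 2(5,6)
    show ?case
    proof (cases v)
      case None
      then obtain x where x: "v' = Some x" "x < a" using V ne by (cases v') (auto simp: V_def)
      then show ?thesis using None out_hub[OF x(2) yz ne(2)] in_hub[OF x(2) yz ne(2)] by simp
    next
      case (Some x)
      note vx = this
      then have xa: "x < a" using V by (simp add: V_def)
      show ?thesis
      proof (cases v')
        case None
        then show ?thesis using vx out_hub[OF xa yz(2,1) ne(2)[symmetric]] in_hub[OF xa yz(2,1) ne(2)[symmetric]]
          by (simp add: insert_commute)
      next
        case (Some x')
        then have x': "x' < a" "x \<noteq> x'" using V vx ne by (auto simp: V_def)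
        define d where "d = (x' + (a - x)) mod a"
        define e where "e = (x + (a - x')) mod a"
        \<comment> \<open>The differences in the two directions add up to the odd number
          \<open>a\<close>, so exactly one of them is odd.\<close>
        have "(d + e) mod a = (x' + (a - x) + (x + (a - x'))) mod a" by (simp add: d_def e_def mod_simps)
        also have "x' + (a - x) + (x + (a - x')) = a + a" using xa x' by simp
        finally have de: "(d + e) mod a = 0" by simp
        have "d < a" "e < a" using a by (simp_all add: d_def e_def)
        moreover have "d \<noteq> 0"
        proof
          assume "d = 0"
          then have "(x + 0) mod a = (x' + a) mod a"
            using xa mod_add_right_eq[of x "x' + (a - x)" a] by (simp add: d_def)
          then show False using xa x' by simp
        qed
        ultimately have "d + e = a" using de by (auto simp: mod_if split: if_splits)
        then have "odd d \<longleftrightarrow> even e" using a by presburger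
        then show ?thesis using rim[OF xa x' yz ne(2)] rim[OF x'(1) xa x'(2)[symmetric] yz(2,1) ne(2)[symmetric]]
          vx Some by (simp add: d_def e_def insert_commute)
      qed
    qed
  qed
  then show ?thesis unfolding ARC_def V_def by blast
qed

text \<open>\<open>m\<close> is the 1-factor left over by Walecki's decomposition, the only member
  without period \<open>b\<close>; \<open>r\<close> and \<open>r'\<close> are the two directions of
  one Hamiltonian cycle of the blocks.\<close>

definition odd_kit ::
    "'s set \<Rightarrow> 'g set \<Rightarrow> nat \<Rightarrow> ('s \<Rightarrow> 'g \<Rightarrow> 'g) \<Rightarrow> ('s \<Rightarrow> 'g \<Rightarrow> 'g) \<Rightarrow> 's \<Rightarrow> 's \<Rightarrow> 's \<Rightarrow> bool" where
  "odd_kit S G b f f' m r r' \<longleftrightarrow> derangements S G f f' \<and> sharp S G f \<and>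
     m \<in> S \<and> r \<in> S \<and> r' \<in> S \<and> m \<noteq> r \<and> m \<noteq> r' \<and> r \<noteq> r' \<and>
     (\<forall>s\<in>S. s \<noteq> m \<longrightarrow> (\<forall>y\<in>G. exper (f s) b y)) \<and>
     (\<forall>y\<in>G. f' m y = f m y \<and> f r' y = f' r y \<and> f' r' y = f r y)"

lemma derangements_sym: "derangements S G f f' \<Longrightarrow> derangements S G f' f"
  unfolding derangements_def by metis

lemma sharp_inverse:
  assumes "derangements S G f f'" "sharp S G f"
  shows "sharp S G f'"
  unfolding sharp_def
proof (intro ballI impI)
  fix y z assume yz: "y \<in> G" "z \<in> G" "y \<noteq> z"
  have "f' s y = z \<longleftrightarrow> f s z = y" if "s \<in> S" for s
    using assms(1) yz that unfolding derangements_def by metis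
  moreover have "\<exists>!s. s \<in> S \<and> f s z = y" using assms(2) yz unfolding sharp_def by metis
  ultimately show "\<exists>!s. s \<in> S \<and> f' s y = z" by metis
qed

text \<open>Reversing all permutations preserves the kit. The layers alternate between
  \<open>f\<close> and \<open>f'\<close> around the cycle missing infinity, so both versions
  occur.\<close>

lemma odd_kit_sym:
  assumes "odd_kit S G b f f' m r r'"
  shows "odd_kit S G b f' f m r r'"
proof -
  have d: "derangements S G f f'" and sh: "sharp S G f" using assms by (auto simp: odd_kit_def)
  have "exper (f' s) b y" if "s \<in> S" "s \<noteq> m" "y \<in> G" for s y
  proof (rule exper_inverse[where A = G])
    show "exper (f s) b y" using assms that by (auto simp: odd_kit_def)
  qed (use d that in \<open>auto simp: derangements_def\<close>)
  then show ?thesis using assms derangements_sym[OF d] sharp_inverse[OF d sh]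
    unfolding odd_kit_def by metis
qed

text \<open>Replacing the 1-factor by a second copy of a Hamiltonian permutation gives every member
  the period \<open>b\<close>, at the price of sharpness.\<close>

definition doubled :: "('s \<Rightarrow> 'g \<Rightarrow> 'g) \<Rightarrow> 's \<Rightarrow> 's \<Rightarrow> 's \<Rightarrow> 'g \<Rightarrow> 'g" where
  "doubled f m r s = (if s = m then f r else f s)"

text \<open>The first layer complements \<open>doubled\<close> (two copies of \<open>f m\<close>, none of \<open>f r\<close>), the other
  two are sharp, and the composition of the three layers is again a permutation into cycles of
  length \<open>b\<close>.\<close>

definition triple :: "('s \<Rightarrow> 'g \<Rightarrow> 'g) \<Rightarrow> ('s \<Rightarrow> 'g \<Rightarrow> 'g) \<Rightarrow> 's \<Rightarrow> 's \<Rightarrow> 's \<Rightarrow> nat \<Rightarrow> 's \<Rightarrow> 'g \<Rightarrow> 'g" where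
  "triple f f' m r r' p s =
     (if s = m then (if p = 1 then f r else f m)
      else if s = r then (if p = 2 then f' r else f m)
      else if s = r' then (if p = 2 then f r else f' r)
      else (if p = 2 then f' s else f s))"

context
  fixes S :: "'s set" and G :: "'g set" and b f f' m r r'
  assumes kit: "odd_kit S G b f f' m r r'"
begin

lemma kit_facts:
  shows "derangements S G f f'" "sharp S G f" "m \<in> S" "r \<in> S" "r' \<in> S" "m \<noteq> r" "m \<noteq> r'" "r \<noteq> r'"
    "\<And>s y. s \<in> S \<Longrightarrow> s \<noteq> m \<Longrightarrow> y \<in> G \<Longrightarrow> exper (f s) b y"
    "\<And>y. y \<in> G \<Longrightarrow> f' m y = f m y" "\<And>y. y \<in> G \<Longrightarrow> f r' y = f' r y" "\<And>y. y \<in> G \<Longrightarrow> f' r' y = f r y"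
    "\<And>s y. s \<in> S \<Longrightarrow> y \<in> G \<Longrightarrow> f s y \<in> G" "\<And>s y. s \<in> S \<Longrightarrow> y \<in> G \<Longrightarrow> f' s y \<in> G"
    "\<And>s y. s \<in> S \<Longrightarrow> y \<in> G \<Longrightarrow> f' s (f s y) = y" "\<And>s y. s \<in> S \<Longrightarrow> y \<in> G \<Longrightarrow> f s (f' s y) = y"
  using kit unfolding odd_kit_def derangements_def by auto

lemma derangements_doubled: "derangements S G (doubled f m r) (doubled f' m r)"
  using kit by (auto simp: odd_kit_def derangements_def doubled_def)

lemma exper_doubled: "s \<in> S \<Longrightarrow> y \<in> G \<Longrightarrow> exper (doubled f m r s) b y"
  using kit_facts(4,6,9) by (auto simp: doubled_def)

lemma derangement_triple:
  assumes "s \<in> S"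
  shows "bij_betw (triple f f' m r r' p s) G G" "y \<in> G \<Longrightarrow> triple f f' m r r' p s y \<noteq> y"
proof -
  have "\<exists>q\<in>S. triple f f' m r r' p s = f q \<or> triple f f' m r r' p s = f' q"
    using assms kit_facts(3-5) by (auto simp: triple_def)
  then obtain q where q: "q \<in> S" "triple f f' m r r' p s = f q \<or> triple f f' m r r' p s = f' q" by blast
  note d = kit_facts(1) derangements_sym[OF kit_facts(1)]
  show "bij_betw (triple f f' m r r' p s) G G"
    using q(2) derangements_bij[OF d(1) q(1)] derangements_bij[OF d(2) q(1)] by auto
  show "y \<in> G \<Longrightarrow> triple f f' m r r' p s y \<noteq> y"
    using q d by (auto simp: derangements_def)
qed

text \<open>The layer 2 is the family of inverses, the layer 1 is \<open>f\<close> with the indices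
  \<open>m\<close> and \<open>r\<close> exchanged.\<close>

lemma sharp_triple:
  assumes "p = 1 \<or> p = 2"
  shows "sharp S G (triple f f' m r r' p)"
  using assms
proof
  assume p: "p = 2"
  have "triple f f' m r r' p s y = f' s y" if "s \<in> S" "y \<in> G" for s y
    using p that kit_facts(6-8) kit_facts(10,12)[OF that(2)] by (auto simp: triple_def)
  then show ?thesis using sharp_inverse[OF kit_facts(1,2)] unfolding sharp_def by metis
next
  assume p: "p = 1"
  define \<pi> where "\<pi> = (\<lambda>s. if s = m then r else if s = r then m else s)"
  have \<pi>: "\<pi> s \<in> S \<longleftrightarrow> s \<in> S" "\<pi> (\<pi> s) = s" for s using kit_facts(3,4) by (auto simp: \<pi>_def)
  have *: "triple f f' m r r' p s y = f (\<pi> s) y" if "s \<in> S" "y \<in> G" for s y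
    using p that kit_facts(6-8) kit_facts(11)[OF that(2)] by (auto simp: triple_def \<pi>_def)
  show ?thesis unfolding sharp_def
  proof (intro ballI impI)
    fix y z assume yz: "y \<in> G" "z \<in> G" "y \<noteq> z"
    then obtain s where s: "s \<in> S" "f s y = z" and un: "\<And>s'. s' \<in> S \<Longrightarrow> f s' y = z \<Longrightarrow> s' = s"
      using kit_facts(2) unfolding sharp_def by metis
    show "\<exists>!s. s \<in> S \<and> triple f f' m r r' p s y = z"
      by (rule ex1I[of _ "\<pi> s"]) (use s * \<pi> yz un in metis)+
  qed
qed

lemma doubled_triple_count:
  assumes finS: "finite S" and yz: "y \<in> G" "z \<in> G" "y \<noteq> z"
  shows "card {s \<in> S. doubled f m r s y = z} + card {s \<in> S. triple f f' m r r' 0 s y = z} = 2"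
proof -
  obtain s0 where s0: "s0 \<in> S" "f s0 y = z" and un: "\<And>s'. s' \<in> S \<Longrightarrow> f s' y = z \<Longrightarrow> s' = s0"
    using kit_facts(2) yz unfolding sharp_def by metis
  have eq: "f s y = z \<longleftrightarrow> s = s0" if "s \<in> S" for s using un s0 that by blast
  have r'y: "f' r y = f r' y" using kit_facts(11)[OF yz(1)] by simp
  have D: "{s \<in> S. doubled f m r s y = z} = (if s0 = m then {} else if s0 = r then {m, r} else {s0})"
    using eq kit_facts(3-8) s0 by (auto simp: doubled_def)
  have E: "{s \<in> S. triple f f' m r r' 0 s y = z} = (if s0 = m then {m, r} else if s0 = r then {} else {s0})"
    using eq kit_facts(3-8) s0 r'y by (auto simp: triple_def)
  show ?thesis unfolding D E using kit_facts(6) by auto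
qed

text \<open>For \<open>s = m\<close> the composition is \<open>f r\<close> conjugated by the
  involution \<open>f m\<close>. In the other cases two of the layers cancel and leave
  \<open>f s\<close>, or \<open>f' r\<close> if \<open>s\<close> is \<open>r\<close> or
  \<open>r'\<close>; \<open>f' r\<close> has period \<open>b\<close> because it agrees with
  \<open>f r'\<close>.\<close>

lemma exper_triple:
  assumes s: "s \<in> S" and y: "y \<in> G"
  shows "exper (layers (\<lambda>p. triple f f' m r r' p s) 3) b y"
proof -
  let ?F = "layers (\<lambda>p. triple f f' m r r' p s) 3"
  have F: "?F v = triple f f' m r r' 2 s (triple f f' m r r' 1 s (triple f f' m r r' 0 s v))" for v
    by (simp add: numeral_3_eq_3 numeral_2_eq_2)
  note G = kit_facts(13,14)
  note inv = kit_facts(15,16)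
  have FG: "?F v \<in> G" if "v \<in> G" for v
    using layers_bij[of 3 "\<lambda>p. triple f f' m r r' p s" G 3] derangement_triple(1)[OF s] that
    by (meson bij_betwE order_refl)
  show ?thesis
  proof (cases "s = m")
    case True
    have "exper (f m \<circ> f r \<circ> f m) b (f m (f m y))"
      by (rule exper_sur_conj[where A = G])
        (use kit_facts(3,4,6,9,10) G inv y in \<open>auto simp flip: kit_facts(10)\<close>)
    moreover have "f m (f m y) = y" using inv(1)[OF kit_facts(3) y] kit_facts(10)[OF G(1)[OF kit_facts(3) y]] by simp
    moreover have "?F = f m \<circ> f r \<circ> f m" by (rule ext, unfold F) (simp add: triple_def True)
    ultimately show ?thesis by (simp only:)
  next
    case False
    define g where "g = (if s = r \<or> s = r' then f' r else f s)"
    have "?F v = g v" if v: "v \<in> G" for v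
    proof -
      have "f m (f m v) = v" using inv(1)[OF kit_facts(3) v] kit_facts(10)[OF G(1)[OF kit_facts(3) v]] by simp
      moreover have "f r (f' r (f' r v)) = f' r v" using inv(2)[OF kit_facts(4)] G(2)[OF kit_facts(4) v] by simp
      moreover have "f' s (f s (f s v)) = f s v" using inv(1)[OF s] G(1)[OF s v] by simp
      ultimately show ?thesis using False kit_facts(6-8) by (unfold F) (simp add: g_def triple_def)
    qed
    then have "exper ?F b y \<longleftrightarrow> exper g b y"
      by (rule exper_cong[where A = G]) (use FG y in auto)
    moreover have "exper g b y"
    proof (cases "s = r \<or> s = r'")
      case True
      have "exper (f r') b y \<longleftrightarrow> exper (f' r) b y"
        by (rule exper_cong[where A = G]) (use kit_facts(11) G(2) kit_facts(4) y in auto)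
      then show ?thesis using True kit_facts(5,7,9) y by (simp add: g_def)
    next
      case False
      then show ?thesis using kit_facts(9)[OF s \<open>s \<noteq> m\<close> y] by (simp add: g_def)
    qed
    ultimately show ?thesis by simp
  qed
qed

end

lemma card_wheel: "finite (wheel a)" "card (wheel a) = a + 1"
  by (auto simp: wheel_def card_image card_insert_if image_iff)

text \<open>The three layers of \<open>triple\<close> suffice for the compensation, since the
  remaining \<open>a - 3\<close> positions are even in number and carry an involution that
  cancels.\<close>

lemma good_1_large:
  assumes "finite S" "odd a" "3 \<le> a" and kit: "odd_kit S G b f f' m r r'"
    and l: "derangements S G l l" "sharp S G l"
  shows "good S G (a * b) (a + 1)"
proof (rule goodI[OF _ card_wheel])
  obtain t where t: "a = 2 * t + 1" using \<open>odd a\<close> by (elim oddE)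
  note kit' = odd_kit_sym[OF kit]
  \<comment> \<open>\<open>(i + t) mod a\<close> is the vertex where the shared edge starts. Its
    parity decides whether \<open>A\<close> uses \<open>f\<close> or \<open>f'\<close> there, and
    \<open>B\<close> has to compensate the same version.\<close>
  define B where "B = (\<lambda>i p s. if 3 \<le> p then l s
    else if even ((i + t) mod a) then triple f f' m r r' p s else triple f' f m r r' p s)"
  define A where "A = (\<lambda>p :: nat. if even p then doubled f m r else doubled f' m r)"
  have A_app: "(\<lambda>p. A p s) = (\<lambda>p. if even p then doubled f m r s else doubled f' m r s)" for s
    by (auto simp: A_def)
  note d = derangements_doubled[OF kit]
  note d' = derangements_doubled[OF kit']
  show "ARC S G (a * b) (wheel a)"
  proof (rule odd_base[where A = A and B = B and t = t, OF t _ refl assms(1)])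
    show "1 \<le> t" using t assms(3) by simp
    show "bij_betw (A p s) G G \<and> (\<forall>y\<in>G. A p s y \<noteq> y)" if "s \<in> S" for p :: nat and s
      using derangements_bij[OF d that] derangements_bij[OF d' that] d d' that
      by (auto simp: A_def derangements_def)
    show "exper (layers (\<lambda>p. A p s) a) b y" if "s \<in> S" "y \<in> G" for s y
    proof -
      have lay: "layers (\<lambda>p. A p s) a v = doubled f m r s v" if "v \<in> G" for v
        unfolding A_app by (rule layers_alternate[where G = G])
          (use d \<open>s \<in> S\<close> \<open>odd a\<close> that in \<open>auto simp: derangements_def\<close>)
      then have "exper (layers (\<lambda>p. A p s) a) b y \<longleftrightarrow> exper (doubled f m r s) b y"
        by (rule exper_cong[where A = G]) (use lay d that in \<open>auto simp: derangements_def\<close>)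
      then show ?thesis using exper_doubled[OF kit that] by simp
    qed
    show "bij_betw (B i p s) G G \<and> (\<forall>y\<in>G. B i p s y \<noteq> y)" if "s \<in> S" for i p :: nat and s
      using derangement_triple[OF kit that, where p = p] derangement_triple[OF kit' that, where p = p]
        derangements_bij[OF l(1) that] l(1) that
      by (auto simp: B_def derangements_def)
    show "exper (layers (\<lambda>p. B i p s) a) b y" if "s \<in> S" "y \<in> G" for i s y
    proof -
      define g where "g = (\<lambda>p. if even ((i + t) mod a) then triple f f' m r r' p s else triple f' f m r r' p s)"
      have gbij: "bij_betw (g p) G G" for p
        using derangement_triple(1)[OF kit \<open>s \<in> S\<close>] derangement_triple(1)[OF kit' \<open>s \<in> S\<close>] by (simp add: g_def)
      have g3: "layers g 3 v \<in> G" if "v \<in> G" for v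
        using layers_bij[of 3 g G 3] gbij that by (meson bij_betwE order_refl)
      have lay: "layers (\<lambda>p. B i p s) a v = layers g 3 v" if "v \<in> G" for v
      proof -
        have 3: "layers (\<lambda>p. B i p s) 3 v = layers g 3 v" by (simp add: numeral_3_eq_3 B_def g_def)
        have "layers (\<lambda>p. B i p s) (3 + (a - 3)) v = layers (\<lambda>p. B i p s) 3 v"
          by (rule layers_involution_tail[where g = "l s" and G = G])
            (use l(1) \<open>s \<in> S\<close> \<open>odd a\<close> assms(3) 3 g3[OF that] in \<open>auto simp: B_def derangements_def\<close>)
        then show ?thesis using 3 assms(3) by simp
      qed
      then have "exper (layers (\<lambda>p. B i p s) a) b y \<longleftrightarrow> exper (layers g 3) b y"
        by (rule exper_cong[where A = G]) (use lay g3 that in auto)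
      then show ?thesis using exper_triple[OF kit that] exper_triple[OF kit' that]
        by (cases "even ((i + t) mod a)") (simp_all add: g_def)
    qed
    show "sharp S G (B i p)" if "1 \<le> p" "p < a" for i p :: nat
    proof (cases "3 \<le> p")
      case True
      then show ?thesis using l(2) by (simp add: B_def)
    next
      case False
      then have "p = 1 \<or> p = 2" using that by auto
      then show ?thesis using False sharp_triple[OF kit, of p] sharp_triple[OF kit', of p]
        by (cases "even ((i + t) mod a)") (simp_all add: B_def)
    qed
    show "card {s \<in> S. A ((i + t) mod a) s y = z} + card {s \<in> S. B i 0 s y = z} = 2"
      if "y \<in> G" "z \<in> G" "y \<noteq> z" for i y z
      using doubled_triple_count[OF kit assms(1) that] doubled_triple_count[OF kit' assms(1) that]
      by (cases "even ((i + t) mod a)") (simp_all add: A_def B_def)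
  qed
qed

text \<open>For \<open>b = 2\<close> the blocks have no Hamiltonian cycle, but an odd number of
  copies of a fixed point free involution is that involution, whose cycles already have length
  2.\<close>

lemma good_1_small:
  assumes "finite S" "odd a" "3 \<le> a" and l: "derangements S G l l" "sharp S G l"
  shows "good S G (a * 2) (a + 1)"
proof (rule goodI[OF _ card_wheel])
  obtain t where t: "a = 2 * t + 1" using \<open>odd a\<close> by (elim oddE)
  have lG: "l s y \<in> G" "l s y \<noteq> y" "l s (l s y) = y" if "s \<in> S" "y \<in> G" for s y
    using l(1) that by (auto simp: derangements_def)
  have lay: "exper (layers (\<lambda>p. l s) a) 2 y" if "s \<in> S" "y \<in> G" for s y
  proof -
    have e: "layers (\<lambda>p. l s) a v = l s v" if "v \<in> G" for v
      using layers_alternate[of a G "l s" "l s" v] lG[OF \<open>s \<in> S\<close>] that \<open>odd a\<close> by simp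
    then have "exper (layers (\<lambda>p. l s) a) 2 y \<longleftrightarrow> exper (l s) 2 y"
      by (rule exper_cong[where A = G]) (use e lG that in auto)
    moreover have "exper (l s) 2 y"
      using lG[OF that] by (auto simp: exper_def numeral_2_eq_2 less_Suc_eq)
    ultimately show ?thesis by simp
  qed
  show "ARC S G (a * 2) (wheel a)"
  proof (rule odd_base[where A = "\<lambda>_. l" and B = "\<lambda>_ _. l" and t = t, OF t _ refl assms(1)])
    show "1 \<le> t" using t assms(3) by simp
    show "card {s \<in> S. l s y = z} + card {s \<in> S. l s y = z} = 2" if "y \<in> G" "z \<in> G" "y \<noteq> z" for y z
    proof -
      have "\<exists>!s. s \<in> S \<and> l s y = z" using l(2) that unfolding sharp_def by blast
      then show ?thesis by (simp add: card_ex1)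
    qed
  qed (use l lay derangements_bij[OF l(1)] lG in auto)
qed

lemma good_general:
  assumes "odd a" "3 \<le> a" "0 < q"
  shows "good (classes m (Suc n)) (colours m (Suc n)) (2 * a * Suc n) (a * q + 1)"
proof (rule good_even_cases[OF finite_classes assms(1,2) refl _ _ assms(3)])
  show ek: "even_kit (classes m (Suc n)) (colours m (Suc n)) (Suc n) (lam m n) (lam' m n)"
    using derangements_lam derangements_lam' sharp_lam sharp_lam' exper_lam_lam' by (auto simp: even_kit_def)
  show "good (classes m (Suc n)) (colours m (Suc n)) (2 * a * Suc n) (a + 1)"
  proof (cases "n = 0")
    case True
    then show ?thesis
      using good_1_small[OF finite_classes assms(1,2) derangements_lam sharp_lam, of m n] by (simp add: mult.commute)
  next
    case False
    have "odd_kit (classes m (Suc n)) (colours m (Suc n)) (2 * Suc n) (kap m n) (kap' m n) (0, n) (0, 0) (0, Suc n)"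
      using derangements_kap sharp_kap exper_kap kap_exceptional False
      by (auto simp: odd_kit_def classes_def)
    from good_1_large[OF finite_classes assms(1,2) this derangements_lam sharp_lam]
    show ?thesis by (simp add: ac_simps)
  qed
qed

section \<open>Partial cycle factors\<close>

definition cycle_graph :: "'a set \<Rightarrow> ('a \<Rightarrow> 'a) \<Rightarrow> 'a mgraph" where
  "cycle_graph W f = \<lparr>mverts = W, medges = image_mset (\<lambda>v. {v, f v}) (mset_set W)\<rparr>"

context
  fixes W :: "'a set" and f :: "'a \<Rightarrow> 'a" and k :: nat
  assumes fin: "finite W" and closed: "\<And>v. v \<in> W \<Longrightarrow> f v \<in> W"
    and per: "\<And>v. v \<in> W \<Longrightarrow> exper f k v" and k: "3 \<le> k"
begin

lemma f_f_neq: "v \<in> W \<Longrightarrow> f (f v) \<noteq> v"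
proof -
  assume v: "v \<in> W"
  have "(f ^^ 2) v \<noteq> v" using per[OF v] k by (auto simp: exper_def)
  then show ?thesis by (simp add: numeral_2_eq_2)
qed

text \<open>Two vertices with the same edge would be exchanged by \<open>f\<close>, which period at
  least 3 excludes. So the factor is simple and a sum over vertices is a sum over edges.\<close>

lemma inj_edge: "inj_on (\<lambda>v. {v, f v}) W"
  by (rule inj_onI) (metis doubleton_eq_iff f_f_neq)

lemma medges_cycle_graph: "medges (cycle_graph W f) = mset_set ((\<lambda>v. {v, f v}) ` W)"
  by (simp add: cycle_graph_def image_mset_mset_set inj_edge)

lemma funpow_closed: "v \<in> W \<Longrightarrow> (f ^^ i) v \<in> W"
  by (induction i) (auto intro: closed)

lemma funpow_period: "v \<in> W \<Longrightarrow> (f ^^ (i mod k)) v = (f ^^ i) v"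
  using per by (intro funpow_mod_eq) (auto simp: exper_def)

lemma adjacency_cycle_graph:
  "(x, y) \<in> adjacency (cycle_graph W f) \<longleftrightarrow> x \<in> W \<and> y \<in> W \<and> (y = f x \<or> x = f y)"
  using fin closed by (auto simp: adjacency_def cycle_graph_def doubleton_eq_iff)

lemma component_eq_orbit:
  assumes x: "x \<in> W"
  shows "(adjacency (cycle_graph W f))\<^sup>* `` {x} = (\<lambda>i. (f ^^ i) x) ` {0..<k}"
proof -
  let ?O = "(\<lambda>i. (f ^^ i) x) ` {0..<k}"
  have O: "(f ^^ i) x \<in> ?O" for i
    using funpow_period[OF x, of i] k by (intro image_eqI[of _ _ "i mod k"]) auto
  have "y \<in> ?O" if "(x, y) \<in> (adjacency (cycle_graph W f))\<^sup>*" for y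
    using that
  proof (induction rule: rtrancl_induct)
    case base
    show ?case using O[of 0] by simp
  next
    case (step y z)
    then obtain i where i: "y = (f ^^ i) x" by blast
    from step(2) have "z \<in> W" "z = f y \<or> y = f z" by (auto simp: adjacency_cycle_graph)
    then show ?case
    proof (elim disjE)
      assume "z = f y"
      then show ?thesis using O[of "Suc i"] i by simp
    next
      assume "y = f z"
      \<comment> \<open>Adjacency is symmetric, so an orbit may also be traversed backwards;
        \<open>k - 1\<close> steps forward undo one step.\<close>
      have "z = (f ^^ (Suc (k - 1))) z" using per[OF \<open>z \<in> W\<close>] k by (simp add: exper_def)
      also have "\<dots> = (f ^^ (k - 1)) (f z)" by (simp only: funpow_Suc_right o_apply)
      also have "\<dots> = (f ^^ (k - 1 + i)) x" using \<open>y = f z\<close> i by (simp add: funpow_add)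
      finally show ?thesis using O by metis
    qed
  qed
  moreover have "(x, (f ^^ i) x) \<in> (adjacency (cycle_graph W f))\<^sup>*" for i
  proof (induction i)
    case (Suc i)
    have "((f ^^ i) x, (f ^^ Suc i) x) \<in> adjacency (cycle_graph W f)"
      using funpow_closed[OF x, of i] closed by (simp add: adjacency_cycle_graph)
    then show ?case using Suc by (rule rtrancl_into_rtrancl[rotated])
  qed simp
  ultimately show ?thesis by blast
qed

lemma components_cycle_graph:
  assumes "C \<in> components (cycle_graph W f)"
  shows "is_cycle k C"
proof -
  obtain x where x: "x \<in> W" "C = induced (cycle_graph W f) ((adjacency (cycle_graph W f))\<^sup>* `` {x})"
    using assms by (auto simp: components_def cycle_graph_def)
  define Ob where "Ob = (\<lambda>i. (f ^^ i) x) ` {0..<k}"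
  have C: "C = induced (cycle_graph W f) Ob" using x component_eq_orbit by (simp add: Ob_def)
  have OW: "Ob \<subseteq> W" using funpow_closed[OF x(1)] by (auto simp: Ob_def)
  have inj: "inj_on (\<lambda>i. (f ^^ i) x) {0..<k}"
  proof (rule linorder_inj_onI)
    fix i j assume "i < j" "i \<in> {0..<k}" "j \<in> {0..<k}"
    then have "0 < j - i" "j - i < k" "(f ^^ (j - i)) ((f ^^ i) x) = (f ^^ j) x"
      by (auto simp flip: funpow_add[THEN fun_cong, unfolded o_apply])
    then show "(f ^^ i) x \<noteq> (f ^^ j) x"
      using per[OF funpow_closed[OF x(1), of i]] unfolding exper_def by metis
  qed auto
  have fO: "f v \<in> Ob" if vO: "v \<in> Ob" for v
  proof -
    obtain i where "v = (f ^^ i) x" using vO by (auto simp: Ob_def)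
    then have "f v = (f ^^ (Suc i mod k)) x" using funpow_period[OF x(1), of "Suc i"] by simp
    then show ?thesis using k by (auto simp: Ob_def)
  qed
  have "medges C = image_mset (\<lambda>v. {v, f v}) (filter_mset (\<lambda>v. {v, f v} \<subseteq> Ob) (mset_set W))"
    by (simp add: C induced_def cycle_graph_def filter_mset_image_mset)
  also have "filter_mset (\<lambda>v. {v, f v} \<subseteq> Ob) (mset_set W) = mset_set Ob"
  proof -
    have "{v \<in> W. {v, f v} \<subseteq> Ob} = Ob" using OW fO by auto
    then show ?thesis using fin by (simp add: filter_mset_mset_set)
  qed
  also have "mset_set Ob = image_mset (\<lambda>i. (f ^^ i) x) (mset_set {0..<k})"
    using inj by (simp add: Ob_def image_mset_mset_set)
  finally have edges: "medges C = image_mset (\<lambda>i. {(f ^^ i) x, f ((f ^^ i) x)}) (mset_set {0..<k})"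
    by (simp add: image_mset.compositionality comp_def)
  define vs where "vs = map (\<lambda>i. (f ^^ i) x) [0..<k]"
  have "{vs ! i, vs ! (Suc i mod k)} = {(f ^^ i) x, f ((f ^^ i) x)}" if "i < k" for i
    using that k funpow_period[OF x(1), of "Suc i"] by (simp add: vs_def)
  then have "medges C = {#{vs ! i, vs ! (Suc i mod k)}. i \<in># mset_set {0..<k}#}"
    unfolding edges by (intro image_mset_cong) auto
  moreover have "length vs = k" "distinct vs" "set vs = Ob"
    using inj by (simp_all add: vs_def Ob_def distinct_map)
  moreover have "mverts C = Ob" using OW by (auto simp: C induced_def cycle_graph_def)
  ultimately show ?thesis unfolding is_cycle_def by (intro exI[of _ vs]) simp
qed

end

section \<open>From arcs to the edge multiset of the tensor product\<close>

definition cross_edges :: "nat \<Rightarrow> nat \<Rightarrow> (nat \<times> nat) set set" where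
  "cross_edges u g = {{(x, y), (x', z)} |x y x' z. x < u \<and> x' < u \<and> x \<noteq> x' \<and> y < g \<and> z < g \<and> y \<noteq> z}"

lemma edges_complete_graph: "{x, y} \<in> edges (complete_graph n) \<longleftrightarrow> x < n \<and> y < n \<and> x \<noteq> y"
  by (auto simp: complete_graph_def doubleton_eq_iff)

lemma edges_tensor: "edges (tensor_product (complete_graph u) (complete_graph g)) = cross_edges u g"
  unfolding tensor_product_def cross_edges_def by (simp add: edges_complete_graph)

lemma finite_cross_edges: "finite (cross_edges u g)"
  by (rule finite_subset[of _ "Pow ({..<u} \<times> {..<g})"]) (auto simp: cross_edges_def)

lemma KxK_simps:
  shows mverts_KxK: "mverts (KxK u g l) = {..<u} \<times> {..<g}"
    and medges_KxK: "medges (KxK u g l) = repeat_mset l (mset_set (cross_edges u g))"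
proof -
  show "mverts (KxK u g l) = {..<u} \<times> {..<g}"
    by (simp add: KxK_def multiply_edges_def tensor_product_def complete_graph_def atLeast0LessThan)
  show "medges (KxK u g l) = repeat_mset l (mset_set (cross_edges u g))"
    by (simp add: KxK_def multiply_edges_def edges_tensor)
qed

lemma partial_factor:
  assumes "j < u" "W = ({..<u} - {j}) \<times> {..<g}" "3 \<le> k"
    and step: "\<And>x y. x \<in> {..<u} - {j} \<Longrightarrow> y < g \<Longrightarrow>
      fst (f (x, y)) \<in> {..<u} - {j, x} \<and> snd (f (x, y)) \<in> {..<g} - {y} \<and> exper f k (x, y)"
  shows "partial_cycle_factor k u g 2 (cycle_graph W f)"
proof -
  have fin: "finite W" by (simp add: assms(2))
  have st: "fst (f v) < u \<and> fst (f v) \<noteq> j \<and> fst (f v) \<noteq> fst v \<and> snd (f v) < g \<and> snd (f v) \<noteq> snd v \<and> exper f k v"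
    if "v \<in> W" for v
    using step[of "fst v" "snd v"] that by (auto simp: assms(2) mem_Times_iff)
  have closed: "f v \<in> W" if "v \<in> W" for v using st[OF that] by (auto simp: assms(2) mem_Times_iff)
  have per: "exper f k v" if "v \<in> W" for v using st[OF that] by simp
  let ?X = "(\<lambda>v. {v, f v}) ` W"
  have X: "medges (cycle_graph W f) = mset_set ?X"
    using medges_cycle_graph[OF fin closed per assms(3)] by simp
  have XE: "?X \<subseteq> cross_edges u g"
  proof
    fix e assume "e \<in> ?X"
    then obtain v where v: "v \<in> W" "e = {v, f v}" by blast
    then have "e = {(fst v, snd v), (fst (f v), snd (f v))} \<and> fst v < u \<and> fst (f v) < u \<and> fst v \<noteq> fst (f v) \<and>
        snd v < g \<and> snd (f v) < g \<and> snd v \<noteq> snd (f v)"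
      using st[OF v(1)] by (auto simp: assms(2))
    then show "e \<in> cross_edges u g" unfolding cross_edges_def by blast
  qed
  have M: "delete_verts (KxK u g 2) (partite_set g j) =
      \<lparr>mverts = W, medges = filter_mset (\<lambda>e. e \<subseteq> W) (repeat_mset 2 (mset_set (cross_edges u g)))\<rparr>"
  proof -
    have "{..<u} \<times> {..<g} - {j} \<times> {0..<g} = W" by (auto simp: assms(2))
    moreover have "{..<u} \<times> {..<g} \<inter> W = W" by (auto simp: assms(2))
    ultimately show ?thesis
      by (simp add: delete_verts_def induced_def KxK_simps partite_set_def complete_graph_def)
  qed
  have "mset_set ?X \<subseteq># filter_mset (\<lambda>e. e \<subseteq> W) (repeat_mset 2 (mset_set (cross_edges u g)))"
  proof (rule mset_subset_eqI)
    fix e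
    show "count (mset_set ?X) e \<le> count (filter_mset (\<lambda>e. e \<subseteq> W) (repeat_mset 2 (mset_set (cross_edges u g)))) e"
    proof (cases "e \<in> ?X")
      case True
      then have "e \<subseteq> W" "e \<in> cross_edges u g" using XE closed by auto
      then show ?thesis using True fin finite_cross_edges by simp
    next
      case False
      then show ?thesis by simp
    qed
  qed
  moreover have "e \<subseteq> W" if "e \<in># mset_set ?X" for e using that fin closed by auto
  ultimately have "spanning_subgraph (cycle_graph W f) (delete_verts (KxK u g 2) (partite_set g j))"
    unfolding spanning_subgraph_def subgraph_def M X by (simp add: cycle_graph_def)
  moreover have "j \<in> verts (complete_graph u)" using assms(1) by (simp add: complete_graph_def)
  ultimately show ?thesis
    using components_cycle_graph[OF fin closed per assms(3)] unfolding partial_cycle_factor_def by blast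
qed

text \<open>The factor indexed by \<open>j\<close> and \<open>s\<close> contains an edge iff its
  permutation traverses it in one of the two directions, never in both. The sums in
  \<open>arc_system\<close> are therefore the multiplicities of the edges in the union of all
  factors.\<close>

lemma ARC_imp_is_ARCS:
  assumes finS: "finite S" and arc: "ARC S {..<g} k {..<u}" and k: "3 \<le> k" and u: "2 \<le> u" and g: "0 < g"
  shows "\<exists>P. is_ARCS k u g 2 P"
proof -
  obtain \<phi> where sys: "arc_system S {..<g} k {..<u} \<phi>" using arc unfolding ARC_def by blast
  define W where "W = (\<lambda>j. ({..<u} - {j}) \<times> {..<g})"
  define F where "F = (\<lambda>(j, s). cycle_graph (W j) (\<phi> j s))"
  define P where "P = image_mset F (mset_set ({..<u} \<times> S))"
  define X where "X = (\<lambda>j s. (\<lambda>v. {v, \<phi> j s v}) ` W j)"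
  have finW: "finite (W j)" for j by (simp add: W_def)
  have sysD: "fst (\<phi> j s (x, y)) \<in> {..<u} - {j, x} \<and> snd (\<phi> j s (x, y)) \<in> {..<g} - {y} \<and> exper (\<phi> j s) k (x, y)"
    if "j < u" "s \<in> S" "x \<in> {..<u} - {j}" "y < g" for j s x y
    using arc_systemD[OF sys, of j s x y] that by auto
  have closed: "\<phi> j s v \<in> W j" and per: "exper (\<phi> j s) k v"
    if "j < u" "s \<in> S" "v \<in> W j" for j s v
    using sysD[OF that(1,2), of "fst v" "snd v"] that(3) by (auto simp: W_def mem_Times_iff)
  have factor: "partial_cycle_factor k u g 2 (F (j, s))" if "j < u" "s \<in> S" for j s
    unfolding F_def prod.case
    by (rule partial_factor[OF that(1) W_def[THEN fun_cong] k sysD[OF that]])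
  have medgesF: "medges (F (j, s)) = mset_set (X j s)" if "j < u" "s \<in> S" for j s
    using medges_cycle_graph[OF finW closed[OF that] per[OF that] k] by (simp add: F_def X_def)
  have ne: "medges (F (j, s)) \<noteq> {#}" if "j < u" "s \<in> S" for j s
  proof -
    \<comment> \<open>Any part other than \<open>j\<close> supplies a vertex; it exists because
      \<open>u\<close> is at least 2.\<close>
    have "((if j = 0 then 1 else 0), 0) \<in> W j" using g u by (auto simp: W_def)
    then show ?thesis using medgesF[OF that] finW by (auto simp: mset_set_empty_iff X_def)
  qed
  have edge: "{v, w} \<in> X j s \<longleftrightarrow>
      fst v \<noteq> j \<and> fst w \<noteq> j \<and> (\<phi> j s v = w \<or> \<phi> j s w = v)"
    if "j < u" "s \<in> S" "v \<in> {..<u} \<times> {..<g}" "w \<in> {..<u} \<times> {..<g}" for j s v w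
  proof
    assume "{v, w} \<in> X j s"
    then obtain x where x: "x \<in> W j" "{v, w} = {x, \<phi> j s x}" unfolding X_def by blast
    then have "v \<in> W j" "w \<in> W j" using closed[OF that(1,2) x(1)] by (auto simp: doubleton_eq_iff)
    then have "fst v \<noteq> j" "fst w \<noteq> j" by (auto simp: W_def)
    then show "fst v \<noteq> j \<and> fst w \<noteq> j \<and> (\<phi> j s v = w \<or> \<phi> j s w = v)"
      using x(2) by (auto simp: doubleton_eq_iff)
  next
    assume "fst v \<noteq> j \<and> fst w \<noteq> j \<and> (\<phi> j s v = w \<or> \<phi> j s w = v)"
    then have "v \<in> W j" "w \<in> W j" "\<phi> j s v = w \<or> \<phi> j s w = v" using that by (auto simp: W_def mem_Times_iff)
    then show "{v, w} \<in> X j s" by (auto simp: X_def intro: image_eqI)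
  qed
  have sum: "(\<Sum>F\<in>#P. medges F) = (\<Sum>p\<in>{..<u} \<times> S. medges (F p))"
    by (simp add: P_def sum_unfold_sum_mset image_mset.compositionality comp_def)
  have "(\<Sum>p\<in>{..<u} \<times> S. medges (F p)) = repeat_mset 2 (mset_set (cross_edges u g))"
  proof (rule multiset_eqI)
    fix e
    have cnt: "count (\<Sum>p\<in>{..<u} \<times> S. medges (F p)) e =
        (\<Sum>j<u. card {s \<in> S. e \<in> X j s})"
    proof -
      have "count (\<Sum>p\<in>{..<u} \<times> S. medges (F p)) e = (\<Sum>j<u. \<Sum>s\<in>S. count (medges (F (j, s))) e)"
        by (simp add: count_sum sum.cartesian_product)
      also have "\<dots> = (\<Sum>j<u. \<Sum>s\<in>S. if e \<in> X j s then 1 else 0)"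
        by (intro sum.cong refl) (use medgesF finW in \<open>auto simp: count_mset_set' X_def\<close>)
      also have "\<dots> = (\<Sum>j<u. card {s \<in> S. e \<in> X j s})"
        using finS by (simp add: sum.If_cases Int_def)
      finally show ?thesis .
    qed
    show "count (\<Sum>p\<in>{..<u} \<times> S. medges (F p)) e = count (repeat_mset 2 (mset_set (cross_edges u g))) e"
    proof (cases "e \<in> cross_edges u g")
      case True
      then obtain x y x' z where e: "e = {(x, y), (x', z)}" and x: "x < u" "x' < u" "x \<noteq> x'" and y: "y < g" "z < g" "y \<noteq> z"
        unfolding cross_edges_def by blast
      have iff: "e \<in> X j s \<longleftrightarrow>
          x \<noteq> j \<and> x' \<noteq> j \<and> (\<phi> j s (x, y) = (x', z) \<or> \<phi> j s (x', z) = (x, y))" if "j < u" "s \<in> S" for j s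
        using edge[OF that, of "(x, y)" "(x', z)"] x y by (simp add: e)
      \<comment> \<open>The two directions exclude each other, as a permutation traversing both
        would have a cycle of length 2.\<close>
      have split: "card {s \<in> S. e \<in> X j s} =
          card {s \<in> S. \<phi> j s (x, y) = (x', z)} + card {s \<in> S. \<phi> j s (x', z) = (x, y)}"
        if j: "j \<in> {..<u} - {x, x'}" for j
      proof -
        have "{s \<in> S. e \<in> X j s} =
            {s \<in> S. \<phi> j s (x, y) = (x', z)} \<union> {s \<in> S. \<phi> j s (x', z) = (x, y)}"
          using iff[of j] j by auto
        moreover have "{s \<in> S. \<phi> j s (x, y) = (x', z)} \<inter> {s \<in> S. \<phi> j s (x', z) = (x, y)} = {}"
        proof (rule equals0I)
          fix s assume "s \<in> {s \<in> S. \<phi> j s (x, y) = (x', z)} \<inter> {s \<in> S. \<phi> j s (x', z) = (x, y)}"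
          then have s: "s \<in> S" "\<phi> j s (x, y) = (x', z)" "\<phi> j s (x', z) = (x, y)" by auto
          have ju: "j < u" "(x, y) \<in> W j" using j x y by (auto simp: W_def)
          have "\<phi> j s (\<phi> j s (x, y)) \<noteq> (x, y)"
            by (rule f_f_neq[OF finW closed[OF ju(1) s(1)] per[OF ju(1) s(1)] k ju(2)])
          then show False by (simp only: s simp_thms)
        qed
        ultimately show ?thesis using finS by (simp add: card_Un_disjoint)
      qed
      have "(\<Sum>j<u. card {s \<in> S. e \<in> X j s}) =
          (\<Sum>j\<in>{..<u} - {x, x'}. card {s \<in> S. e \<in> X j s})"
      proof (rule sum.mono_neutral_right)
        show "\<forall>j\<in>{..<u} - ({..<u} - {x, x'}). card {s \<in> S. e \<in> X j s} = 0"
        proof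
          fix j assume "j \<in> {..<u} - ({..<u} - {x, x'})"
          then have "{s \<in> S. e \<in> X j s} = {}" using iff[of j] by auto
          then show "card {s \<in> S. e \<in> X j s} = 0" by (metis card.empty)
        qed
      qed auto
      also have "\<dots> = 2"
        using arc_system_count[OF sys, of x x' y z] x y by (simp add: split sum.distrib)
      finally show ?thesis using cnt True finite_cross_edges by simp
    next
      case False
      have "{s \<in> S. e \<in> X j s} = {}" if "j < u" for j
      proof -
        have "e \<notin> X j s" if "s \<in> S" for s
        proof
          assume "e \<in> X j s"
          then obtain v where v: "v \<in> W j" "e = {v, \<phi> j s v}" unfolding X_def by blast
          have "e = {(fst v, snd v), (fst (\<phi> j s v), snd (\<phi> j s v))} \<and> fst v < u \<and> fst (\<phi> j s v) < u \<and>
              fst v \<noteq> fst (\<phi> j s v) \<and> snd v < g \<and> snd (\<phi> j s v) < g \<and> snd v \<noteq> snd (\<phi> j s v)"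
            using sysD[OF \<open>j < u\<close> that, of "fst v" "snd v"] v by (auto simp: W_def)
          then show False using False unfolding cross_edges_def by blast
        qed
        then show ?thesis by blast
      qed
      then have "card {s \<in> S. e \<in> X j s} = 0" if "j < u" for j
        using that by (simp only: card.empty)
      then have "(\<Sum>j<u. card {s \<in> S. e \<in> X j s}) = 0"
        by (intro sum.neutral) blast
      then show ?thesis using cnt False finite_cross_edges by simp
    qed
  qed
  then have "(\<Sum>F\<in>#P. medges F) = medges (KxK u g 2)" using sum by (simp add: KxK_simps)
  moreover have "\<forall>C\<in>#P. partial_cycle_factor k u g 2 C \<and> medges C \<noteq> {#}"
    using factor ne finS by (auto simp: P_def)
  ultimately have "is_ARCS k u g 2 P" unfolding is_ARCS_def by blast
  then show ?thesis by blast
qed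

theorem theorem4p9:
  fixes p :: "nat \<Rightarrow> nat" and k t i u g :: nat
  assumes "u > 0" and "g > 0"
    and "k = (\<Prod>j=1..t. p j)" and "k \<ge> 6" and "even k"
    and "\<forall>j\<in>{1..t}. prime (p j)"
    and "1 \<le> i" and "i \<le> t - 1"
    and "\<forall>j\<in>{1..i}. odd (p j)"
    and "\<exists>j\<in>{i+1..t}. p j = 2"
    and "[u = 1] (mod (\<Prod>j=1..i. p j))"
    and "[g = 0] (mod (\<Prod>j=i+1..t. p j))"
  shows "\<exists>P. is_ARCS k u g 2 P"
proof (cases "u = 1")
  case True
  then have "medges (KxK u g 2) = {#}" by (auto simp: medges_KxK cross_edges_def)
  then show ?thesis by (intro exI[of _ "{#}"]) (simp add: is_ARCS_def)
next
  case False
  define a where "a = (\<Prod>j=1..i. p j)"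
  define b where "b = (\<Prod>j=i+1..t. p j)"
  have it: "i < t" using assms(7,8) by simp
  have "{1..t} = {1..i} \<union> {i+1..t}" using it by auto
  then have kab: "k = a * b"
    by (simp add: assms(3) a_def b_def prod.union_disjoint)
  have "odd a" using assms(9) by (auto simp: a_def even_prod_iff)
  have "p 1 dvd a" unfolding a_def using assms(7) by (intro dvd_prodI) auto
  moreover have "prime (p 1)" using assms(6,7) it by simp
  ultimately have "a \<noteq> 1" using not_prime_unit by fastforce
  then have a3: "3 \<le> a" using \<open>odd a\<close> by presburger
  obtain j where "j \<in> {i+1..t}" "p j = 2" using assms(10) by blast
  then have "even b" unfolding b_def by (metis dvd_prodI finite_atLeastAtMost)
  then obtain c where c: "b = 2 * c" by blast
  obtain m' where m': "g = b * m'" using assms(12) by (auto simp: b_def cong_0_iff)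
  then have "0 < c" "0 < m'" using assms(2) c by (auto intro: gr0I)
  \<comment> \<open>With \<open>m' = m + 1\<close> the colours have \<open>2 * m + 2\<close> first
    and \<open>c\<close> second coordinates, altogether
    \<open>2 * c * m' = b * m' = g\<close>.\<close>
  then obtain n m where n: "c = Suc n" and m: "m' = Suc m" by (metis gr0_implies_Suc)
  have "a dvd u - 1" using assms(1,11) by (metis One_nat_def Suc_leI a_def cong_altdef_nat)
  then obtain q where q: "u = a * q + 1" using assms(1) by (metis Suc_eq_plus1 Suc_pred' dvd_def)
  then have "0 < q" using False by (auto intro: gr0I)
  have "good (classes m (Suc n)) (colours m (Suc n)) (2 * a * Suc n) (a * q + 1)"
    by (rule good_general[OF \<open>odd a\<close> a3 \<open>0 < q\<close>])
  then have arc: "ARC (classes m c) (colours m c) k {..<u}"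
    by (simp add: good_def q kab c n ac_simps)
  have "card (colours m c) = g" by (simp add: card_colours m' m c)
  moreover have "finite (colours m c)" by (simp add: colours_def)
  ultimately obtain h where "bij_betw h (colours m c) {..<g}"
    using ex_bij_betw_finite_nat[of "colours m c"] by (auto simp: atLeast0LessThan)
  then have "ARC (classes m c) {..<g} k {..<u}"
    using ARC_transport[OF arc, of id "{..<u}" h "{..<g}"] by simp
  then show ?thesis
    by (rule ARC_imp_is_ARCS[OF finite_classes]) (use assms(1,2,4) False in auto)
qed

end
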